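(* Let $A,a>0$ and $M\in\mathbb N$. There exists a constant $C=C(A,a,M)>0$, depending only on $A$, $a$, $M$, such that the following holds. If $\mathcal E=(E_k)_{k\ge 1}$ is a sequence of nonempty closed sets $E_k\subset[-A,A]$ that is balanced with parameters $M,a$, then for every $r\in\mathbb N$ there exist a positive integer $n\le C r^2$ and coefficients $\varepsilon_k\in E_k$, $k=1,\dots,n$, such that the polynomial $$P_n(x)=1+\sum_{k=1}^n\varepsilon_k x^k$$ has at least $r$ distinct roots in $[0,1]$. Moreover, such a polynomial can be obtained by an explicit algorithm with running time polynomial in $r$, namely $\widetilde O(r^5)$.
   Context: A sequence $\mathcal E=(E_k)_{k\ge1}$ of uniformly bounded nonempty closed subsets of $\mathbb R$ is called balanced with parameters $M\in\mathbb N$, $a>0$ if for every integer $n\ge 0$ one has $$\sum_{k=1}^M \min E_{n+k}\le -a\quad\text{and}\quad \sum_{k=1}^M\max E_{n+k}\ge a .$$ $\mathcal P(\mathcal E)$ denotes the set of all polynomials $P_n(x)=1+\sum_{k=1}^n\varepsilon_kx^k$ with $\varepsilon_k\in E_k$; "degree $n$" refers to this form. The notation $\widetilde O(\cdot)$ means that factors logarithmic in $r$ are ignored; the implied constants may depend on $A,a,M$. Running time is counted in terms of fixed-point arithmetic: an elementary arithmetic operation on numbers with $O(r)$ digits costs $\widetilde O(r)$, and the numbers $\min E_k$, $\max E_k$ are available to the algorithm. *)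

theory Defs
  imports
    "HOL-Analysis.Analysis"
    "HOL-Computational_Algebra.Polynomial"
    "HOL-Library.Log_Nat"
begin

section \<open>Balanced sequences of sets and their polynomials\<close>

definition set_min :: "real set \<Rightarrow> real" where
  "set_min S = (LEAST x. x \<in> S)"

definition set_max :: "real set \<Rightarrow> real" where
  "set_max S = (GREATEST x. x \<in> S)"

lemma set_min_eq_Inf:
  assumes "closed S" "S \<noteq> {}" "bounded S"
  shows "set_min S = Inf S" "set_min S \<in> S"
proof -
  have "Inf S \<in> S"
    using assms by (intro closed_contains_Inf bounded_imp_bdd_below)
  moreover have "Inf S \<le> x" if "x \<in> S" for x
    using assms that by (intro cInf_lower bounded_imp_bdd_below)
  ultimately show "set_min S = Inf S"
    unfolding set_min_def by (intro Least_equality)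
  then show "set_min S \<in> S" using \<open>Inf S \<in> S\<close> by simp
qed

lemma set_max_eq_Sup:
  assumes "closed S" "S \<noteq> {}" "bounded S"
  shows "set_max S = Sup S" "set_max S \<in> S"
proof -
  have "Sup S \<in> S"
    using assms by (intro closed_contains_Sup bounded_imp_bdd_above)
  moreover have "x \<le> Sup S" if "x \<in> S" for x
    using assms that by (intro cSup_upper bounded_imp_bdd_above)
  ultimately show "set_max S = Sup S"
    unfolding set_max_def by (intro Greatest_equality)
  then show "set_max S \<in> S" using \<open>Sup S \<in> S\<close> by simp
qed

text \<open>A sequence \<open>(E\<^sub>k)\<close>, \<open>k \<ge> 1\<close>, is a function on \<^typ>\<open>nat\<close>
  whose value at \<open>0\<close> is irrelevant.\<close>

definition balanced :: "(nat \<Rightarrow> real set) \<Rightarrow> nat \<Rightarrow> real \<Rightarrow> bool" where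
  "balanced E M a \<longleftrightarrow>
     (\<forall>k\<ge>1. closed (E k) \<and> E k \<noteq> {}) \<and>
     (\<exists>B. \<forall>k\<ge>1. E k \<subseteq> {-B..B}) \<and>
     (\<forall>n. (\<Sum>k=1..M. set_min (E (n + k))) \<le> - a \<and>
          (\<Sum>k=1..M. set_max (E (n + k))) \<ge> a)"

definition coeff_poly :: "(nat \<Rightarrow> real) \<Rightarrow> nat \<Rightarrow> real poly" where
  "coeff_poly \<epsilon> n = 1 + (\<Sum>k=1..n. monom (\<epsilon> k) k)"

definition is_solution ::
    "real \<Rightarrow> (nat \<Rightarrow> real set) \<Rightarrow> nat \<Rightarrow> nat \<Rightarrow> (nat \<Rightarrow> real) \<Rightarrow> bool" where
  "is_solution C E r n \<epsilon> \<longleftrightarrow>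
     0 < n \<and> real n \<le> C * (real r)\<^sup>2 \<and>
     (\<forall>k\<in>{1..n}. \<epsilon> k \<in> E k) \<and>
     r \<le> card {x. 0 \<le> x \<and> x \<le> 1 \<and> poly (coeff_poly \<epsilon> n) x = 0}"


section \<open>Model of computation\<close>

text \<open>Programs of a while language over integer arrays, with digit-length costs.
  A fixed-point number \<open>m / 2\<^sup>p\<close> is held as the integer \<open>m\<close>, so that addition,
  multiplication and division of fixed-point numbers are integer operations up to
  a rescaling by \<open>2\<^sup>p\<close>.  An elementary operation is charged the total number of
  binary digits of the numbers involved; the logarithmic factors of fast
  multiplication and division are left to the polylogarithmic factor of the time
  bound.  Every variable is an infinite integer array; scalars live in cell \<open>0\<close>.\<close>

type_synonym vname = string
type_synonym store = "vname \<Rightarrow> int \<Rightarrow> int"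

text \<open>\<open>Query_min k p\<close> and \<open>Query_max k p\<close> read the two available numbers belonging
  to the index \<open>k\<close>, rounded down to \<open>p\<close> binary places.\<close>

datatype aexp =
    Lit int
  | Cell vname aexp
  | Add aexp aexp
  | Sub aexp aexp
  | Mul aexp aexp
  | Div aexp aexp
  | Query_min aexp aexp
  | Query_max aexp aexp

datatype com =
    Skip
  | Assign vname aexp aexp
  | Seq com com
  | IfLess aexp aexp com com
  | WhileLess aexp aexp com

definition digits :: "int \<Rightarrow> nat" where
  "digits x = 1 + nat (bitlen \<bar>x\<bar>)"

definition fixed_point :: "nat \<Rightarrow> real \<Rightarrow> int" where
  "fixed_point p x = \<lfloor>2 ^ p * x\<rfloor>"

fun aval :: "(nat \<Rightarrow> real) \<Rightarrow> (nat \<Rightarrow> real) \<Rightarrow> store \<Rightarrow> aexp \<Rightarrow> int" where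
  "aval lo hi s (Lit c) = c"
| "aval lo hi s (Cell x i) = s x (aval lo hi s i)"
| "aval lo hi s (Add e f) = aval lo hi s e + aval lo hi s f"
| "aval lo hi s (Sub e f) = aval lo hi s e - aval lo hi s f"
| "aval lo hi s (Mul e f) = aval lo hi s e * aval lo hi s f"
| "aval lo hi s (Div e f) = aval lo hi s e div aval lo hi s f"
| "aval lo hi s (Query_min k p) =
     fixed_point (nat (aval lo hi s p)) (lo (nat (aval lo hi s k)))"
| "aval lo hi s (Query_max k p) =
     fixed_point (nat (aval lo hi s p)) (hi (nat (aval lo hi s k)))"

text \<open>Queries are charged for the precision \<open>p\<close> itself, not for the number of its
  digits.\<close>

fun acost :: "(nat \<Rightarrow> real) \<Rightarrow> (nat \<Rightarrow> real) \<Rightarrow> store \<Rightarrow> aexp \<Rightarrow> nat" where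
  "acost lo hi s (Lit c) = digits c"
| "acost lo hi s (Cell x i) =
     acost lo hi s i + digits (aval lo hi s i) + digits (aval lo hi s (Cell x i))"
| "acost lo hi s (Add e f) =
     acost lo hi s e + acost lo hi s f + digits (aval lo hi s e) + digits (aval lo hi s f)"
| "acost lo hi s (Sub e f) =
     acost lo hi s e + acost lo hi s f + digits (aval lo hi s e) + digits (aval lo hi s f)"
| "acost lo hi s (Mul e f) =
     acost lo hi s e + acost lo hi s f + digits (aval lo hi s e) + digits (aval lo hi s f)"
| "acost lo hi s (Div e f) =
     acost lo hi s e + acost lo hi s f + digits (aval lo hi s e) + digits (aval lo hi s f)"
| "acost lo hi s (Query_min k p) =
     acost lo hi s k + acost lo hi s p + digits (aval lo hi s k) + digits (aval lo hi s p) +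
     nat (aval lo hi s p) + digits (aval lo hi s (Query_min k p))"
| "acost lo hi s (Query_max k p) =
     acost lo hi s k + acost lo hi s p + digits (aval lo hi s k) + digits (aval lo hi s p) +
     nat (aval lo hi s p) + digits (aval lo hi s (Query_max k p))"

definition test_cost :: "(nat \<Rightarrow> real) \<Rightarrow> (nat \<Rightarrow> real) \<Rightarrow> store \<Rightarrow> aexp \<Rightarrow> aexp \<Rightarrow> nat" where
  "test_cost lo hi s e f =
     acost lo hi s e + acost lo hi s f + digits (aval lo hi s e) + digits (aval lo hi s f)"

text \<open>\<open>exec lo hi c s t s'\<close>: started in \<open>s\<close>, the program \<open>c\<close> halts in \<open>s'\<close> after
  time \<open>t\<close>.\<close>

inductive exec ::
    "(nat \<Rightarrow> real) \<Rightarrow> (nat \<Rightarrow> real) \<Rightarrow> com \<Rightarrow> store \<Rightarrow> nat \<Rightarrow> store \<Rightarrow> bool"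
  for lo hi where
  Skip: "exec lo hi Skip s 1 s"
| Assign: "exec lo hi (Assign x i e) s
     (acost lo hi s i + acost lo hi s e + digits (aval lo hi s i) + digits (aval lo hi s e))
     (s(x := (s x)(aval lo hi s i := aval lo hi s e)))"
| Seq: "exec lo hi c s t s' \<Longrightarrow> exec lo hi d s' t' s'' \<Longrightarrow>
     exec lo hi (Seq c d) s (t + t') s''"
| IfTrue: "aval lo hi s e < aval lo hi s f \<Longrightarrow> exec lo hi c s t s' \<Longrightarrow>
     exec lo hi (IfLess e f c d) s (test_cost lo hi s e f + t) s'"
| IfFalse: "\<not> aval lo hi s e < aval lo hi s f \<Longrightarrow> exec lo hi d s t s' \<Longrightarrow>
     exec lo hi (IfLess e f c d) s (test_cost lo hi s e f + t) s'"
| WhileTrue: "aval lo hi s e < aval lo hi s f \<Longrightarrow> exec lo hi c s t s' \<Longrightarrow>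
     exec lo hi (WhileLess e f c) s' t' s'' \<Longrightarrow>
     exec lo hi (WhileLess e f c) s (test_cost lo hi s e f + t + t') s''"
| WhileFalse: "\<not> aval lo hi s e < aval lo hi s f \<Longrightarrow>
     exec lo hi (WhileLess e f c) s (test_cost lo hi s e f) s"

inductive_cases exec_SkipE: "exec lo hi Skip s t s'"
inductive_cases exec_AssignE: "exec lo hi (Assign x i e) s t s'"
inductive_cases exec_SeqE: "exec lo hi (Seq c d) s t s'"
inductive_cases exec_IfE: "exec lo hi (IfLess e f c d) s t s'"
inductive_cases exec_WhileE: "exec lo hi (WhileLess e f c) s t s'"

lemma exec_deterministic:
  "exec lo hi c s t s' \<Longrightarrow> exec lo hi c s u s'' \<Longrightarrow> u = t \<and> s'' = s'"
proof (induction arbitrary: u s'' rule: exec.induct)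
  case (Skip s)
  then show ?case by (auto elim: exec_SkipE)
next
  case (Assign x i e s)
  then show ?case by (auto elim: exec_AssignE)
next
  case (Seq c s t s' d t' s'')
  then show ?case by (blast elim: exec_SeqE)
next
  case (IfTrue s e f c t s' d)
  then show ?case by (blast elim: exec_IfE)
next
  case (IfFalse s e f d t s' c)
  then show ?case by (blast elim: exec_IfE)
next
  case (WhileTrue s e f c t s' t' s'')
  then show ?case by (blast elim: exec_WhileE)
next
  case (WhileFalse s e f c)
  then show ?case by (blast elim: exec_WhileE)
qed

definition input_store :: "nat \<Rightarrow> store" where
  "input_store r = (\<lambda>x i. if x = ''r'' \<and> i = 0 then int r else 0)"

definition output_degree :: "store \<Rightarrow> nat" where
  "output_degree s = nat (s ''n'' 0)"

text \<open>The real numbers known to the algorithm are the minima and maxima of the sets,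
  so it specifies a coefficient by a choice between these two.\<close>

definition output_coeff :: "(nat \<Rightarrow> real set) \<Rightarrow> store \<Rightarrow> nat \<Rightarrow> real" where
  "output_coeff E s k =
     (if s ''eps'' (int k) = 0 then set_min (E k) else set_max (E k))"

definition run_on ::
    "com \<Rightarrow> (nat \<Rightarrow> real set) \<Rightarrow> nat \<Rightarrow> nat \<Rightarrow> store \<Rightarrow> bool" where
  "run_on prog E r t s \<longleftrightarrow>
     exec (\<lambda>k. set_min (E k)) (\<lambda>k. set_max (E k)) prog (input_store r) t s"

end

theory Submission
  imports Defs
begin

text \<open>
  The coefficients are found by sigma-delta quantisation.  They are chosen one after the other in
  such a way that, up to truncation and rounding, \<open>P = F + Q g\<close>.  Here \<open>F\<close> is a target polynomial
  with small real coefficients and prescribed sign changes at \<open>r + 1\<close> test points, \<open>g\<close> is a power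
  series with bounded coefficients (the state of the quantiser), and \<open>Q\<close> is a sparse polynomial with
  \<open>Q(0) = 1\<close> that is extremely small at the test points.  There \<open>P\<close> has the signs of \<open>F\<close>, and the
  intermediate value theorem gives \<open>r\<close> roots.

  Everything happens at distance of order \<open>1/r\<close> from the point 1.  With \<open>q\<close> a constant multiple of \<open>r\<close>,
  the target is \<open>F = (\<Prod>l=1..r. 4 r x^q - (r + l)) / (d (8 r)^r)\<close>, and the test points are those with
  \<open>x^q = (r + j + 1/2) / (4 r)\<close>.  At them \<open>\<bar>F\<bar> \<ge> 1 / (d 128^r)\<close> (\<open>half_odd_product\<close>,
  \<open>power_self_le_fact\<close>), which is only exponentially small in \<open>r\<close>, while \<open>x^n \<le> 2^(- \<kappa> r)\<close> when
  \<open>n\<close> is a suitable multiple of \<open>r\<^sup>2\<close>.  This is where the degree \<open>O(r\<^sup>2)\<close> comes from.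

  The filter \<open>Q\<close> has the exponents \<open>0\<close>, \<open>1\<close> and \<open>c i\<^sup>2\<close> for \<open>1 \<le> i \<le> m = \<kappa> r\<close>, and the weights that make
  it vanish to order \<open>m + 1\<close> at 1.  Because the exponents grow quadratically, these weights stay
  bounded; \<open>Q\<close> differs from \<open>1 - x\<close> only by weights of total size \<open>O(1/c)\<close> (\<open>tap_abs_sum_le\<close>), and
  nevertheless \<open>\<bar>Q\<bar> \<le> 2^(- \<kappa> r)\<close> at the test points (\<open>filter_fun_bound\<close>, \<open>node_exists\<close>).

  Since \<open>Q\<close> is nearly \<open>1 - x\<close>, the state obeys \<open>g k = g (k - 1) + \<epsilon> k + disturbance\<close> with a small
  disturbance.  Taking the minimum of \<open>E k\<close> when the state is nonnegative and the maximum when it is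
  negative keeps the state bounded: over \<open>M\<close> consecutive steps the balance condition moves it towards
  0 by \<open>a\<close>, which outweighs the disturbance (\<open>greedy_bound\<close>).

  The recursion can be run in fixed-point arithmetic with \<open>2 \<kappa> r\<close> binary places, for whatever is
  rounded away in step \<open>k\<close> only contributes an error term \<open>e k x^k\<close> to \<open>P\<close>.  The program performs
  \<open>O(r\<^sup>3)\<close> assignments and tests on integers with \<open>O(r\<^sup>2)\<close> digits, and so takes time \<open>O(r\<^sup>5)\<close>.
\<close>
section \<open>A filter that is tiny near the point 1\<close>

text \<open>The quotient of binomial coefficients \<open>(2m choose (m + i)) / (2m choose m)\<close>.  The recursion in \<open>i\<close>
  is the form in which the program computes it.\<close>

fun central_ratio :: "nat \<Rightarrow> nat \<Rightarrow> real" where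
  "central_ratio m 0 = 1"
| "central_ratio m (Suc i) = central_ratio m i * (real m - real i) / real (m + i + 1)"

text \<open>Comparing order \<open>m\<close> with order \<open>m + 1\<close> is what turns the alternating sums below into the
  solutions of a chain of differential equations.\<close>

lemma central_ratio_lower_order:
  "central_ratio m i * (real m + 1)\<^sup>2 = central_ratio (Suc m) i * ((real m + 1)\<^sup>2 - (real i)\<^sup>2)"
proof (induction i)
  case 0
  then show ?case by simp
next
  case (Suc i)
  have pos: "real m + real i + 1 \<noteq> 0" "real m + real i + 2 \<noteq> 0" by linarith+
  have "central_ratio m (Suc i) * (real m + 1)\<^sup>2
      = (central_ratio m i * (real m + 1)\<^sup>2) * (real m - real i) / (real m + real i + 1)"
    by (simp add: algebra_simps)
  also have "\<dots> = central_ratio (Suc m) i * ((real m + 1)\<^sup>2 - (real i)\<^sup>2) * (real m - real i) / (real m + real i + 1)"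
    unfolding Suc.IH ..
  also have "(real m + 1)\<^sup>2 - (real i)\<^sup>2 = (real m + 1 - real i) * (real m + real i + 1)"
    by (simp add: power2_eq_square algebra_simps)
  also have "central_ratio (Suc m) i * ((real m + 1 - real i) * (real m + real i + 1)) * (real m - real i) / (real m + real i + 1)
     = central_ratio (Suc m) i * (real m + 1 - real i) / (real m + real i + 2) * ((real m - real i) * (real m + real i + 2))"
    using pos by (simp add: field_simps)
  also have "central_ratio (Suc m) i * (real m + 1 - real i) / (real m + real i + 2) = central_ratio (Suc m) (Suc i)"
    by (simp add: algebra_simps)
  also have "(real m - real i) * (real m + real i + 2) = (real m + 1)\<^sup>2 - (real (Suc i))\<^sup>2"
    by (simp add: power2_eq_square algebra_simps)
  finally show ?case .
qed

lemma central_ratio_bounds: "i \<le> m \<Longrightarrow> 0 \<le> central_ratio m i \<and> central_ratio m i \<le> 1"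
proof (induction i)
  case (Suc i)
  then have IH: "0 \<le> central_ratio m i" "central_ratio m i \<le> 1" by auto
  have f: "0 \<le> (real m - real i) / real (m + i + 1)" "(real m - real i) / real (m + i + 1) \<le> 1"
    using Suc.prems by (auto simp: divide_simps)
  have "central_ratio m (Suc i) = central_ratio m i * ((real m - real i) / real (m + i + 1))" by simp
  then show ?case using IH f by (metis mult_nonneg_nonneg mult_le_one)
qed simp

text \<open>A truncated Jacobi theta function in \<open>x = exp (- s)\<close>, namely
  \<open>\<Sum>i=-m..m. (-1)^i (2m choose (m + i)) x^(i\<^sup>2) / (2m choose m)\<close>, which vanishes to order \<open>m\<close> at \<open>x = 1\<close>.\<close>

definition theta :: "nat \<Rightarrow> real \<Rightarrow> real" where
  "theta m s = 1 + 2 * (\<Sum>i=1..m. (-1) ^ i * central_ratio m i * exp (- ((real i)\<^sup>2 * s)))"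

text \<open>The partial sums telescope, and the closed form shows that the full sum is 0.\<close>

lemma theta_partial_sum_at_0:
  assumes "m > 0"
  shows "1 + 2 * (\<Sum>i=1..I. (-1) ^ i * central_ratio m i)
    = (-1) ^ I * central_ratio m I * (real m - real I) / real m"
proof (induction I)
  case 0
  then show ?case using assms by simp
next
  case (Suc I)
  have pos: "real m + real I + 1 \<noteq> 0" "real m \<noteq> 0" using assms by linarith+
  have e: "central_ratio m I * (real m - real I) = central_ratio m (Suc I) * (real m + real I + 1)"
    using pos(1) by (simp add: field_simps)
  have "1 + 2 * (\<Sum>i=1..Suc I. (-1) ^ i * central_ratio m i)
     = (-1) ^ I * (central_ratio m I * (real m - real I)) / real m - 2 * (-1) ^ I * central_ratio m (Suc I)"
    using Suc.IH by (simp del: central_ratio.simps add: algebra_simps)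
  also have "\<dots> = (-1) ^ Suc I * central_ratio m (Suc I) * (real m - real (Suc I)) / real m"
    unfolding e using pos(2) by (simp del: central_ratio.simps add: field_simps)
  finally show ?case .
qed

lemma theta_at_0: "m > 0 \<Longrightarrow> theta m 0 = 0"
  using theta_partial_sum_at_0[of m m] by (simp add: theta_def)

text \<open>A relaxation equation: \<open>theta (m + 1)\<close> follows \<open>theta m\<close> at rate \<open>(m + 1)\<^sup>2\<close>.  Probabilistically,
  \<open>theta m\<close> is the distribution function of a sum of independent exponential variables of rates
  \<open>1\<^sup>2, \<dots>, m\<^sup>2\<close>, which explains both its positivity and its smallness near 0.\<close>

lemma theta_deriv:
  "(theta (Suc m) has_real_derivative (real m + 1)\<^sup>2 * (theta m s - theta (Suc m) s)) (at s)"
proof -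
  let ?e = "\<lambda>i::nat. exp (- ((real i)\<^sup>2 * s))"
  let ?v = "central_ratio (Suc m)"
  have "(theta (Suc m) has_real_derivative
      2 * (\<Sum>i=1..Suc m. (-1) ^ i * ?v i * (?e i * - (real i)\<^sup>2))) (at s)"
    unfolding theta_def by (auto intro!: derivative_eq_intros sum.cong simp del: central_ratio.simps sum.cl_ivl_Suc simp: algebra_simps)
  moreover have "2 * (\<Sum>i=1..Suc m. (-1) ^ i * ?v i * (?e i * - (real i)\<^sup>2))
     = (real m + 1)\<^sup>2 * (theta m s - theta (Suc m) s)"
  proof -
    have "(\<Sum>i=1..m. (-1) ^ i * central_ratio m i * ?e i) = (\<Sum>i=1..Suc m. (-1) ^ i * central_ratio m i * ?e i)"
      by simp
    then have "(real m + 1)\<^sup>2 * (theta m s - theta (Suc m) s)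
      = 2 * (\<Sum>i=1..Suc m. (real m + 1)\<^sup>2 * ((-1) ^ i * central_ratio m i * ?e i - (-1) ^ i * ?v i * ?e i))"
      unfolding theta_def sum_subtractf sum_distrib_left[symmetric] right_diff_distrib[symmetric] by simp
    also have "\<dots> = 2 * (\<Sum>i=1..Suc m. (-1) ^ i * ?v i * (?e i * - (real i)\<^sup>2))"
    proof -
      have "(real m + 1)\<^sup>2 * ((-1) ^ i * central_ratio m i * ?e i - (-1) ^ i * ?v i * ?e i)
         = (-1) ^ i * ?v i * (?e i * - (real i)\<^sup>2)" for i
      proof -
        have "(real m + 1)\<^sup>2 * ((-1) ^ i * central_ratio m i * ?e i - (-1) ^ i * ?v i * ?e i)
          = (-1) ^ i * ?e i * (central_ratio m i * (real m + 1)\<^sup>2 - ?v i * (real m + 1)\<^sup>2)"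
          by (simp add: algebra_simps)
        also have "\<dots> = (-1) ^ i * ?v i * (?e i * - (real i)\<^sup>2)"
          unfolding central_ratio_lower_order by (simp add: algebra_simps)
        finally show ?thesis .
      qed
      then show ?thesis by simp
    qed
    finally show ?thesis ..
  qed
  ultimately show ?thesis by simp
qed

text \<open>A function that starts at 0 and relaxes towards a nonnegative \<open>g\<close> stays nonnegative, so its derivative is
  at most \<open>t g\<close>; hence every relaxation gains one order of vanishing at 0.\<close>

lemma relaxation_bound:
  fixes f g :: "real \<Rightarrow> real"
  assumes der: "\<And>s. s \<ge> 0 \<Longrightarrow> (f has_real_derivative t * (g s - f s)) (at s)"
    and f0: "f 0 = 0" and t: "t \<ge> 0"
    and g: "\<And>s. s \<ge> 0 \<Longrightarrow> 0 \<le> g s \<and> g s \<le> K * s ^ k"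
    and s: "s \<ge> 0"
  shows "0 \<le> f s \<and> f s \<le> t * K * s ^ Suc k / real (Suc k)"
proof -
  have nonneg: "0 \<le> f x" if "x \<ge> 0" for x
  proof -
    have "exp (t * 0) * f 0 \<le> exp (t * x) * f x"
    proof (rule DERIV_nonneg_imp_nondecreasing[OF that])
      fix y assume y: "0 \<le> y" "y \<le> x"
      have "((\<lambda>x. exp (t * x) * f x) has_real_derivative exp (t * y) * (t * g y)) (at y)"
        by (rule derivative_eq_intros der[OF y(1)] refl | simp add: algebra_simps)+
      moreover have "exp (t * y) * (t * g y) \<ge> 0" using g y(1) t by simp
      ultimately show "\<exists>d. ((\<lambda>x. exp (t * x) * f x) has_real_derivative d) (at y) \<and> 0 \<le> d" by blast
    qed
    then show ?thesis using f0 by (simp add: zero_le_mult_iff)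
  qed
  have "t * K * 0 ^ Suc k / real (Suc k) - f 0 \<le> t * K * s ^ Suc k / real (Suc k) - f s"
  proof (rule DERIV_nonneg_imp_nondecreasing[OF s])
    fix y assume y: "0 \<le> y" "y \<le> s"
    have "((\<lambda>x. t * K * x ^ Suc k / real (Suc k) - f x) has_real_derivative
        t * K * y ^ k - t * (g y - f y)) (at y)"
      by (rule derivative_eq_intros der[OF y(1)] refl | simp)+
    moreover have "t * (g y - f y) \<le> t * (K * y ^ k)"
      using g[OF y(1)] nonneg[OF y(1)] t by (intro mult_left_mono) auto
    ultimately show "\<exists>d. ((\<lambda>x. t * K * x ^ Suc k / real (Suc k) - f x) has_real_derivative d) (at y) \<and> 0 \<le> d"
      by (intro exI conjI) (assumption, simp add: algebra_simps)
  qed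
  then show ?thesis using f0 nonneg[OF s] by simp
qed

lemma theta_bound: "s \<ge> 0 \<Longrightarrow> 0 \<le> theta m s \<and> theta m s \<le> fact m * s ^ m"
proof (induction m arbitrary: s)
  case 0
  then show ?case by (simp add: theta_def)
next
  case (Suc m)
  have "0 \<le> theta (Suc m) s \<and> theta (Suc m) s \<le> (real m + 1)\<^sup>2 * fact m * s ^ Suc m / real (Suc m)"
    by (rule relaxation_bound[where g = "theta m"]) (auto simp: theta_deriv theta_at_0 Suc)
  also have "(real m + 1)\<^sup>2 * fact m * s ^ Suc m / real (Suc m) = fact (Suc m) * s ^ Suc m"
    by (simp add: field_simps power2_eq_square)
  finally show ?case .
qed

text \<open>The weights for which \<open>filter_fun\<close> relaxes towards \<open>theta m (c s)\<close> at rate 1: in the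
  variable \<open>x = exp (- s)\<close> the weight at the exponent \<open>t = c i\<^sup>2\<close> has to be the weight of \<open>theta\<close> there
  divided by \<open>1 - t\<close>.\<close>

definition tap :: "nat \<Rightarrow> nat \<Rightarrow> nat \<Rightarrow> real" where
  "tap m c i = 2 * (-1) ^ i * central_ratio m i / (1 - real c * (real i)\<^sup>2)"

text \<open>The weight at the exponent 1 is written as minus the sum of all others, which makes the filter
  vanish at 1 without a separate formula for that weight.\<close>

definition filter_fun :: "nat \<Rightarrow> nat \<Rightarrow> real \<Rightarrow> real" where
  "filter_fun m c x = 1 - x + (\<Sum>i=1..m. tap m c i * (x ^ (c * i\<^sup>2) - x))"

text \<open>The last relaxation of the chain, at rate 1, applied to \<open>theta\<close> on the time scale \<open>c s\<close>.\<close>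

lemma filter_fun_bound:
  assumes c: "c \<ge> 2" and s: "s \<ge> 0"
  shows "0 \<le> filter_fun m c (exp (- s)) \<and>
    filter_fun m c (exp (- s)) \<le> real c ^ m * fact m * s ^ Suc m / real (Suc m)"
proof -
  define h where "h s = filter_fun m c (exp (- s))" for s
  have h_eq: "h s = 1 - exp (-s) + (\<Sum>i=1..m. tap m c i * (exp (- (real c * (real i)\<^sup>2 * s)) - exp (-s)))" for s
    unfolding h_def filter_fun_def
    by (simp add: exp_of_nat_mult[symmetric] algebra_simps)
  have tap: "tap m c i * (1 - real c * (real i)\<^sup>2) = 2 * (-1) ^ i * central_ratio m i" if "i \<ge> 1" for i
  proof -
    have "real c * (real i)\<^sup>2 \<ge> 2 * 1" using c that by (intro mult_mono) auto
    then show ?thesis unfolding tap_def by simp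
  qed
  have der: "(h has_real_derivative 1 * (theta m (real c * s) - h s)) (at s)" for s
  proof -
    let ?e = "\<lambda>i::nat. exp (- (real c * (real i)\<^sup>2 * s))"
    have "(h has_real_derivative exp (-s) + (\<Sum>i=1..m. tap m c i * (- (real c * (real i)\<^sup>2) * ?e i + exp (-s)))) (at s)"
      unfolding h_eq by (auto intro!: derivative_eq_intros sum.cong simp: algebra_simps)
    moreover have "(exp (-s) + (\<Sum>i=1..m. tap m c i * (- (real c * (real i)\<^sup>2) * ?e i + exp (-s)))) + h s
        = theta m (real c * s)"
    proof -
      have "(\<Sum>i=1..m. tap m c i * (- (real c * (real i)\<^sup>2) * ?e i + exp (-s))) + (\<Sum>i=1..m. tap m c i * (?e i - exp (-s)))
         = (\<Sum>i=1..m. (tap m c i * (1 - real c * (real i)\<^sup>2)) * ?e i)"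
        unfolding sum.distrib[symmetric] by (intro sum.cong) (auto simp: algebra_simps)
      also have "\<dots> = (\<Sum>i=1..m. 2 * (-1) ^ i * central_ratio m i * ?e i)"
        by (intro sum.cong) (auto simp: tap)
      also have "\<dots> = 2 * (\<Sum>i=1..m. (-1) ^ i * central_ratio m i * exp (- ((real i)\<^sup>2 * (real c * s))))"
        unfolding sum_distrib_left by (intro sum.cong) (auto simp: algebra_simps)
      finally show ?thesis unfolding h_eq theta_def by simp
    qed
    ultimately show ?thesis
      by (metis (no_types, lifting) add_diff_cancel_right' mult_1)
  qed
  have "0 \<le> h s \<and> h s \<le> 1 * (real c ^ m * fact m) * s ^ Suc m / real (Suc m)"
  proof (rule relaxation_bound[where g = "\<lambda>s. theta m (real c * s)"])
    show "h 0 = 0" unfolding h_eq by simp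
    show "0 \<le> theta m (real c * y) \<and> theta m (real c * y) \<le> real c ^ m * fact m * y ^ m" if "y \<ge> 0" for y
      using theta_bound[of "real c * y" m] that by (simp add: power_mult_distrib algebra_simps)
  qed (use der s in auto)
  then show ?thesis unfolding h_def by simp
qed

lemma sum_inverse_squares_le: "(\<Sum>i=1..m. 1 / (real i)\<^sup>2) \<le> 2"
proof -
  have "(\<Sum>i=1..m. 1 / (real i)\<^sup>2) \<le> 2 - 1 / real m" if "m \<ge> 1"
    using that
  proof (induction m rule: dec_induct)
    case (step m)
    have "1 / (real (Suc m))\<^sup>2 \<le> 1 / (real m * real (Suc m))"
      using step by (intro divide_left_mono) (auto simp: power2_eq_square)
    also have "\<dots> = 1 / real m - 1 / real (Suc m)" using step by (simp add: field_simps)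
    finally show ?case using step by simp
  qed simp
  then show ?thesis by (cases m) (auto intro: order.trans)
qed

text \<open>The bound decays like \<open>1 / i\<^sup>2\<close> because of the division by \<open>1 - c i\<^sup>2\<close>; this summability is what
  the additional exponent 1 buys.\<close>

lemma tap_abs_le:
  assumes "c \<ge> 2" "1 \<le> i" "i \<le> m"
  shows "\<bar>tap m c i\<bar> \<le> 4 / (real c * (real i)\<^sup>2)"
proof -
  have ci: "real c * (real i)\<^sup>2 \<ge> 2 * 1" using assms by (intro mult_mono) auto
  have "\<bar>tap m c i\<bar> = 2 * central_ratio m i / (real c * (real i)\<^sup>2 - 1)"
    using ci central_ratio_bounds[of i m] assms unfolding tap_def
    by (simp add: abs_mult power_abs)
  also have "\<dots> \<le> 2 * 1 / (real c * (real i)\<^sup>2 / 2)"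
    using ci central_ratio_bounds[of i m] assms by (intro frac_le) auto
  finally show ?thesis by simp
qed

lemma tap_abs_sum_le:
  assumes "c \<ge> 2"
  shows "(\<Sum>i=1..m. \<bar>tap m c i\<bar>) \<le> 8 / real c"
proof -
  have "(\<Sum>i=1..m. \<bar>tap m c i\<bar>) \<le> (\<Sum>i=1..m. 4 / real c * (1 / (real i)\<^sup>2))"
    using tap_abs_le[OF assms] by (intro sum_mono) auto
  also have "\<dots> \<le> 4 / real c * 2"
    unfolding sum_distrib_left[symmetric] by (intro mult_left_mono sum_inverse_squares_le) auto
  finally show ?thesis by simp
qed

section \<open>Filtering a bounded sequence\<close>

text \<open>Delaying a sequence by \<open>t\<close> multiplies its generating function by \<open>x^t\<close>, up to the terms that the
  delay pushes beyond the degree \<open>n\<close>.\<close>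

lemma shifted_sum_truncation:
  fixes g :: "nat \<Rightarrow> real"
  assumes x: "0 \<le> x" "x < 1" and g: "\<And>k. k \<le> n \<Longrightarrow> \<bar>g k\<bar> \<le> B"
  shows "\<bar>(\<Sum>k\<le>n. x ^ k * (if t \<le> k then g (k - t) else 0)) - x ^ t * (\<Sum>k\<le>n. x ^ k * g k)\<bar>
    \<le> B * x ^ n / (1 - x)"
proof -
  have B: "B \<ge> 0" using g[of 0] by simp
  have "(\<Sum>k\<le>n. x ^ k * (if t \<le> k then g (k - t) else 0)) = (\<Sum>k\<in>{t..n}. x ^ k * g (k - t))"
    by (rule sum.mono_neutral_cong_right) auto
  also have "\<dots> = (\<Sum>j\<in>{j. t + j \<le> n}. x ^ (t + j) * g j)"
    by (rule sum.reindex_bij_witness[where i = "\<lambda>j. t + j" and j = "\<lambda>k. k - t"]) auto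
  finally have 1: "(\<Sum>k\<le>n. x ^ k * (if t \<le> k then g (k - t) else 0)) = (\<Sum>j\<in>{j. t + j \<le> n}. x ^ (t + j) * g j)" .
  have "x ^ t * (\<Sum>k\<le>n. x ^ k * g k) = (\<Sum>j\<le>n. x ^ (t + j) * g j)"
    by (simp add: sum_distrib_left power_add algebra_simps)
  also have "\<dots> = (\<Sum>j\<in>{j. t + j \<le> n}. x ^ (t + j) * g j) + (\<Sum>j\<in>{j. j \<le> n \<and> n < t + j}. x ^ (t + j) * g j)"
    by (subst sum.union_disjoint[symmetric]) (auto intro: sum.cong finite_subset[of _ "{..n}"])
  finally have 2: "x ^ t * (\<Sum>k\<le>n. x ^ k * g k) = \<dots>" .
  have "\<bar>\<Sum>j\<in>{j. j \<le> n \<and> n < t + j}. x ^ (t + j) * g j\<bar> \<le> (\<Sum>j\<in>{j. j \<le> n \<and> n < t + j}. B * x ^ (t + j))"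
    using x g B by (intro order.trans[OF sum_abs] sum_mono) (auto simp: abs_mult mult.commute[of B] intro!: mult_left_mono)
  also have "\<dots> = (\<Sum>i\<in>(\<lambda>j. t + j) ` {j. j \<le> n \<and> n < t + j}. B * x ^ i)"
    by (subst sum.reindex) auto
  also have "\<dots> \<le> (\<Sum>i\<in>{n..<n + t + 1}. B * x ^ i)"
    using x B by (intro sum_mono2) auto
  also have "\<dots> = B * x ^ n * (\<Sum>i<t + 1. x ^ i)"
    using sum.shift_bounds_nat_ivl[of "\<lambda>i. B * x ^ i" 0 n "t + 1"]
    by (simp add: sum_distrib_left power_add algebra_simps lessThan_atLeast0)
  also have "(\<Sum>i<t + 1. x ^ i) \<le> 1 / (1 - x)"
  proof -
    have "(\<Sum>i<t + 1. x ^ i) = (1 - x ^ (t + 1)) / (1 - x)"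
      using x by (subst sum_gp_strict) auto
    then show ?thesis using x by (simp add: divide_right_mono)
  qed
  finally show ?thesis unfolding 1 2 using x B by (simp add: mult_left_mono)
qed

text \<open>The identity \<open>P = F + Q g - e\<close> for truncated generating functions.  The three contributions to the error
  are \<open>Q\<close> times the generating function of the state, the truncation of the delayed states, and the
  rounding errors.\<close>

lemma filtered_error_bound:
  fixes g \<epsilon> f e w :: "nat \<Rightarrow> real" and T :: "nat \<Rightarrow> nat"
  assumes x: "0 \<le> x" "x < 1" and g: "\<And>k. k \<le> n \<Longrightarrow> \<bar>g k\<bar> \<le> B"
    and e: "\<And>k. k \<le> n \<Longrightarrow> \<bar>e k\<bar> \<le> err"
    and w: "(\<Sum>i=1..m. \<bar>w i\<bar>) \<le> 1 / 2" and T: "\<And>i. i \<in> {1..m} \<Longrightarrow> 1 \<le> T i"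
    and g0: "g 0 = \<epsilon> 0 - f 0 + e 0"
    and rec: "\<And>k. Suc k \<le> n \<Longrightarrow> g (Suc k) = g k + \<epsilon> (Suc k) - f (Suc k) + e (Suc k)
      - (\<Sum>i=1..m. w i * ((if T i \<le> Suc k then g (Suc k - T i) else 0) - g k))"
  shows "\<bar>(\<Sum>k\<le>n. \<epsilon> k * x ^ k) - (\<Sum>k\<le>n. f k * x ^ k)\<bar>
    \<le> (\<bar>1 - x + (\<Sum>i=1..m. w i * (x ^ T i - x))\<bar> * B + 2 * B * x ^ n + err) / (1 - x)"
proof -
  define G where "G = (\<Sum>k\<le>n. x ^ k * g k)"
  define sh where "sh t k = (if t \<le> k then g (k - t) else 0)" for t k
  define conv where "conv t = (\<Sum>k\<le>n. x ^ k * sh t k)" for t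
  define \<tau> where "\<tau> = B * x ^ n / (1 - x)"
  have conv: "\<bar>conv t - x ^ t * G\<bar> \<le> \<tau>" for t
    unfolding conv_def sh_def G_def \<tau>_def using shifted_sum_truncation[OF x g] .
  have B: "B \<ge> 0" and err: "err \<ge> 0" using g[of 0] e[of 0] by auto
  then have tau: "\<tau> \<ge> 0" unfolding \<tau>_def using x by simp
  have geom: "(\<Sum>k\<le>n. x ^ k) \<le> 1 / (1 - x)"
  proof -
    have "(\<Sum>k\<le>n. x ^ k) = (1 - x ^ Suc n) / (1 - x)"
      using x by (simp add: sum_gp0)
    then show ?thesis using x by (simp add: divide_right_mono)
  qed
  \<comment> \<open>The delays of at least 1 contribute nothing at time 0, so the initial value obeys the same
    relation as the recursion.\<close>
  have pt: "\<epsilon> k - f k + e k = sh 0 k - sh 1 k + (\<Sum>i=1..m. w i * (sh (T i) k - sh 1 k))" if "k \<le> n" for k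
  proof (cases k)
    case 0
    have "(\<Sum>i=1..m. w i * (sh (T i) 0 - sh 1 0)) = 0"
      using T by (intro sum.neutral) (force simp: sh_def)
    then show ?thesis using 0 g0 by (simp add: sh_def)
  next
    case (Suc j)
    then show ?thesis using rec[of j] that by (simp add: sh_def)
  qed
  have "(\<Sum>k\<le>n. x ^ k * (\<epsilon> k - f k + e k)) = conv 0 - conv 1 + (\<Sum>i=1..m. w i * (conv (T i) - conv 1))"
  proof -
    have "x ^ k * (\<epsilon> k - f k + e k)
      = x ^ k * sh 0 k - x ^ k * sh 1 k + (\<Sum>i=1..m. w i * (x ^ k * sh (T i) k - x ^ k * sh 1 k))" if "k \<le> n" for k
      unfolding pt[OF that] distrib_left sum_distrib_left right_diff_distrib by (simp add: mult.left_commute)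
    then have "(\<Sum>k\<le>n. x ^ k * (\<epsilon> k - f k + e k))
      = (\<Sum>k\<le>n. x ^ k * sh 0 k - x ^ k * sh 1 k + (\<Sum>i=1..m. w i * (x ^ k * sh (T i) k - x ^ k * sh 1 k)))"
      by simp
    also have "\<dots> = conv 0 - conv 1 + (\<Sum>k\<le>n. \<Sum>i=1..m. w i * (x ^ k * sh (T i) k - x ^ k * sh 1 k))"
      by (simp add: conv_def sum.distrib sum_subtractf)
    also have "(\<Sum>k\<le>n. \<Sum>i=1..m. w i * (x ^ k * sh (T i) k - x ^ k * sh 1 k)) = (\<Sum>i=1..m. w i * (conv (T i) - conv 1))"
      unfolding conv_def sum_subtractf[symmetric] sum_distrib_left by (rule sum.swap)
    finally show ?thesis .
  qed
  moreover have "conv 0 = G" unfolding conv_def sh_def G_def by simp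
  ultimately have eq: "(\<Sum>k\<le>n. x ^ k * (\<epsilon> k - f k + e k))
     = (1 - x + (\<Sum>i=1..m. w i * (x ^ T i - x))) * G
      + (- (conv 1 - x * G) + (\<Sum>i=1..m. w i * ((conv (T i) - x ^ T i * G) - (conv 1 - x * G))))"
    (is "_ = ?Q * G + ?R")
    by (simp add: algebra_simps sum_subtractf sum.distrib sum_distrib_left sum_distrib_right)
  have R: "\<bar>?R\<bar> \<le> 2 * \<tau>"
  proof -
    have c1: "\<bar>conv 1 - x * G\<bar> \<le> \<tau>" using conv[of 1] by simp
    have "\<bar>\<Sum>i=1..m. w i * ((conv (T i) - x ^ T i * G) - (conv 1 - x * G))\<bar> \<le> (\<Sum>i=1..m. \<bar>w i\<bar> * (2 * \<tau>))"
    proof (intro order.trans[OF sum_abs] sum_mono)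
      fix i
      have "\<bar>(conv (T i) - x ^ T i * G) - (conv 1 - x * G)\<bar> \<le> 2 * \<tau>"
        using c1 conv[of "T i"] by linarith
      then show "\<bar>w i * ((conv (T i) - x ^ T i * G) - (conv 1 - x * G))\<bar> \<le> \<bar>w i\<bar> * (2 * \<tau>)"
        unfolding abs_mult by (rule mult_left_mono) auto
    qed
    also have "\<dots> = (\<Sum>i=1..m. \<bar>w i\<bar>) * (2 * \<tau>)" by (rule sum_distrib_right[symmetric])
    also have "\<dots> \<le> 1 / 2 * (2 * \<tau>)" using w tau by (intro mult_right_mono) auto
    finally show ?thesis using c1 by linarith
  qed
  have "\<bar>G\<bar> \<le> (\<Sum>k\<le>n. x ^ k * B)"
    unfolding G_def using x g by (intro order.trans[OF sum_abs] sum_mono) (auto simp: abs_mult intro!: mult_left_mono)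
  also have "\<dots> = (\<Sum>k\<le>n. x ^ k) * B" by (rule sum_distrib_right[symmetric])
  also have "\<dots> \<le> 1 / (1 - x) * B" using geom B by (rule mult_right_mono)
  finally have Gb: "\<bar>G\<bar> \<le> B / (1 - x)" by simp
  have "\<bar>\<Sum>k\<le>n. x ^ k * e k\<bar> \<le> (\<Sum>k\<le>n. x ^ k * err)"
    using x e by (intro order.trans[OF sum_abs] sum_mono) (auto simp: abs_mult intro!: mult_left_mono)
  also have "\<dots> = (\<Sum>k\<le>n. x ^ k) * err" by (rule sum_distrib_right[symmetric])
  also have "\<dots> \<le> 1 / (1 - x) * err" using geom err by (rule mult_right_mono)
  finally have Eb: "\<bar>\<Sum>k\<le>n. x ^ k * e k\<bar> \<le> err / (1 - x)" by simp
  have "(\<Sum>k\<le>n. \<epsilon> k * x ^ k) - (\<Sum>k\<le>n. f k * x ^ k) = ?Q * G + ?R - (\<Sum>k\<le>n. x ^ k * e k)"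
    unfolding eq[symmetric] by (simp add: algebra_simps sum.distrib sum_subtractf)
  moreover have "\<bar>?Q * G\<bar> \<le> \<bar>?Q\<bar> * (B / (1 - x))"
    unfolding abs_mult using Gb by (rule mult_left_mono) auto
  ultimately have "\<bar>(\<Sum>k\<le>n. \<epsilon> k * x ^ k) - (\<Sum>k\<le>n. f k * x ^ k)\<bar>
      \<le> \<bar>?Q\<bar> * (B / (1 - x)) + 2 * \<tau> + err / (1 - x)"
    using R Eb by linarith
  also have "\<dots> = (\<bar>?Q\<bar> * B + 2 * B * x ^ n + err) / (1 - x)"
    unfolding \<tau>_def by (simp add: add_divide_distrib)
  finally show ?thesis .
qed

section \<open>Greedy choices keep the state bounded\<close>

text \<open>Full blocks contribute nothing positive, which leaves fewer than \<open>M\<close> terms.\<close>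

lemma block_sum_upper:
  fixes z :: "nat \<Rightarrow> real"
  assumes block: "\<And>n. (\<Sum>k=1..M. z (n + k)) \<le> 0" and z: "\<And>k. k \<ge> 1 \<Longrightarrow> z k \<le> Z" and Z: "Z \<ge> 0" and M: "M \<ge> 1"
  shows "(\<Sum>k=1..l. z (n + k)) \<le> real M * Z"
proof (induction l arbitrary: n rule: less_induct)
  case (less l)
  show ?case
  proof (cases "l \<le> M")
    case True
    have "(\<Sum>k=1..l. z (n + k)) \<le> (\<Sum>k=1..l. Z)" by (intro sum_mono z) auto
    also have "\<dots> \<le> real M * Z" using True Z by (simp add: mult_right_mono)
    finally show ?thesis .
  next
    case False
    have "(\<Sum>k=1..l. z (n + k)) = (\<Sum>k=1..M. z (n + k)) + (\<Sum>k=M+1..l. z (n + k))"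
      using False sum.ub_add_nat[of 1 M "\<lambda>k. z (n + k)" "l - M"] by simp
    also have "(\<Sum>k=M+1..l. z (n + k)) = (\<Sum>k=1..l-M. z (n + M + k))"
      using False by (intro sum.reindex_bij_witness[where i = "\<lambda>k. M + k" and j = "\<lambda>k. k - M"]) auto
    also have "\<dots> \<le> real M * Z" using less[of "l - M" "n + M"] False M by simp
    finally show ?thesis using block[of n] by linarith
  qed
qed

text \<open>The state can only be large at time \<open>n\<close> if it has been positive since some time \<open>j\<close> at which it was
  at most \<open>2 + Z\<close>, and from then on every step was a downward one.\<close>

lemma greedy_upper:
  fixes G :: "nat \<Rightarrow> real"
  assumes block: "\<And>n. (\<Sum>k=1..M. z (n + k)) \<le> 0" and z: "\<And>k. k \<ge> 1 \<Longrightarrow> z k \<le> Z" and Z: "Z \<ge> 0" and M: "M \<ge> 1"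
    and down: "\<And>k. k < n \<Longrightarrow> G k > 0 \<Longrightarrow> G (Suc k) - G k \<le> z (Suc k)"
    and step: "\<And>k. k < n \<Longrightarrow> G (Suc k) - G k \<le> Z"
    and G0: "G 0 \<le> 2"
  shows "G n \<le> 2 + (real M + 1) * Z"
proof -
  have "\<exists>j\<le>k. G j \<le> 2 + Z \<and> G k \<le> G j + (\<Sum>i=1..k-j. z (j + i))" if "k \<le> n" for k
    using that
  proof (induction k)
    case 0
    then show ?case using G0 Z by auto
  next
    case (Suc k)
    then obtain j where j: "j \<le> k" "G j \<le> 2 + Z" "G k \<le> G j + (\<Sum>i=1..k-j. z (j + i))" by auto
    show ?case
    proof (cases "G k > 0")
      case True
      then have "G (Suc k) \<le> G k + z (Suc k)" using down[of k] Suc.prems by simp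
      moreover have "(\<Sum>i=1..Suc k-j. z (j + i)) = (\<Sum>i=1..k-j. z (j + i)) + z (Suc k)"
        using j(1) by (simp add: Suc_diff_le)
      ultimately show ?thesis using j by (intro exI[of _ j]) auto
    next
      case False
      then have "G (Suc k) \<le> 2 + Z" using step[of k] Suc.prems by simp
      then show ?thesis by (intro exI[of _ "Suc k"]) auto
    qed
  qed
  from this[of n] obtain j where "G j \<le> 2 + Z" "G n \<le> G j + (\<Sum>i=1..n-j. z (j + i))" by auto
  moreover have "(\<Sum>i=1..n-j. z (j + i)) \<le> real M * Z" by (rule block_sum_upper[OF block z Z M])
  ultimately show ?thesis by (simp add: algebra_simps)
qed

text \<open>The disturbance of a step is only assumed to be small as long as the state has been bounded
  so far, since it contains delayed values of the state.\<close>

lemma greedy_bound: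
  fixes G \<epsilon> lo hi :: "nat \<Rightarrow> real"
  assumes lo: "\<And>n. (\<Sum>k=1..M. lo (n + k)) \<le> - a" and hi: "\<And>n. (\<Sum>k=1..M. hi (n + k)) \<ge> a"
    and range: "\<And>k. k \<ge> 1 \<Longrightarrow> \<bar>lo k\<bar> \<le> A \<and> \<bar>hi k\<bar> \<le> A"
    and M: "M \<ge> 1" and \<eta>: "\<eta> \<ge> 0" "real M * \<eta> \<le> a"
    and choice: "\<And>k. k < n \<Longrightarrow> \<epsilon> (Suc k) = (if G k < 0 then hi (Suc k) else lo (Suc k))"
    and G0: "\<bar>G 0\<bar> \<le> 2" and B: "B = 2 + (real M + 1) * (A + \<eta>)"
    and step: "\<And>k. k < n \<Longrightarrow> (\<And>j. j \<le> k \<Longrightarrow> \<bar>G j\<bar> \<le> B) \<Longrightarrow> \<bar>G (Suc k) - G k - \<epsilon> (Suc k)\<bar> \<le> \<eta>"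
    and k: "k \<le> n"
  shows "\<bar>G k\<bar> \<le> B"
  using k
proof (induction k rule: less_induct)
  case (less k)
  have A: "A \<ge> 0" using range[of 1] by linarith
  have st: "\<bar>G (Suc j) - G j - \<epsilon> (Suc j)\<bar> \<le> \<eta>" if "j < k" for j
    using that less by (intro step) auto
  have eps: "\<bar>\<epsilon> (Suc j)\<bar> \<le> A" if "j < k" for j
    using choice[of j] range[of "Suc j"] that less.prems by auto
  have "G k \<le> 2 + (real M + 1) * (A + \<eta>)"
  proof (rule greedy_upper[where z = "\<lambda>k. lo k + \<eta>"])
    show "(\<Sum>k=1..M. lo (n + k) + \<eta>) \<le> 0" for n
      using lo[of n] \<eta>(2) by (simp add: sum.distrib)
    show "lo k + \<eta> \<le> A + \<eta>" if "k \<ge> 1" for k using range[OF that] by auto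
    show "G (Suc j) - G j \<le> lo (Suc j) + \<eta>" if "j < k" "G j > 0" for j
      using st[OF that(1)] choice[of j] that less.prems by (auto simp: abs_le_iff)
    show "G (Suc j) - G j \<le> A + \<eta>" if "j < k" for j
      using st[OF that] eps[OF that] by linarith
  qed (use A \<eta> M G0 in auto)
  moreover have "- G k \<le> 2 + (real M + 1) * (A + \<eta>)"
  proof (rule greedy_upper[where z = "\<lambda>k. - hi k + \<eta>" and G = "\<lambda>k. - G k"])
    show "(\<Sum>k=1..M. - hi (n + k) + \<eta>) \<le> 0" for n
      using hi[of n] \<eta>(2) by (simp only: sum.distrib sum_negf) simp
    show "- hi k + \<eta> \<le> A + \<eta>" if "k \<ge> 1" for k using range[OF that] by auto
    show "- G (Suc j) - - G j \<le> - hi (Suc j) + \<eta>" if "j < k" "- G j > 0" for j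
      using st[OF that(1)] choice[of j] that less.prems by (auto simp: abs_le_iff)
    show "- G (Suc j) - - G j \<le> A + \<eta>" if "j < k" for j
      using st[OF that] eps[OF that] by linarith
  qed (use A \<eta> M G0 in auto)
  ultimately show ?case unfolding B by linarith
qed

section \<open>A target polynomial with many sign changes\<close>

text \<open>Polymorphic, since the program holds the integer coefficients while the sign changes are those of
  the real polynomial.\<close>

fun node_poly :: "nat \<Rightarrow> nat \<Rightarrow> nat \<Rightarrow> 'a::comm_ring_1 poly" where
  "node_poly r q 0 = 1"
| "node_poly r q (Suc j) = (monom (of_nat (4 * r)) q - [:of_nat (r + Suc j):]) * node_poly r q j"

lemma coeff_node_poly_Suc:
  "coeff (node_poly r q (Suc j)) k = of_nat (4 * r) * (if q \<le> k then coeff (node_poly r q j) (k - q) else 0)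
     - of_nat (r + Suc j) * coeff (node_poly r q j) k"
  by (simp del: of_nat_add of_nat_mult of_nat_Suc add: left_diff_distrib coeff_monom_mult)

lemma coeff_node_poly_of_int:
  "of_int (coeff (node_poly r q j :: int poly) k) = coeff (node_poly r q j :: 'a::comm_ring_1 poly) k"
proof (induction j arbitrary: k)
  case (Suc j)
  then show ?case by (simp del: node_poly.simps add: coeff_node_poly_Suc)
qed (simp add: coeff_1)

lemma degree_node_poly: "degree (node_poly r q j :: 'a::comm_ring_1 poly) \<le> j * q"
proof (induction j)
  case (Suc j)
  have "degree (monom (of_nat (4 * r)) q - [:of_nat (r + Suc j):] :: 'a poly) \<le> q"
    by (intro degree_diff_le degree_monom_le) auto
  then show ?case using Suc degree_mult_le[of "monom (of_nat (4 * r)) q - [:of_nat (r + Suc j):] :: 'a poly" "node_poly r q j"]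
    by simp
qed simp

lemma coeff_node_poly_bound:
  "j \<le> r \<Longrightarrow> \<bar>coeff (node_poly r q j :: int poly) k\<bar> \<le> (8 * int r) ^ j"
proof (induction j arbitrary: k)
  case (Suc j)
  let ?c = "coeff (node_poly r q j :: int poly)"
  have 1: "\<bar>int (4 * r) * (if q \<le> k then ?c (k - q) else 0)\<bar> \<le> int (4 * r) * (8 * int r) ^ j"
    unfolding abs_mult using Suc.IH[of "k - q"] Suc.prems by (intro mult_mono) auto
  have 2: "\<bar>int (r + Suc j) * ?c k\<bar> \<le> int (2 * r) * (8 * int r) ^ j"
    unfolding abs_mult using Suc.IH[of k] Suc.prems by (intro mult_mono) auto
  have "\<bar>coeff (node_poly r q (Suc j) :: int poly) k\<bar> \<le> int (6 * r) * (8 * int r) ^ j"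
    unfolding coeff_node_poly_Suc using 1 2 by (simp add: algebra_simps)
  also have "\<dots> \<le> (8 * int r) ^ Suc j" by (simp add: mult_right_mono)
  finally show ?case .
qed (simp add: coeff_1)

lemma poly_node_poly:
  "poly (node_poly r q j) x = (\<Prod>l=1..j. of_nat (4 * r) * x ^ q - of_nat (r + l))"
  by (induction j) (simp_all add: poly_monom algebra_simps)

text \<open>The factors have absolute values \<open>1/2, 3/2, \<dots>\<close> on both sides of \<open>j\<close>, so the product is comparable to
  \<open>j! (r - j)!\<close>, which is \<open>r!\<close> up to a power of 2.\<close>

lemma half_odd_product:
  fixes j r :: nat
  assumes "j \<le> r"
  shows "fact r / 4 ^ r \<le> (-1) ^ (r - j) * (\<Prod>l=1..r. real j + 1 / 2 - real l)"
proof -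
  have half: "fact k / 2 ^ k \<le> (\<Prod>i=1..k. real i - 1 / 2)" for k
  proof (induction k)
    case (Suc k)
    have "fact (Suc k) / 2 ^ Suc k = fact k / 2 ^ k * ((real k + 1) / 2)" by (simp add: field_simps)
    also have "\<dots> \<le> (\<Prod>i=1..k. real i - 1 / 2) * (real (Suc k) - 1 / 2)"
      using Suc by (intro mult_mono prod_nonneg) auto
    finally show ?case by simp
  qed simp
  have "(\<Prod>l=1..r. real j + 1 / 2 - real l) = (\<Prod>l=1..j. real j + 1 / 2 - real l) * (\<Prod>l=j+1..r. real j + 1 / 2 - real l)"
    using assms prod.ub_add_nat[of 1 j "\<lambda>l. real j + 1 / 2 - real l" "r - j"] by simp
  also have "(\<Prod>l=1..j. real j + 1 / 2 - real l) = (\<Prod>i=1..j. real i - 1 / 2)"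
    by (intro prod.reindex_bij_witness[where i = "\<lambda>i. j + 1 - i" and j = "\<lambda>i. j + 1 - i"]) (auto simp: of_nat_diff)
  also have "(\<Prod>l=j+1..r. real j + 1 / 2 - real l) = (\<Prod>i=1..r-j. - (real i - 1 / 2))"
    using assms by (intro prod.reindex_bij_witness[where i = "\<lambda>i. j + i" and j = "\<lambda>i. i - j"]) (auto simp: of_nat_diff)
  also have "\<dots> = (-1) ^ (r - j) * (\<Prod>i=1..r-j. real i - 1 / 2)"
    by (simp only: prod_uminus card_atLeastAtMost) simp
  finally have "(-1) ^ (r - j) * (\<Prod>l=1..r. real j + 1 / 2 - real l)
      = (\<Prod>i=1..j. real i - 1 / 2) * (\<Prod>i=1..r-j. real i - 1 / 2)"
    by (simp add: power_mult_distrib[symmetric] mult.left_commute)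
  moreover have "(\<Prod>i=1..j. real i - 1 / 2) * (\<Prod>i=1..r-j. real i - 1 / 2) \<ge> (fact j / 2 ^ j) * (fact (r - j) / 2 ^ (r - j))"
    by (intro mult_mono half prod_nonneg) auto
  moreover have "(fact j / 2 ^ j) * (fact (r - j) / 2 ^ (r - j)) \<ge> (fact r / 4 ^ r :: real)"
  proof -
    have "real (r choose j) \<le> 2 ^ r" using binomial_le_pow2[of r j] by (metis of_nat_le_iff of_nat_numeral of_nat_power)
    moreover have "real (r choose j) = fact r / (fact j * fact (r - j))" using binomial_fact[OF assms] .
    ultimately have "fact r \<le> 2 ^ r * (fact j * fact (r - j) :: real)" by (simp add: field_simps)
    then have "fact r / 4 ^ r \<le> 2 ^ r * (fact j * fact (r - j) :: real) / 4 ^ r" by (rule divide_right_mono) simp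
    also have "\<dots> = fact j * fact (r - j) * (2 ^ r / 4 ^ r)" by simp
    also have "(2 ^ r / 4 ^ r :: real) = 1 / 2 ^ r" by (simp add: power_divide[symmetric] power_one_over)
    also have "(2 :: real) ^ r = 2 ^ j * 2 ^ (r - j)" using assms by (simp add: power_add[symmetric])
    finally show ?thesis by simp
  qed
  ultimately show ?thesis by linarith
qed

text \<open>Induction with \<open>(1 + 1/r)^r \<le> exp 1 \<le> 3\<close>.\<close>

lemma power_self_le_fact: "real r ^ r \<le> 3 ^ r * fact r"
proof (induction r)
  case (Suc r)
  show ?case
  proof (cases "r = 0")
    case False
    have "(1 + 1 / real r) ^ r \<le> exp (1 / real r) ^ r"
      by (intro power_mono) auto
    also have "\<dots> = exp 1" using False by (simp add: exp_of_nat_mult[symmetric])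
    also have "\<dots> \<le> 3" by (rule exp_le)
    finally have "(1 + 1 / real r) ^ r \<le> 3" .
    then have "(1 + 1 / real r) ^ r * real r ^ r \<le> 3 * (3 ^ r * fact r)"
      using Suc by (intro mult_mono) auto
    moreover have "(1 + 1 / real r) ^ r * real r ^ r = (real r + 1) ^ r"
      using False by (simp add: power_mult_distrib[symmetric] field_simps)
    ultimately have "(real r + 1) * (real r + 1) ^ r \<le> (real r + 1) * (3 * (3 ^ r * fact r))"
      by (intro mult_left_mono) auto
    then show ?thesis by (simp add: algebra_simps)
  qed simp
qed simp

lemma alternation_roots:
  fixes f :: "real \<Rightarrow> real"
  assumes cont: "continuous_on {0..1} f" and fin: "finite {x. 0 \<le> x \<and> x \<le> 1 \<and> f x = 0}"
    and y: "\<And>j. j \<le> r \<Longrightarrow> 0 \<le> y j \<and> y j \<le> 1" and mono: "\<And>j. j < r \<Longrightarrow> y j < y (Suc j)"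
    and alt: "\<And>j. j \<le> r \<Longrightarrow> 0 < (-1) ^ (r - j) * f (y j)"
  shows "r \<le> card {x. 0 \<le> x \<and> x \<le> 1 \<and> f x = 0}"
proof -
  have "\<exists>z. y j < z \<and> z < y (Suc j) \<and> f z = 0" if j: "j < r" for j
  proof -
    have e: "r - j = Suc (r - Suc j)" using j by simp
    have c: "continuous_on {y j..y (Suc j)} f"
      by (rule continuous_on_subset[OF cont]) (use y[of j] y[of "Suc j"] j in auto)
    have s: "0 < (-1) ^ (r - Suc j) * f (y (Suc j))" "(-1) ^ (r - Suc j) * f (y j) < 0"
      using alt[of j] alt[of "Suc j"] j unfolding e by auto
    have "\<exists>z. y j \<le> z \<and> z \<le> y (Suc j) \<and> (\<lambda>x. (-1) ^ (r - Suc j) * f x) z = 0"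
      using s mono[OF j] c by (intro IVT') (auto intro!: continuous_intros)
    then obtain z where z: "y j \<le> z" "z \<le> y (Suc j)" "f z = 0" by auto
    moreover have "z \<noteq> y j" "z \<noteq> y (Suc j)" using s z(3) by auto
    ultimately show ?thesis by (metis less_le)
  qed
  then obtain z where z: "\<And>j. j < r \<Longrightarrow> y j < z j \<and> z j < y (Suc j) \<and> f (z j) = 0" by metis
  have ymono: "y i \<le> y j" if "i \<le> j" "j \<le> r" for i j
    using that
  proof (induction "j - i" arbitrary: j)
    case (Suc l)
    then obtain k where k: "j = Suc k" "k < r" "i \<le> k" by (cases j) auto
    have "y i \<le> y k" using Suc k by auto
    also have "y k < y j" using mono[OF k(2)] k(1) by simp
    finally show ?case by (rule less_imp_le)
  qed simp
  have zless: "z i < z j" if "i < j" "j < r" for i j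
  proof -
    have "z i < y (Suc i)" using z[of i] that by simp
    also have "\<dots> \<le> y j" using ymono[of "Suc i" j] that by simp
    also have "\<dots> < z j" using z[of j] that by simp
    finally show ?thesis .
  qed
  have "inj_on z {..<r}"
    by (rule linorder_inj_onI') (metis zless lessThan_iff less_irrefl)
  then have "card (z ` {..<r}) = r" by (simp add: card_image)
  moreover have "z ` {..<r} \<subseteq> {x. 0 \<le> x \<and> x \<le> 1 \<and> f x = 0}"
  proof safe
    fix j assume "j < r"
    then show "0 \<le> z j" "z j \<le> 1" "f (z j) = 0" using z[of j] y[of j] y[of "Suc j"] by auto
  qed
  ultimately show ?thesis using card_mono[OF fin, of "z ` {..<r}"] by simp
qed

text \<open>With \<open>s = - ln x \<le> 2 / q\<close> the bound of \<open>filter_fun_bound\<close> is at most \<open>(c s m)^m\<close>, and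
  \<open>q = 4 c \<kappa> r = 4 c m\<close> is chosen to make the base at most \<open>1/2\<close>.\<close>

lemma node_exists:
  fixes c \<kappa> r j :: nat
  assumes c: "c \<ge> 2" and \<kappa>: "\<kappa> \<ge> 1" and r: "r \<ge> 1" and j: "j \<le> r"
  defines "u \<equiv> (real r + real j + 1 / 2) / (4 * real r)" and "q \<equiv> 4 * c * \<kappa> * r"
  defines "x \<equiv> exp (- (- ln u / real q))"
  shows "0 < x" "x < 1" "x ^ q = u" "1 / (1 - x) \<le> 3 * real q" "x ^ (q * (2 * \<kappa> * r)) \<le> 1 / 2 ^ (\<kappa> * r)"
    "\<bar>filter_fun (\<kappa> * r) c x\<bar> \<le> 1 / 2 ^ (\<kappa> * r)"
proof -
  have q: "q > 0" unfolding q_def using c \<kappa> r by simp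
  have u: "1 / 4 \<le> u" "u \<le> 5 / 8" unfolding u_def using r j by (auto simp: divide_simps)
  show x0: "0 < x" unfolding x_def by simp
  have lnu: "ln u < 0" using u by simp
  show x1: "x < 1" unfolding x_def using lnu q by (simp add: divide_neg_pos)
  show xq: "x ^ q = u" unfolding x_def using q u by (simp add: exp_of_nat_mult[symmetric])
  have "1 + real q * (x - 1) \<le> (1 + (x - 1)) ^ q" by (rule Bernoulli_inequality) (use x0 in simp)
  then have "3 / 8 \<le> real q * (1 - x)" using xq u by (simp add: algebra_simps)
  then show "1 / (1 - x) \<le> 3 * real q" using x1 by (simp add: field_simps)
  have "x ^ (q * (2 * \<kappa> * r)) = (u\<^sup>2) ^ (\<kappa> * r)"
    by (simp only: power_mult xq)
  also have "\<dots> \<le> (1 / 2) ^ (\<kappa> * r)"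
  proof (rule power_mono)
    have "u\<^sup>2 \<le> (5 / 8)\<^sup>2" using u by (intro power_mono) auto
    then show "u\<^sup>2 \<le> 1 / 2" by (simp add: power2_eq_square)
  qed simp
  finally show "x ^ (q * (2 * \<kappa> * r)) \<le> 1 / 2 ^ (\<kappa> * r)" by (simp add: power_one_over)
  define s where "s = - ln u / real q"
  define m where "m = \<kappa> * r"
  have m: "m \<ge> 1" unfolding m_def using \<kappa> r by simp
  have s0: "s \<ge> 0" unfolding s_def using lnu q by (simp add: divide_nonpos_pos)
  have "exp (-2) \<le> (1 / 4 :: real)"
  proof -
    have "2 * 2 \<le> exp 1 * (exp 1 :: real)" using exp_ge_add_one_self[of 1] by (intro mult_mono) auto
    then have "4 \<le> exp (2 :: real)" by (simp add: exp_add[symmetric])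
    then show ?thesis by (simp add: exp_minus field_simps)
  qed
  then have "- ln u \<le> 2" using u ln_ge_iff[of u "-2"] by simp
  then have s2: "s \<le> 2 / real q" unfolding s_def by (intro divide_right_mono) auto
  have "4 * 2 * 1 * 1 \<le> q" unfolding q_def using c \<kappa> r by (intro mult_le_mono) auto
  then have "2 / real q \<le> 1" by simp
  then have s1: "s \<le> 1" using s2 by simp
  have csm: "real c * s * real m \<le> 1 / 2"
  proof -
    have "real c * s * real m \<le> real c * (2 / real q) * real m" using s2 by (intro mult_mono) (use s0 in auto)
    also have "\<dots> = 1 / 2" unfolding q_def m_def using c \<kappa> r by simp
    finally show ?thesis .
  qed
  have fb: "0 \<le> filter_fun m c (exp (- s)) \<and>
    filter_fun m c (exp (- s)) \<le> real c ^ m * fact m * s ^ Suc m / real (Suc m)"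
    by (rule filter_fun_bound[OF c s0])
  then have "filter_fun m c (exp (- s)) \<le> real c ^ m * fact m * s ^ Suc m / real (Suc m)" ..
  also have "real c ^ m * fact m * s ^ Suc m / real (Suc m) \<le> real c ^ m * fact m * s ^ m"
  proof -
    have "s / real (Suc m) \<le> 1" using s1 s0 by (simp add: divide_le_eq)
    then have "real c ^ m * fact m * s ^ m * (s / real (Suc m)) \<le> real c ^ m * fact m * s ^ m * 1"
      using s0 by (intro mult_left_mono) auto
    then show ?thesis by (simp add: algebra_simps)
  qed
  also have "\<dots> \<le> real c ^ m * real m ^ m * s ^ m"
    using s0 fact_le_power[of m, where 'a=real] by (intro mult_right_mono mult_left_mono) auto
  also have "\<dots> = (real c * s * real m) ^ m" by (simp add: power_mult_distrib)
  also have "\<dots> \<le> (1 / 2) ^ m" using csm s0 by (intro power_mono) auto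
  finally show "\<bar>filter_fun (\<kappa> * r) c x\<bar> \<le> 1 / 2 ^ (\<kappa> * r)"
    using fb unfolding x_def s_def[symmetric] m_def[symmetric] by (simp add: power_one_over)
qed

section \<open>The quantised polynomial\<close>

lemma of_int_div_close:
  fixes x y :: int
  shows "\<bar>real_of_int (x div y) - real_of_int x / real_of_int y\<bar> \<le> 1"
proof -
  have "real_of_int (x div y) = of_int \<lfloor>real_of_int x / real_of_int y\<rfloor>"
    by (simp add: floor_divide_of_int_eq)
  then show ?thesis by linarith
qed

lemma scaled_close:
  fixes u v s :: real
  assumes "s > 0" "\<bar>u - v\<bar> \<le> 1"
  shows "\<bar>u / s - v / s\<bar> \<le> 1 / s"
proof -
  have "\<bar>u / s - v / s\<bar> = \<bar>u - v\<bar> / s" using assms(1) by (simp add: diff_divide_distrib[symmetric])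
  then show ?thesis using assms by (simp add: divide_right_mono)
qed

lemma is_solution_cong:
  assumes "\<And>k. 1 \<le> k \<Longrightarrow> k \<le> n \<Longrightarrow> \<epsilon> k = \<epsilon>' k" "is_solution C E r n \<epsilon>"
  shows "is_solution C E r n \<epsilon>'"
proof -
  have "coeff_poly \<epsilon> n = coeff_poly \<epsilon>' n" unfolding coeff_poly_def using assms(1) by (auto intro!: sum.cong)
  then show ?thesis using assms unfolding is_solution_def by auto
qed

text \<open>\<open>B\<close> bounds the state, and \<open>\<eta>\<close> is the disturbance per step that the balance condition can absorb.
  The target has coefficients at most \<open>1/d\<close>, and \<open>c\<close> is the spacing of the filter; each of the two
  takes up at most a quarter of \<open>\<eta>\<close>, and \<open>\<kappa>1\<close> bounds the rounding by another quarter.  The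
  assumption \<open>\<kappa>2\<close> makes the errors at the test points smaller than the target.\<close>

locale quantiser_constants =
  fixes A a :: real and M c d \<kappa> :: nat and \<eta> B :: real
  assumes A: "A > 0" and a: "a > 0" and M: "M \<ge> 1" and \<kappa>: "\<kappa> \<ge> 1"
    and eta: "\<eta> = a / (real M + 1)" and B_def: "B = 2 + (real M + 1) * (A + \<eta>)"
    and d: "4 / \<eta> \<le> real d" and d2: "d \<ge> 2" and c: "64 * B / \<eta> \<le> real c"
    and \<kappa>1: "(2 * B + 4) / 2 ^ \<kappa> \<le> \<eta> / 4"
    and \<kappa>2: "12 * real c * real \<kappa> * real d * (9 * B + 3) * 2 ^ 8 < 2 ^ \<kappa>"
begin

lemma eta_pos: "\<eta> > 0" using a eta by simp

lemma eta_M: "real M * \<eta> \<le> a"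
  unfolding eta using a by (simp add: field_simps)

lemma B_ge: "B \<ge> 2" "B \<ge> \<eta>"
proof -
  show "B \<ge> 2" unfolding B_def using A eta_pos by simp
  have "\<eta> \<le> (real M + 1) * (A + \<eta>)" using A eta_pos mult_mono[of 1 "real M + 1" \<eta> "A + \<eta>"] by simp
  then show "B \<ge> \<eta>" unfolding B_def by simp
qed

lemma c_ge: "c \<ge> 64"
proof -
  have "64 * 1 \<le> 64 * (B / \<eta>)" using B_ge eta_pos by (intro mult_left_mono) auto
  then show ?thesis using c by simp
qed

lemma d_ge: "d \<ge> 1" using d2 by simp

lemma d_small: "1 / real d \<le> \<eta> / 4"
  using d eta_pos d_ge by (simp add: field_simps)

lemma c_small: "16 * B / real c \<le> \<eta> / 4"
  using c eta_pos c_ge by (simp add: field_simps)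

end

text \<open>A run of \<open>N\<close> steps with state \<open>G\<close> and filter weights \<open>W\<close>, all scaled by \<open>S\<close> and rounded.  The
  arrays are indexed by integers, as in the store of a program, and \<open>G\<close> is 0 at negative times, so
  that delays reaching back before time 0 need no case distinction.\<close>

locale quantiser_run = quantiser_constants +
  fixes E :: "nat \<Rightarrow> real set" and r :: nat and W G :: "int \<Rightarrow> int" and N :: nat
  assumes range: "\<And>k. k \<ge> 1 \<Longrightarrow> E k \<subseteq> {-A..A}" and bal: "balanced E M a" and r: "r \<ge> 1"
  fixes S :: int and m q n p :: nat and lo hi \<epsilon> :: "nat \<Rightarrow> real" and D :: int
  defines "p \<equiv> 2 * \<kappa> * r" and "S \<equiv> 2 ^ p" and "m \<equiv> \<kappa> * r" and "q \<equiv> 4 * c * \<kappa> * r"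
    and "n \<equiv> q * (2 * \<kappa> * r)" and "D \<equiv> (8 * int r) ^ r"
    and "lo \<equiv> \<lambda>k. set_min (E k)" and "hi \<equiv> \<lambda>k. set_max (E k)"
    and "\<epsilon> \<equiv> \<lambda>k. if k = 0 then 1 else if G (int k - 1) < 0 then hi k else lo k"
  assumes W: "\<And>i. 1 \<le> i \<Longrightarrow> i \<le> m \<Longrightarrow> \<bar>real_of_int (W (int i)) - real_of_int S * tap m c i\<bar> \<le> 3"
    and W_le: "\<And>i. 1 \<le> i \<Longrightarrow> i \<le> m \<Longrightarrow> \<bar>real_of_int (W (int i))\<bar> \<le> 4 / (real c * (real i)\<^sup>2) * real_of_int S + 1"
    and G0: "G 0 = S - (S * coeff (node_poly r q r) 0) div (int d * D)"
    and Gneg: "\<And>j. j < 0 \<Longrightarrow> G j = 0"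
    and N: "N \<le> n"
    and rec: "\<And>k. k < N \<Longrightarrow> G (int k + 1) = G (int k)
        + fixed_point p (\<epsilon> (Suc k))
        - (S * coeff (node_poly r q r) (Suc k)) div (int d * D)
        - (\<Sum>i=1..m. W (int i) * (G (int k + 1 - int c * (int i)\<^sup>2) - G (int k))) div S"
begin

definition g :: "nat \<Rightarrow> real" where "g k = real_of_int (G (int k)) / real_of_int S"
definition sh :: "nat \<Rightarrow> nat \<Rightarrow> real" where "sh t k = (if t \<le> k then g (k - t) else 0)"
definition target :: "nat \<Rightarrow> real" where
  "target k = real_of_int (coeff (node_poly r q r) k) / (real d * real_of_int D)"
definition target_fix :: "nat \<Rightarrow> real" where
  "target_fix k = real_of_int ((S * coeff (node_poly r q r) k) div (int d * D)) / real_of_int S"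
definition feedback :: "nat \<Rightarrow> int" where
  "feedback k = (\<Sum>i=1..m. W (int i) * (G (int k + 1 - int c * (int i)\<^sup>2) - G (int k)))"

lemma S_pos: "S > 0" unfolding S_def by simp

lemma D_pos: "D > 0" unfolding D_def using r by simp

lemma inverse_S: "1 / real_of_int S \<le> 1 / 2 ^ m" "real m / real_of_int S \<le> 1 / 2 ^ m"
proof -
  have S2: "real_of_int S = 2 ^ m * 2 ^ m" unfolding S_def p_def m_def by (simp add: power_add[symmetric] mult_2[symmetric] mult.assoc)
  show "1 / real_of_int S \<le> 1 / 2 ^ m" unfolding S2 by (simp add: divide_simps)
  have "real m \<le> 2 ^ m" by (simp add: less_imp_le of_nat_less_two_power)
  then have "real m * 2 ^ m \<le> 2 ^ m * 2 ^ m" by (intro mult_right_mono) auto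
  then show "real m / real_of_int S \<le> 1 / 2 ^ m" unfolding S2 by (simp add: field_simps)
qed

lemma two_m: "1 / 2 ^ m \<le> (1 / 2 ^ \<kappa> :: real)"
  unfolding m_def using r by (intro divide_left_mono power_increasing) auto

lemma fixed_point_close: "\<bar>real_of_int (fixed_point p v) / real_of_int S - v\<bar> \<le> 1 / real_of_int S"
proof -
  have "\<bar>real_of_int (fixed_point p v) - real_of_int S * v\<bar> \<le> 1"
    unfolding fixed_point_def S_def by simp linarith
  then have "\<bar>real_of_int (fixed_point p v) - real_of_int S * v\<bar> / real_of_int S \<le> 1 / real_of_int S"
    using S_pos by (intro divide_right_mono) auto
  moreover have "real_of_int (fixed_point p v) / real_of_int S - v = (real_of_int (fixed_point p v) - real_of_int S * v) / real_of_int S"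
    using S_pos by (simp add: diff_divide_distrib)
  ultimately show ?thesis using S_pos by simp
qed

lemma target_close: "\<bar>target_fix k - target k\<bar> \<le> 1 / real_of_int S"
proof -
  let ?z = "S * coeff (node_poly r q r) k" and ?w = "int d * D"
  have "target k = (real_of_int ?z / real_of_int ?w) / real_of_int S"
    unfolding target_def using S_pos by simp
  then show ?thesis
    unfolding target_fix_def using scaled_close[OF _ of_int_div_close[of ?z ?w], of "real_of_int S"] S_pos by simp
qed

lemma target_le: "\<bar>target k\<bar> \<le> 1 / real d"
proof -
  have "\<bar>coeff (node_poly r q r) k\<bar> \<le> D"
    using coeff_node_poly_bound[of r r q k] unfolding D_def by simp
  then have "\<bar>real_of_int (coeff (node_poly r q r) k)\<bar> \<le> real_of_int D" by linarith
  then show ?thesis unfolding target_def using D_pos d_ge by (simp add: abs_mult field_simps)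
qed

lemma sh_eq: "sh (c * i\<^sup>2) (Suc k) = real_of_int (G (int k + 1 - int c * (int i)\<^sup>2)) / real_of_int S"
proof (cases "c * i\<^sup>2 \<le> Suc k")
  case True
  then have "int (Suc k - c * i\<^sup>2) = int k + 1 - int c * (int i)\<^sup>2" by (simp add: of_nat_diff)
  then show ?thesis using True unfolding sh_def g_def by (simp only: if_True)
next
  case False
  then have "int (Suc k) < int (c * i\<^sup>2)" by linarith
  then have "int k + 1 - int c * (int i)\<^sup>2 < 0" by simp
  then show ?thesis using False unfolding sh_def by (simp only: Gneg) simp
qed

lemma feedback_eq:
  "real_of_int (feedback k) / real_of_int S / real_of_int S
    = (\<Sum>i=1..m. real_of_int (W (int i)) / real_of_int S * (sh (c * i\<^sup>2) (Suc k) - g k))"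
  unfolding feedback_def sh_eq g_def of_int_sum sum_divide_distrib of_int_mult of_int_diff
  by (simp add: diff_divide_distrib right_diff_distrib)

lemma feedback_close:
  "\<bar>real_of_int (feedback k div S) / real_of_int S
    - (\<Sum>i=1..m. real_of_int (W (int i)) / real_of_int S * (sh (c * i\<^sup>2) (Suc k) - g k))\<bar> \<le> 1 / real_of_int S"
  unfolding feedback_eq[symmetric]
  using scaled_close[OF _ of_int_div_close[of "feedback k" S], of "real_of_int S"] S_pos by simp

lemma rec_real:
  assumes "k < N"
  shows "g (Suc k) = g k + real_of_int (fixed_point p (\<epsilon> (Suc k))) / real_of_int S - target_fix (Suc k)
    - real_of_int (feedback k div S) / real_of_int S"
proof -
  have "g (Suc k) = real_of_int (G (int k + 1)) / real_of_int S" unfolding g_def by (simp add: add.commute)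
  then show ?thesis unfolding rec[OF assms] feedback_def[symmetric] g_def target_fix_def
    by (simp add: add_divide_distrib diff_divide_distrib)
qed

lemma sh_bound:
  assumes "\<And>j. j \<le> k \<Longrightarrow> \<bar>g j\<bar> \<le> B" "t \<ge> 1"
  shows "\<bar>sh t (Suc k) - g k\<bar> \<le> 2 * B"
proof -
  have "\<bar>sh t (Suc k)\<bar> \<le> B" unfolding sh_def using assms B_ge by auto
  then show ?thesis using assms(1)[of k] by linarith
qed

lemma taps_pos: "i \<ge> 1 \<Longrightarrow> c * i\<^sup>2 \<ge> 1"
  using c_ge by simp

text \<open>The disturbance consists of the target coefficient, the feedback of the filter beyond \<open>1 - x\<close>, and
  the rounding errors.\<close>

lemma drift_small:
  assumes k: "k < N" and g: "\<And>j. j \<le> k \<Longrightarrow> \<bar>g j\<bar> \<le> B"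
  shows "\<bar>g (Suc k) - g k - \<epsilon> (Suc k)\<bar> \<le> \<eta>"
proof -
  let ?S = "real_of_int S"
  let ?fb = "\<Sum>i=1..m. real_of_int (W (int i)) / ?S * (sh (c * i\<^sup>2) (Suc k) - g k)"
  have "\<bar>?fb\<bar> \<le> (\<Sum>i=1..m. (4 / real c * (1 / (real i)\<^sup>2) + 1 / ?S) * (2 * B))"
  proof (intro order.trans[OF sum_abs] sum_mono)
    fix i assume i: "i \<in> {1..m}"
    have "\<bar>real_of_int (W (int i)) / ?S\<bar> = \<bar>real_of_int (W (int i))\<bar> / ?S" using S_pos by simp
    also have "\<dots> \<le> (4 / (real c * (real i)\<^sup>2) * ?S + 1) / ?S"
      using W_le[of i] i S_pos by (intro divide_right_mono) auto
    also have "\<dots> = 4 / real c * (1 / (real i)\<^sup>2) + 1 / ?S" using S_pos by (simp add: add_divide_distrib)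
    finally have "\<bar>real_of_int (W (int i)) / ?S\<bar> \<le> 4 / real c * (1 / (real i)\<^sup>2) + 1 / ?S" .
    then show "\<bar>real_of_int (W (int i)) / ?S * (sh (c * i\<^sup>2) (Suc k) - g k)\<bar> \<le> (4 / real c * (1 / (real i)\<^sup>2) + 1 / ?S) * (2 * B)"
      unfolding abs_mult using sh_bound[OF g taps_pos] i S_pos by (intro mult_mono) auto
  qed
  also have "\<dots> = (4 / real c * (\<Sum>i=1..m. 1 / (real i)\<^sup>2) + real m / ?S) * (2 * B)"
    unfolding sum_distrib_right[symmetric] sum.distrib sum_distrib_left[symmetric] by simp
  also have "\<dots> \<le> (4 / real c * 2 + 1 / 2 ^ \<kappa>) * (2 * B)"
    using sum_inverse_squares_le[of m] inverse_S(2) two_m B_ge by (intro mult_right_mono add_mono mult_left_mono) auto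
  also have "\<dots> = 16 * B / real c + 2 * B / 2 ^ \<kappa>" by (simp add: algebra_simps)
  finally have "\<bar>?fb\<bar> \<le> \<eta> / 4 + 2 * B / 2 ^ \<kappa>" using c_small by linarith
  moreover have "1 / ?S \<le> 1 / 2 ^ \<kappa>" using inverse_S(1) two_m by linarith
  moreover have "2 * B / 2 ^ \<kappa> + 4 * (1 / 2 ^ \<kappa>) \<le> \<eta> / 4" using \<kappa>1 by (simp add: add_divide_distrib)
  ultimately show ?thesis
    unfolding rec_real[OF k]
    using fixed_point_close[of "\<epsilon> (Suc k)"] target_close[of "Suc k"] target_le[of "Suc k"] feedback_close[of k] d_small eta_pos
      abs_ge_zero[of ?fb]
    by linarith
qed

lemma lo_hi_in:
  assumes "k \<ge> 1"
  shows "lo k \<in> E k" "hi k \<in> E k"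
proof -
  have "closed (E k)" "E k \<noteq> {}" using bal assms unfolding balanced_def by auto
  moreover have "bounded (E k)" by (rule bounded_subset[OF bounded_closed_interval range[OF assms]])
  ultimately show "lo k \<in> E k" "hi k \<in> E k"
    unfolding lo_def hi_def using set_min_eq_Inf(2) set_max_eq_Sup(2) by auto
qed

lemma lo_hi_range:
  assumes "k \<ge> 1"
  shows "\<bar>lo k\<bar> \<le> A \<and> \<bar>hi k\<bar> \<le> A"
  using lo_hi_in[OF assms] range[OF assms] by (auto simp: abs_le_iff subset_iff)

lemma g_bounded: "k \<le> N \<Longrightarrow> \<bar>g k\<bar> \<le> B"
proof (rule greedy_bound[where lo = lo and hi = hi and \<epsilon> = \<epsilon> and n = N])
  show "(\<Sum>k=1..M. lo (n + k)) \<le> - a" "a \<le> (\<Sum>k=1..M. hi (n + k))" for n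
    using bal unfolding balanced_def lo_def hi_def by auto
  show "\<epsilon> (Suc k) = (if g k < 0 then hi (Suc k) else lo (Suc k))" for k
    unfolding \<epsilon>_def g_def using S_pos by (simp add: divide_less_0_iff)
  have "g 0 = 1 - target_fix 0" unfolding g_def target_fix_def using G0 S_pos by (simp add: diff_divide_distrib)
  moreover have "1 / real d \<le> 1 / 2" using d2 by (intro divide_left_mono) auto
  moreover have "1 / 2 ^ \<kappa> \<le> (1 / 2 :: real)"
    using \<kappa> power_increasing[of 1 \<kappa> "2::real"] by (intro divide_left_mono) auto
  ultimately show "\<bar>g 0\<bar> \<le> 2" using target_close[of 0] target_le[of 0] inverse_S(1) two_m by linarith
qed (use lo_hi_range M eta_pos eta_M B_def drift_small in auto)

text \<open>The sequence \<open>e\<close> collects everything by which the rounded recursion differs from the exact one.\<close>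

lemma quantised_solution:
  assumes NN: "N = n"
  shows "is_solution (8 * real c * (real \<kappa>)\<^sup>2) E r n \<epsilon>"
proof -
  let ?S = "real_of_int S"
  define e where "e k = (if k = 0 then g 0 - 1 + target 0 else
      g k - g (k - 1) - \<epsilon> k + target k + (\<Sum>i=1..m. tap m c i * (sh (c * i\<^sup>2) k - g (k - 1))))" for k
  have e: "\<bar>e k\<bar> \<le> (3 + 6 * B) / 2 ^ m" if k: "k \<le> n" for k
  proof (cases k)
    case 0
    have "g 0 = 1 - target_fix 0" unfolding g_def target_fix_def using G0 S_pos by (simp add: diff_divide_distrib)
    then have "\<bar>e k\<bar> \<le> 1 / ?S" using target_close[of 0] 0 unfolding e_def by simp
    also have "\<dots> \<le> 1 / 2 ^ m" by (rule inverse_S)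
    also have "\<dots> \<le> (3 + 6 * B) / 2 ^ m" using B_ge by (intro divide_right_mono) auto
    finally show ?thesis .
  next
    case (Suc j)
    have gj: "\<bar>g i\<bar> \<le> B" if "i \<le> j" for i using that k Suc NN by (intro g_bounded) auto
    let ?fb = "\<Sum>i=1..m. real_of_int (W (int i)) / ?S * (sh (c * i\<^sup>2) (Suc j) - g j)"
    let ?tb = "\<Sum>i=1..m. tap m c i * (sh (c * i\<^sup>2) (Suc j) - g j)"
    have "\<bar>?fb - ?tb\<bar> \<le> (\<Sum>i=1..m. 3 / ?S * (2 * B))"
      unfolding sum_subtractf[symmetric] left_diff_distrib[symmetric]
    proof (intro order.trans[OF sum_abs] sum_mono)
      fix i assume i: "i \<in> {1..m}"
      have "real_of_int (W (int i)) / ?S - tap m c i = (real_of_int (W (int i)) - ?S * tap m c i) / ?S"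
        using S_pos by (simp add: diff_divide_distrib)
      then have "\<bar>real_of_int (W (int i)) / ?S - tap m c i\<bar> \<le> 3 / ?S"
        using W[of i] i S_pos by (simp add: divide_right_mono)
      then show "\<bar>(real_of_int (W (int i)) / ?S - tap m c i) * (sh (c * i\<^sup>2) (Suc j) - g j)\<bar> \<le> 3 / ?S * (2 * B)"
        unfolding abs_mult using sh_bound[OF gj taps_pos] i S_pos by (intro mult_mono) auto
    qed
    also have "\<dots> = real m / ?S * (6 * B)" by simp
    also have "\<dots> \<le> 1 / 2 ^ m * (6 * B)" using inverse_S(2) B_ge by (intro mult_right_mono) auto
    finally have "\<bar>?fb - ?tb\<bar> \<le> 6 * B / 2 ^ m" by simp
    moreover have "e k = (real_of_int (fixed_point p (\<epsilon> (Suc j))) / ?S - \<epsilon> (Suc j)) - (target_fix (Suc j) - target (Suc j))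
        - (real_of_int (feedback j div S) / ?S - ?fb) - (?fb - ?tb)"
      using rec_real[of j] k Suc NN unfolding e_def by simp
    moreover have "(3 + 6 * B) / 2 ^ m = 3 * (1 / 2 ^ m) + 6 * B / 2 ^ m" by (simp add: add_divide_distrib)
    ultimately show ?thesis
      using fixed_point_close[of "\<epsilon> (Suc j)"] target_close[of "Suc j"] feedback_close[of j] inverse_S(1) by linarith
  qed
  have target_sum: "(\<Sum>k\<le>n. target k * x ^ k) = (\<Prod>l=1..r. 4 * real r * x ^ q - real (r + l)) / (real d * real_of_int D)" for x
  proof -
    have deg: "degree (node_poly r q r :: real poly) \<le> n"
    proof (rule order.trans[OF degree_node_poly])
      have "r * q \<le> (2 * \<kappa> * r) * q" using \<kappa> by (intro mult_right_mono) auto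
      then show "r * q \<le> n" unfolding n_def by (simp add: mult.commute)
    qed
    have "(\<Sum>k\<le>n. target k * x ^ k) = (\<Sum>k\<le>n. coeff (node_poly r q r) k * x ^ k) / (real d * real_of_int D)"
      unfolding target_def coeff_node_poly_of_int sum_divide_distrib by simp
    also have "(\<Sum>k\<le>n. coeff (node_poly r q r) k * x ^ k) = poly (node_poly r q r) x"
      unfolding poly_altdef using deg
      by (intro sum.mono_neutral_right) (auto simp: coeff_eq_0)
    finally show ?thesis unfolding poly_node_poly by simp
  qed
  define u where "u j = (real r + real j + 1 / 2) / (4 * real r)" for j :: nat
  define x where "x j = exp (- (- ln (u j) / real q))" for j
  have P: "poly (coeff_poly \<epsilon> n) y = (\<Sum>k\<le>n. \<epsilon> k * y ^ k)" for y
  proof -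
    have "{..n} = insert 0 {1..n}" by auto
    then show ?thesis unfolding coeff_poly_def by (simp add: poly_sum poly_monom \<epsilon>_def)
  qed
  have main: "0 < (-1) ^ (r - j) * poly (coeff_poly \<epsilon> n) (x j)" if j: "j \<le> r" for j
  proof -
    have c2: "c \<ge> 2" using c_ge by simp
    note nd = node_exists[OF c2 \<kappa> r j, folded u_def q_def, folded x_def m_def n_def]
    have "\<bar>(\<Sum>k\<le>n. \<epsilon> k * x j ^ k) - (\<Sum>k\<le>n. target k * x j ^ k)\<bar>
      \<le> (\<bar>1 - x j + (\<Sum>i=1..m. tap m c i * (x j ^ (c * i\<^sup>2) - x j))\<bar> * B + 2 * B * x j ^ n + (3 + 6 * B) / 2 ^ m) / (1 - x j)"
    proof (rule filtered_error_bound[where g = g and e = e])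
      show "(\<Sum>i=1..m. \<bar>tap m c i\<bar>) \<le> 1 / 2"
      proof -
        have "8 / real c \<le> 8 / 16" using c_ge by (intro divide_left_mono) auto
        then show ?thesis using tap_abs_sum_le[OF c2, of m] by simp
      qed
      show "\<bar>g k\<bar> \<le> B" if "k \<le> n" for k using that NN by (intro g_bounded) simp
      show "g 0 = \<epsilon> 0 - target 0 + e 0" unfolding e_def \<epsilon>_def by simp
      show "g (Suc k) = g k + \<epsilon> (Suc k) - target (Suc k) + e (Suc k)
        - (\<Sum>i=1..m. tap m c i * ((if c * i\<^sup>2 \<le> Suc k then g (Suc k - c * i\<^sup>2) else 0) - g k))" for k
        unfolding e_def sh_def by simp
      show "1 \<le> c * i\<^sup>2" if "i \<in> {1..m}" for i using taps_pos[of i] that by simp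
    qed (use nd e in auto)
    also have "1 - x j + (\<Sum>i=1..m. tap m c i * (x j ^ (c * i\<^sup>2) - x j)) = filter_fun m c (x j)"
      unfolding filter_fun_def ..
    also have "(\<bar>filter_fun m c (x j)\<bar> * B + 2 * B * x j ^ n + (3 + 6 * B) / 2 ^ m) / (1 - x j)
       \<le> (1 / 2 ^ m * B + 2 * B * (1 / 2 ^ m) + (3 + 6 * B) / 2 ^ m) * (3 * real q)"
      unfolding divide_inverse[of _ "1 - x j"] using nd B_ge
      by (intro mult_mono add_mono mult_left_mono) (auto simp: divide_inverse)
    also have "\<dots> = (9 * B + 3) * (12 * real c * real \<kappa>) * real r / 2 ^ m"
      unfolding q_def by (simp add: algebra_simps add_divide_distrib)
    \<comment> \<open>The assumption on the constants gives this for \<open>r = 1\<close> with a factor 2 to spare, and taking \<open>r\<close>-th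
      powers turns that factor into \<open>2^r\<close>, which absorbs the factor \<open>r\<close>.\<close>
    also have "\<dots> < 1 / (real d * 128 ^ r)"
    proof -
      define K where "K = 12 * real c * real \<kappa> * real d * (9 * B + 3)"
      have "1 * 1 * 1 * 1 * 1 \<le> K" unfolding K_def using c_ge \<kappa> d_ge B_ge by (intro mult_mono) auto
      then have K1: "1 \<le> K" by simp
      have "real r \<le> 2 ^ r" by (simp add: less_imp_le of_nat_less_two_power)
      then have "K * real r * 128 ^ r \<le> K ^ r * 2 ^ r * 128 ^ r"
        using K1 r power_increasing[of 1 r K] by (intro mult_mono) auto
      also have "\<dots> = (K * 2 * 128) ^ r" by (simp only: power_mult_distrib)
      also have "\<dots> < (2 ^ \<kappa>) ^ r"
        using \<kappa>2[folded K_def] K1 r by (intro power_strict_mono) auto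
      also have "\<dots> = 2 ^ m" unfolding m_def by (rule power_mult[symmetric])
      finally have "K * real r / 2 ^ m < 1 / 128 ^ r" by (simp add: field_simps)
      then have "K * real r / 2 ^ m / real d < 1 / 128 ^ r / real d"
        using d_ge by (intro divide_strict_right_mono) auto
      moreover have "K * real r / 2 ^ m / real d = (9 * B + 3) * (12 * real c * real \<kappa>) * real r / 2 ^ m"
        unfolding K_def using d_ge by simp
      ultimately show ?thesis by (simp add: mult.commute)
    qed
    finally have close: "\<bar>(\<Sum>k\<le>n. \<epsilon> k * x j ^ k) - (\<Sum>k\<le>n. target k * x j ^ k)\<bar> < 1 / (real d * 128 ^ r)" .
    have "1 / (real d * 128 ^ r) \<le> (-1) ^ (r - j) * (\<Sum>k\<le>n. target k * x j ^ k)"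
    proof -
      have "4 * real r * x j ^ q = real r + real j + 1 / 2" unfolding nd(3) using r by (simp add: u_def)
      then have "(\<Sum>k\<le>n. target k * x j ^ k) = (\<Prod>l=1..r. real j + 1 / 2 - real l) / (real d * real_of_int D)"
        unfolding target_sum by (simp add: algebra_simps)
      moreover have "fact r / 4 ^ r / (real d * real_of_int D) \<le> (-1) ^ (r - j) * (\<Prod>l=1..r. real j + 1 / 2 - real l) / (real d * real_of_int D)"
        using half_odd_product[OF j] D_pos by (intro divide_right_mono) auto
      moreover have "1 / (real d * 128 ^ r) \<le> fact r / 4 ^ r / (real d * real_of_int D)"
      proof -
        have "real_of_int D = (8 * real r) ^ r" unfolding D_def by simp
        then have "4 ^ r * real_of_int D = (4 * 8) ^ r * real r ^ r"
          by (simp only: power_mult_distrib mult.assoc)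
        also have "\<dots> \<le> (4 * 8) ^ r * (3 ^ r * fact r)" by (intro mult_left_mono power_self_le_fact) auto
        also have "\<dots> = (4 * 8 * 3) ^ r * fact r" by (simp only: power_mult_distrib mult.assoc)
        also have "\<dots> \<le> 128 ^ r * fact r" by (intro mult_right_mono power_mono) auto
        finally have "1 / 128 ^ r \<le> fact r / (4 ^ r * real_of_int D)" using D_pos by (simp add: field_simps)
        then have "1 / 128 ^ r / real d \<le> fact r / (4 ^ r * real_of_int D) / real d" by (rule divide_right_mono) simp
        then show ?thesis by (simp add: mult_ac)
      qed
      ultimately show ?thesis by simp
    qed
    moreover have "(-1) ^ (r - j) * (\<Sum>k\<le>n. \<epsilon> k * x j ^ k) \<ge> (-1) ^ (r - j) * (\<Sum>k\<le>n. target k * x j ^ k)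
       - \<bar>(\<Sum>k\<le>n. \<epsilon> k * x j ^ k) - (\<Sum>k\<le>n. target k * x j ^ k)\<bar>"
      by (cases "even (r - j)") auto
    ultimately show ?thesis using close unfolding P by linarith
  qed
  have "coeff_poly \<epsilon> n \<noteq> 0"
  proof
    assume "coeff_poly \<epsilon> n = 0"
    then show False using P[of 0] main[of 0] by simp
  qed
  then have fin: "finite {y. 0 \<le> y \<and> y \<le> 1 \<and> poly (coeff_poly \<epsilon> n) y = 0}"
    by (intro finite_subset[OF _ poly_roots_finite]) auto
  have q: "q > 0" unfolding q_def using c_ge \<kappa> r by simp
  have "r \<le> card {y. 0 \<le> y \<and> y \<le> 1 \<and> poly (coeff_poly \<epsilon> n) y = 0}"
  proof (rule alternation_roots[where y = x])
    show "continuous_on {0..1} (poly (coeff_poly \<epsilon> n))" by (intro continuous_intros)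
    have c2: "c \<ge> 2" using c_ge by simp
    show "0 \<le> x j \<and> x j \<le> 1" if "j \<le> r" for j
      using node_exists(1,2)[OF c2 \<kappa> r that] unfolding x_def u_def q_def by (simp add: less_imp_le)
    show "x j < x (Suc j)" for j
    proof -
      have u: "0 < u j" "u j < u (Suc j)" unfolding u_def using r by (auto simp: divide_strict_right_mono)
      then have "ln (u j) < ln (u (Suc j))" by simp
      then show ?thesis unfolding x_def using q by (simp add: divide_strict_right_mono)
    qed
  qed (use fin main in auto)
  moreover have "0 < n" unfolding n_def using q \<kappa> r by simp
  moreover have "real n \<le> 8 * real c * (real \<kappa>)\<^sup>2 * (real r)\<^sup>2"
    unfolding n_def q_def by (simp add: power2_eq_square)
  moreover have "\<epsilon> k \<in> E k" if "k \<in> {1..n}" for k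
    using lo_hi_in[of k] that unfolding \<epsilon>_def by auto
  ultimately show ?thesis unfolding is_solution_def by blast
qed

end

section \<open>Running times of programs on bounded stores\<close>

text \<open>A single bound on all cells at all times suffices for the running time, since only the size of the
  numbers matters for the cost of an operation.\<close>

definition bounded_store :: "nat \<Rightarrow> store \<Rightarrow> bool" where
  "bounded_store b s \<longleftrightarrow> (\<forall>x i. \<bar>s x i\<bar> \<le> 2 ^ b)"

fun expr_size :: "aexp \<Rightarrow> nat" where
  "expr_size (Lit c) = 1"
| "expr_size (Cell x i) = expr_size i + 1"
| "expr_size (Add e f) = expr_size e + expr_size f + 1"
| "expr_size (Sub e f) = expr_size e + expr_size f + 1"
| "expr_size (Mul e f) = expr_size e + expr_size f + 1"
| "expr_size (Div e f) = expr_size e + expr_size f + 1"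
| "expr_size (Query_min k p) = expr_size k + expr_size p + 1"
| "expr_size (Query_max k p) = expr_size k + expr_size p + 1"

text \<open>Conditions under which an expression cannot produce values with more than \<open>b\<close> times its size many
  digits: only literals and queries can introduce large numbers.\<close>

fun tame :: "(nat \<Rightarrow> real) \<Rightarrow> (nat \<Rightarrow> real) \<Rightarrow> nat \<Rightarrow> store \<Rightarrow> aexp \<Rightarrow> bool" where
  "tame lo hi b s (Lit c) \<longleftrightarrow> \<bar>c\<bar> \<le> 2 ^ b"
| "tame lo hi b s (Cell x i) \<longleftrightarrow> tame lo hi b s i"
| "tame lo hi b s (Add e f) \<longleftrightarrow> tame lo hi b s e \<and> tame lo hi b s f"
| "tame lo hi b s (Sub e f) \<longleftrightarrow> tame lo hi b s e \<and> tame lo hi b s f"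
| "tame lo hi b s (Mul e f) \<longleftrightarrow> tame lo hi b s e \<and> tame lo hi b s f"
| "tame lo hi b s (Div e f) \<longleftrightarrow> tame lo hi b s e \<and> tame lo hi b s f"
| "tame lo hi b s (Query_min k p) \<longleftrightarrow> tame lo hi b s k \<and> tame lo hi b s p \<and>
     aval lo hi s p \<le> int b \<and> \<bar>aval lo hi s (Query_min k p)\<bar> \<le> 2 ^ b"
| "tame lo hi b s (Query_max k p) \<longleftrightarrow> tame lo hi b s k \<and> tame lo hi b s p \<and>
     aval lo hi s p \<le> int b \<and> \<bar>aval lo hi s (Query_max k p)\<bar> \<le> 2 ^ b"

lemma expr_size_pos: "1 \<le> expr_size e"
  by (induction e) auto

lemma abs_int_div_le:
  fixes x y :: int
  shows "\<bar>x div y\<bar> \<le> \<bar>x\<bar>"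
proof (cases "y = 0")
  case False
  have "\<bar>real_of_int x / real_of_int y\<bar> \<le> \<bar>real_of_int x\<bar>"
  proof -
    have "1 \<le> \<bar>y\<bar>" using False by linarith
    then have "1 \<le> \<bar>real_of_int y\<bar>" by linarith
    then have "\<bar>real_of_int x\<bar> / \<bar>real_of_int y\<bar> \<le> \<bar>real_of_int x\<bar> / 1" by (intro divide_left_mono) auto
    then show ?thesis by simp
  qed
  then have "real_of_int (-\<bar>x\<bar>) \<le> real_of_int x / real_of_int y" "real_of_int x / real_of_int y \<le> real_of_int \<bar>x\<bar>"
    unfolding of_int_minus of_int_abs by linarith+
  then have "-\<bar>x\<bar> \<le> \<lfloor>real_of_int x / real_of_int y\<rfloor>" "\<lfloor>real_of_int x / real_of_int y\<rfloor> \<le> \<bar>x\<bar>"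
    by linarith+
  then show ?thesis unfolding floor_divide_of_int_eq by linarith
qed simp

lemma aval_bound:
  assumes "bounded_store b s" "b \<ge> 1" "tame lo hi b s e"
  shows "\<bar>aval lo hi s e\<bar> \<le> 2 ^ (b * expr_size e)"
  using assms(3)
proof (induction e)
  case (Cell x i)
  have "\<bar>s x (aval lo hi s i)\<bar> \<le> 2 ^ b" using assms(1) unfolding bounded_store_def by blast
  also have "(2 :: int) ^ b \<le> 2 ^ (b * (expr_size i + 1))" by (intro power_increasing) auto
  finally show ?case by simp
next
  case (Query_min k p)
  then have "\<bar>aval lo hi s (Query_min k p)\<bar> \<le> 2 ^ b" by simp
  also have "(2 :: int) ^ b \<le> 2 ^ (b * expr_size (Query_min k p))" by (intro power_increasing) auto
  finally show ?case .
next
  case (Query_max k p)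
  then have "\<bar>aval lo hi s (Query_max k p)\<bar> \<le> 2 ^ b" by simp
  also have "(2 :: int) ^ b \<le> 2 ^ (b * expr_size (Query_max k p))" by (intro power_increasing) auto
  finally show ?case .
next
  case (Lit c)
  then show ?case by simp
next
  case (Add e f)
  then have IH: "\<bar>aval lo hi s e\<bar> \<le> 2 ^ (b * expr_size e)" "\<bar>aval lo hi s f\<bar> \<le> 2 ^ (b * expr_size f)" by auto
  have "(2 :: int) ^ (b * expr_size e) \<le> 2 ^ (b * (expr_size e + expr_size f))"
    "(2 :: int) ^ (b * expr_size f) \<le> 2 ^ (b * (expr_size e + expr_size f))" by (intro power_increasing; simp)+
  then have "\<bar>aval lo hi s (Add e f)\<bar> \<le> 2 * 2 ^ (b * (expr_size e + expr_size f))" using IH unfolding aval.simps by linarith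
  also have "\<dots> \<le> (2 :: int) ^ b * 2 ^ (b * (expr_size e + expr_size f))"
    using assms(2) power_increasing[of 1 b "2 :: int"] by (intro mult_right_mono) auto
  finally show ?case by (simp add: power_add algebra_simps)
next
  case (Sub e f)
  then have IH: "\<bar>aval lo hi s e\<bar> \<le> 2 ^ (b * expr_size e)" "\<bar>aval lo hi s f\<bar> \<le> 2 ^ (b * expr_size f)" by auto
  have "(2 :: int) ^ (b * expr_size e) \<le> 2 ^ (b * (expr_size e + expr_size f))"
    "(2 :: int) ^ (b * expr_size f) \<le> 2 ^ (b * (expr_size e + expr_size f))" by (intro power_increasing; simp)+
  then have "\<bar>aval lo hi s (Sub e f)\<bar> \<le> 2 * 2 ^ (b * (expr_size e + expr_size f))" using IH unfolding aval.simps by linarith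
  also have "\<dots> \<le> (2 :: int) ^ b * 2 ^ (b * (expr_size e + expr_size f))"
    using assms(2) power_increasing[of 1 b "2 :: int"] by (intro mult_right_mono) auto
  finally show ?case by (simp add: power_add algebra_simps)
next
  case (Mul e f)
  then have "\<bar>aval lo hi s (Mul e f)\<bar> \<le> 2 ^ (b * expr_size e) * 2 ^ (b * expr_size f)"
    by (simp add: abs_mult mult_mono)
  also have "\<dots> = 2 ^ (b * (expr_size e + expr_size f))" by (simp add: power_add algebra_simps)
  also have "\<dots> \<le> (2 :: int) ^ (b * expr_size (Mul e f))" by (intro power_increasing) auto
  finally show ?case .
next
  case (Div e f)
  have "\<bar>aval lo hi s (Div e f)\<bar> \<le> \<bar>aval lo hi s e\<bar>" using abs_int_div_le by simp
  also have "\<dots> \<le> 2 ^ (b * expr_size e)" using Div by simp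
  also have "\<dots> \<le> (2 :: int) ^ (b * expr_size (Div e f))" by (intro power_increasing) (auto simp: algebra_simps)
  finally show ?case .
qed

lemma digits_bound:
  assumes "\<bar>v\<bar> \<le> 2 ^ N"
  shows "digits v \<le> N + 2"
proof -
  have "bitlen \<bar>v\<bar> \<le> int N + 1"
  proof -
    have "\<bar>v\<bar> < 2 ^ (N + 1)" using assms by (rule order.strict_trans1) simp
    moreover have "nat (int N + 1) = N + 1" by simp
    ultimately show ?thesis using bitlen_le_iff_power[of "\<bar>v\<bar>" "int N + 1"] by auto
  qed
  then show ?thesis unfolding digits_def by simp
qed

lemma digits_aval:
  assumes "bounded_store b s" "b \<ge> 1" "tame lo hi b s e" "expr_size e \<le> N"
  shows "digits (aval lo hi s e) \<le> b * N + 2"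
proof -
  have "\<bar>aval lo hi s e\<bar> \<le> 2 ^ (b * expr_size e)" using assms aval_bound by blast
  also have "\<dots> \<le> (2 :: int) ^ (b * N)" using assms(4) by (intro power_increasing mult_le_mono2) auto
  finally show ?thesis by (rule digits_bound)
qed

lemma acost_bound:
  assumes "bounded_store b s" "b \<ge> 1" "tame lo hi b s e" "expr_size e \<le> N"
  shows "acost lo hi s e \<le> 4 * expr_size e * (b * N + 2)"
  using assms(3,4)
proof (induction e)
  case (Lit c)
  then show ?case using digits_aval[OF assms(1,2), of lo hi "Lit c" N] by simp
next
  case (Cell x i)
  then show ?case using digits_aval[OF assms(1,2), of lo hi "Cell x i" N] digits_aval[OF assms(1,2), of lo hi i N]
    by (simp add: algebra_simps)
next
  case (Add e f)
  then show ?case using digits_aval[OF assms(1,2), of lo hi e N] digits_aval[OF assms(1,2), of lo hi f N]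
    by (simp add: algebra_simps)
next
  case (Sub e f)
  then show ?case using digits_aval[OF assms(1,2), of lo hi e N] digits_aval[OF assms(1,2), of lo hi f N]
    by (simp add: algebra_simps)
next
  case (Mul e f)
  then show ?case using digits_aval[OF assms(1,2), of lo hi e N] digits_aval[OF assms(1,2), of lo hi f N]
    by (simp add: algebra_simps)
next
  case (Div e f)
  then show ?case using digits_aval[OF assms(1,2), of lo hi e N] digits_aval[OF assms(1,2), of lo hi f N]
    by (simp add: algebra_simps)
next
  case (Query_min k p)
  have N1: "1 \<le> N" using Query_min.prems(2) expr_size_pos[of "Query_min k p"] by linarith
  have "nat (aval lo hi s p) \<le> b * N" using Query_min.prems N1 by (auto intro: order.trans[of _ b])
  moreover have "digits (aval lo hi s k) \<le> b * N + 2" "digits (aval lo hi s p) \<le> b * N + 2"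
    "digits (aval lo hi s (Query_min k p)) \<le> b * N + 2"
    using Query_min.prems digits_aval[OF assms(1,2)] by (auto simp del: aval.simps)
  moreover have "acost lo hi s k \<le> 4 * expr_size k * (b * N + 2)" "acost lo hi s p \<le> 4 * expr_size p * (b * N + 2)"
    using Query_min by auto
  ultimately show ?case by (simp del: aval.simps add: algebra_simps)
next
  case (Query_max k p)
  have N1: "1 \<le> N" using Query_max.prems(2) expr_size_pos[of "Query_max k p"] by linarith
  have "nat (aval lo hi s p) \<le> b * N" using Query_max.prems N1 by (auto intro: order.trans[of _ b])
  moreover have "digits (aval lo hi s k) \<le> b * N + 2" "digits (aval lo hi s p) \<le> b * N + 2"
    "digits (aval lo hi s (Query_max k p)) \<le> b * N + 2"
    using Query_max.prems digits_aval[OF assms(1,2)] by (auto simp del: aval.simps)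
  moreover have "acost lo hi s k \<le> 4 * expr_size k * (b * N + 2)" "acost lo hi s p \<le> 4 * expr_size p * (b * N + 2)"
    using Query_max by auto
  ultimately show ?case by (simp del: aval.simps add: algebra_simps)
qed

text \<open>A cost that covers every assignment and every test whose two expressions together have at most 40
  nodes; each of the nodes is charged for a bounded number of values with at most \<open>40 b + 2\<close> digits.\<close>

definition tick :: "nat \<Rightarrow> nat" where "tick b = 8000 * b"

lemma test_cost_bound:
  assumes "bounded_store b s" "b \<ge> 1" "tame lo hi b s e" "tame lo hi b s f" "expr_size e + expr_size f \<le> 40"
  shows "test_cost lo hi s e f \<le> tick b"
proof -
  define Z where "Z = b * 40 + 2"
  have "acost lo hi s e \<le> 4 * expr_size e * Z" "acost lo hi s f \<le> 4 * expr_size f * Z"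
    unfolding Z_def by (rule acost_bound[OF assms(1,2)]; use assms in simp)+
  moreover have "digits (aval lo hi s e) \<le> Z" "digits (aval lo hi s f) \<le> Z"
    unfolding Z_def by (rule digits_aval[OF assms(1,2)]; use assms in simp)+
  moreover have "4 * expr_size e * Z + 4 * expr_size f * Z \<le> 4 * 40 * Z"
    unfolding distrib_right[symmetric] using assms(5) by (intro mult_right_mono) auto
  ultimately have "test_cost lo hi s e f \<le> 162 * Z" unfolding test_cost_def by linarith
  also have "162 * Z \<le> tick b" unfolding tick_def Z_def using assms(2) by simp
  finally show ?thesis .
qed

text \<open>Weakest preconditions of loop-free programs, strengthened by the conditions under which every
  assignment and test costs at most one tick.  Loops are treated by \<open>runs_to_For\<close>, hence the value
  \<open>False\<close>.\<close>

fun wp :: "(nat \<Rightarrow> real) \<Rightarrow> (nat \<Rightarrow> real) \<Rightarrow> nat \<Rightarrow> com \<Rightarrow> (store \<Rightarrow> bool) \<Rightarrow> store \<Rightarrow> bool" where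
  "wp lo hi b Skip Q s \<longleftrightarrow> Q s"
| "wp lo hi b (Assign x i e) Q s \<longleftrightarrow> bounded_store b s \<and> tame lo hi b s i \<and> tame lo hi b s e \<and>
     expr_size i + expr_size e \<le> 40 \<and> Q (s(x := (s x)(aval lo hi s i := aval lo hi s e)))"
| "wp lo hi b (Seq c d) Q s \<longleftrightarrow> wp lo hi b c (wp lo hi b d Q) s"
| "wp lo hi b (IfLess e f c d) Q s \<longleftrightarrow> bounded_store b s \<and> tame lo hi b s e \<and> tame lo hi b s f \<and>
     expr_size e + expr_size f \<le> 40 \<and>
     (if aval lo hi s e < aval lo hi s f then wp lo hi b c Q s else wp lo hi b d Q s)"
| "wp lo hi b (WhileLess e f c) Q s \<longleftrightarrow> False"

text \<open>For a conditional, the sum of both branches is a convenient upper bound.\<close>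

fun ticks :: "com \<Rightarrow> nat" where
  "ticks Skip = 1"
| "ticks (Assign x i e) = 1"
| "ticks (Seq c d) = ticks c + ticks d"
| "ticks (IfLess e f c d) = 1 + (ticks c + ticks d)"
| "ticks (WhileLess e f c) = 0"

definition runs_to ::
    "(nat \<Rightarrow> real) \<Rightarrow> (nat \<Rightarrow> real) \<Rightarrow> nat \<Rightarrow> com \<Rightarrow> nat \<Rightarrow> (store \<Rightarrow> bool) \<Rightarrow> store \<Rightarrow> bool" where
  "runs_to lo hi b c T Q s \<longleftrightarrow> (\<exists>t s'. exec lo hi c s t s' \<and> t \<le> T * tick b \<and> Q s')"

lemma runs_to_wp:
  assumes "b \<ge> 1" "wp lo hi b c Q s"
  shows "runs_to lo hi b c (ticks c) Q s"
  unfolding runs_to_def using assms(2)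
proof (induction c arbitrary: s Q)
  case Skip
  have "1 \<le> tick b" using assms(1) unfolding tick_def by simp
  then show ?case using Skip exec.Skip[of lo hi s] by auto
next
  case (Assign x i e)
  have "test_cost lo hi s i e \<le> tick b" using Assign assms(1) by (intro test_cost_bound) auto
  then show ?case using Assign exec.Assign[of lo hi x i e s] unfolding test_cost_def by fastforce
next
  case (Seq c d)
  from Seq.IH(1)[of "wp lo hi b d Q" s] Seq.prems obtain t s'
    where 1: "exec lo hi c s t s'" "t \<le> ticks c * tick b" "wp lo hi b d Q s'" by auto
  from Seq.IH(2)[OF 1(3)] obtain t' s''
    where 2: "exec lo hi d s' t' s''" "t' \<le> ticks d * tick b" "Q s''" by auto
  have "t + t' \<le> ticks (Seq c d) * tick b" using 1(2) 2(2) by (simp add: algebra_simps)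
  then show ?case using exec.Seq[OF 1(1) 2(1)] 2(3) by blast
next
  case (IfLess e f c d)
  have tc: "test_cost lo hi s e f \<le> tick b" using IfLess.prems assms(1) by (intro test_cost_bound) auto
  show ?case
  proof (cases "aval lo hi s e < aval lo hi s f")
    case True
    with IfLess.IH(1)[of Q s] IfLess.prems obtain t s'
      where 1: "exec lo hi c s t s'" "t \<le> ticks c * tick b" "Q s'" by auto
    have "test_cost lo hi s e f + t \<le> ticks (IfLess e f c d) * tick b"
      using tc 1(2) by (simp add: algebra_simps)
    then show ?thesis using exec.IfTrue[OF True 1(1)] 1(3) by blast
  next
    case False
    with IfLess.IH(2)[of Q s] IfLess.prems obtain t s'
      where 1: "exec lo hi d s t s'" "t \<le> ticks d * tick b" "Q s'" by auto
    have "test_cost lo hi s e f + t \<le> ticks (IfLess e f c d) * tick b"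
      using tc 1(2) by (simp add: algebra_simps)
    then show ?thesis using exec.IfFalse[OF False 1(1)] 1(3) by blast
  qed
next
  case (WhileLess e f c)
  then show ?case by simp
qed

lemma runs_to_Seq:
  assumes "runs_to lo hi b c T R s" "\<And>s'. R s' \<Longrightarrow> runs_to lo hi b d T' Q s'"
  shows "runs_to lo hi b (Seq c d) (T + T') Q s"
proof -
  from assms(1) obtain t s' where 1: "exec lo hi c s t s'" "t \<le> T * tick b" "R s'"
    unfolding runs_to_def by auto
  from assms(2)[OF 1(3)] obtain t' s'' where 2: "exec lo hi d s' t' s''" "t' \<le> T' * tick b" "Q s''"
    unfolding runs_to_def by auto
  have "t + t' \<le> (T + T') * tick b" using 1(2) 2(2) by (simp add: algebra_simps)
  then show ?thesis unfolding runs_to_def using exec.Seq[OF 1(1) 2(1)] 2(3) by blast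
qed

abbreviation Var :: "vname \<Rightarrow> aexp" where "Var x \<equiv> Cell x (Lit 0)"
abbreviation Set_var :: "vname \<Rightarrow> aexp \<Rightarrow> com" where "Set_var x e \<equiv> Assign x (Lit 0) e"

definition For :: "vname \<Rightarrow> aexp \<Rightarrow> com \<Rightarrow> com" where
  "For x e c = Seq (Set_var x (Lit 0))
     (WhileLess (Var x) e (Seq c (Set_var x (Add (Var x) (Lit 1)))))"

text \<open>The invariant is stated for the store in which the counter has its new value, so that it can be
  reused for the next iteration; the test is evaluated \<open>N + 1\<close> times.\<close>

lemma runs_to_For:
  assumes b: "b \<ge> 1" and s: "bounded_store b s" and e_size: "expr_size e \<le> 38"
    and init: "Inv 0 (s(x := (s x)(0 := 0)))"
    and test: "\<And>k s. Inv k s \<Longrightarrow> bounded_store b s \<and> tame lo hi b s e \<and> aval lo hi s e = int N \<and> s x 0 = int k"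
    and body: "\<And>k s. k < N \<Longrightarrow> Inv k s \<Longrightarrow> runs_to lo hi b c T
        (\<lambda>s'. bounded_store b s' \<and> s' x 0 = int k \<and> Inv (Suc k) (s'(x := (s' x)(0 := int k + 1)))) s"
    and final: "\<And>s. Inv N s \<Longrightarrow> Q s"
  shows "runs_to lo hi b (For x e c) (2 + N * (T + 2)) Q s"
proof -
  have loop: "runs_to lo hi b (WhileLess (Var x) e (Seq c (Set_var x (Add (Var x) (Lit 1))))) (1 + (N - k) * (T + 2)) Q s"
    if "Inv k s" "k \<le> N" for k s
    using that
  proof (induction "N - k" arbitrary: k s)
    case 0
    then have k: "k = N" by simp
    have t: "bounded_store b s" "tame lo hi b s e" "aval lo hi s e = int N" "s x 0 = int k" using test[OF 0(2)] by auto
    have "test_cost lo hi s (Var x) e \<le> tick b"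
      using t b e_size by (intro test_cost_bound) auto
    moreover have "exec lo hi (WhileLess (Var x) e (Seq c (Set_var x (Add (Var x) (Lit 1))))) s (test_cost lo hi s (Var x) e) s"
      using t k by (intro exec.WhileFalse) simp
    ultimately show ?case using final[of s] 0(2) k unfolding runs_to_def by (intro exI conjI) auto
  next
    case (Suc l)
    then have k: "k < N" by simp
    have t: "bounded_store b s" "tame lo hi b s e" "aval lo hi s e = int N" "s x 0 = int k" using test[OF Suc(3)] by auto
    have tc: "test_cost lo hi s (Var x) e \<le> tick b"
      using t b e_size by (intro test_cost_bound) auto
    have true: "aval lo hi s (Var x) < aval lo hi s e" using t k by simp
    have "runs_to lo hi b (Seq c (Set_var x (Add (Var x) (Lit 1)))) (T + 1) (Inv (Suc k)) s"
    proof (rule runs_to_Seq[OF body[OF k Suc(3)]])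
      fix s' assume s': "bounded_store b s' \<and> s' x 0 = int k \<and> Inv (Suc k) (s'(x := (s' x)(0 := int k + 1)))"
      show "runs_to lo hi b (Set_var x (Add (Var x) (Lit 1))) 1 (Inv (Suc k)) s'"
        using runs_to_wp[OF b, of lo hi "Set_var x (Add (Var x) (Lit 1))" "Inv (Suc k)" s'] s' by simp
    qed
    then obtain t1 s1 where 1: "exec lo hi (Seq c (Set_var x (Add (Var x) (Lit 1)))) s t1 s1"
      "t1 \<le> (T + 1) * tick b" "Inv (Suc k) s1" unfolding runs_to_def by auto
    have "l = N - Suc k" "Suc k \<le> N" using Suc(2) k by auto
    from Suc(1)[OF this(1) 1(3) this(2)] obtain t2 s2
      where 2: "exec lo hi (WhileLess (Var x) e (Seq c (Set_var x (Add (Var x) (Lit 1))))) s1 t2 s2"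
        "t2 \<le> (1 + (N - Suc k) * (T + 2)) * tick b" "Q s2" unfolding runs_to_def by blast
    have "test_cost lo hi s (Var x) e + t1 + t2 \<le> (1 + (N - k) * (T + 2)) * tick b"
    proof -
      have "N - k = Suc (N - Suc k)" using k by simp
      then show ?thesis using tc 1(2) 2(2) by (simp add: algebra_simps)
    qed
    then show ?case using exec.WhileTrue[OF true 1(1) 2(1)] 2(3) unfolding runs_to_def by blast
  qed
  have "runs_to lo hi b (For x e c) (1 + (1 + (N - 0) * (T + 2))) Q s"
    unfolding For_def
  proof (rule runs_to_Seq[where R = "Inv 0"])
    show "runs_to lo hi b (Set_var x (Lit 0)) 1 (Inv 0) s"
      using runs_to_wp[OF b, of lo hi "Set_var x (Lit 0)" "Inv 0" s] s init by simp
  qed (rule loop, auto)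
  then show ?thesis by simp
qed

text \<open>Stores change one array at a time, which makes this the form in which boundedness is preserved
  by symbolic execution.\<close>

definition bounded_row :: "nat \<Rightarrow> (int \<Rightarrow> int) \<Rightarrow> bool" where
  "bounded_row b h \<longleftrightarrow> (\<forall>i. \<bar>h i\<bar> \<le> 2 ^ b)"

lemma bounded_row_zero: "bounded_row b (\<lambda>_. 0)"
  unfolding bounded_row_def by simp

lemma bounded_row_update: "bounded_row b h \<Longrightarrow> \<bar>v\<bar> \<le> 2 ^ b \<Longrightarrow> bounded_row b (h(i := v))"
  unfolding bounded_row_def by simp

lemma bounded_store_row: "bounded_store b s \<Longrightarrow> bounded_row b (s x)"
  unfolding bounded_store_def bounded_row_def by simp

lemma bounded_store_update:
  "bounded_store b s \<Longrightarrow> bounded_row b h \<Longrightarrow> bounded_store b (s(x := h))"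
  unfolding bounded_store_def bounded_row_def by simp

lemma runs_to_wp':
  "b \<ge> 1 \<Longrightarrow> ticks c = T \<Longrightarrow> wp lo hi b c Q s \<Longrightarrow> runs_to lo hi b c T Q s"
  using runs_to_wp by blast

lemma runs_to_mono:
  "runs_to lo hi b c T Q s \<Longrightarrow> (\<And>s'. Q s' \<Longrightarrow> R s') \<Longrightarrow> runs_to lo hi b c T R s"
  unfolding runs_to_def by blast

section \<open>The program\<close>

text \<open>Each step contracts the previous rounding error, by a factor at most 1, and adds at most 1.\<close>

fun ratio_fix :: "int \<Rightarrow> nat \<Rightarrow> nat \<Rightarrow> int" where
  "ratio_fix S m 0 = S"
| "ratio_fix S m (Suc i) = ((0 - ratio_fix S m i) * (int m - int i)) div (int m + int i + 1)"

definition tap_fix :: "int \<Rightarrow> nat \<Rightarrow> nat \<Rightarrow> nat \<Rightarrow> int" where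
  "tap_fix S m c i = (2 * ratio_fix S m i) div (1 - int c * (int i * int i))"

lemma ratio_fix_close:
  "i \<le> m \<Longrightarrow> \<bar>real_of_int (ratio_fix S m i) - real_of_int S * ((-1) ^ i * central_ratio m i)\<bar> \<le> real i"
proof (induction i)
  case (Suc i)
  let ?x = "real_of_int (ratio_fix S m i)" and ?y = "real_of_int S * ((-1) ^ i * central_ratio m i)"
  let ?\<rho> = "(real m - real i) / real (m + i + 1)"
  let ?num = "(0 - ratio_fix S m i) * (int m - int i)" and ?den = "int m + int i + 1"
  have rho: "0 \<le> ?\<rho>" "?\<rho> \<le> 1" using Suc.prems by (auto simp: divide_simps)
  have 1: "real_of_int S * ((-1) ^ Suc i * central_ratio m (Suc i)) = - ?y * ?\<rho>" by simp
  have 2: "real_of_int ?num / real_of_int ?den = - ?x * ?\<rho>" by simp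
  have "\<bar>?x - ?y\<bar> * ?\<rho> \<le> real i * 1" using Suc rho by (intro mult_mono) auto
  moreover have "\<bar>- ?x * ?\<rho> - (- ?y * ?\<rho>)\<bar> = \<bar>?x - ?y\<bar> * ?\<rho>"
  proof -
    have "- ?x * ?\<rho> - (- ?y * ?\<rho>) = - ((?x - ?y) * ?\<rho>)" by (simp only: left_diff_distrib mult_minus_left)
    then have "\<bar>- ?x * ?\<rho> - (- ?y * ?\<rho>)\<bar> = \<bar>(?x - ?y) * ?\<rho>\<bar>" by (simp only: abs_minus_cancel)
    also have "\<dots> = \<bar>?x - ?y\<bar> * ?\<rho>" using rho by (simp only: abs_mult abs_of_nonneg)
    finally show ?thesis .
  qed
  moreover have "\<bar>real_of_int (?num div ?den) - - ?x * ?\<rho>\<bar> \<le> 1"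
    using of_int_div_close[of ?num ?den] unfolding 2 .
  moreover have "\<bar>X - Y\<bar> \<le> v + 1" if "w \<le> v * 1" "\<bar>Z - Y\<bar> = w" "\<bar>X - Z\<bar> \<le> 1" for X Y Z v w :: real
    using that by linarith
  ultimately have "\<bar>real_of_int (?num div ?den) - - ?y * ?\<rho>\<bar> \<le> real i + 1" by blast
  then show ?case unfolding 1 ratio_fix.simps by simp
qed simp

lemma ratio_fix_abs_le:
  assumes "S \<ge> 0"
  shows "i \<le> m \<Longrightarrow> \<bar>ratio_fix S m i\<bar> \<le> S"
proof (induction i)
  case (Suc i)
  let ?x = "ratio_fix S m i"
  let ?num = "(0 - ?x) * (int m - int i)" and ?den = "int m + int i + 1"
  have IH: "\<bar>?x\<bar> \<le> S" using Suc by simp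
  have "\<bar>?num\<bar> = \<bar>?x\<bar> * (int m - int i)" using Suc.prems by (simp add: abs_mult)
  also have "\<dots> \<le> S * ?den" using IH assms Suc.prems by (intro mult_mono) auto
  finally have num: "\<bar>?num\<bar> \<le> S * ?den" .
  have "?num div ?den \<le> (S * ?den) div ?den" using num by (intro zdiv_mono1) auto
  moreover have "(- S * ?den) div ?den \<le> ?num div ?den" using num by (intro zdiv_mono1) auto
  moreover have "(S * ?den) div ?den = S" by (rule nonzero_mult_div_cancel_right) linarith
  moreover have "(- S * ?den) div ?den = - S" by (rule nonzero_mult_div_cancel_right) linarith
  ultimately show ?case by simp
qed (use assms in simp)

lemma tap_fix_close:
  assumes c: "c \<ge> 2" and i: "1 \<le> i" "i \<le> m"
  shows "\<bar>real_of_int (tap_fix S m c i) - real_of_int S * tap m c i\<bar> \<le> 3"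
proof -
  let ?z = "2 * ratio_fix S m i" and ?d = "1 - int c * (int i * int i)"
  have ii: "real c * (real i)\<^sup>2 \<ge> 2 * real i"
  proof -
    have "2 * (real i * 1) \<le> real c * (real i * real i)" using c i by (intro mult_mono) auto
    then show ?thesis by (simp add: power2_eq_square)
  qed
  have d: "real_of_int ?d = 1 - real c * (real i)\<^sup>2" by (simp add: power2_eq_square)
  have "\<bar>real_of_int ?z / real_of_int ?d - real_of_int S * tap m c i\<bar>
    = 2 * \<bar>real_of_int (ratio_fix S m i) - real_of_int S * ((-1) ^ i * central_ratio m i)\<bar> / \<bar>1 - real c * (real i)\<^sup>2\<bar>"
  proof -
    have "real_of_int ?z / real_of_int ?d - real_of_int S * tap m c i
      = 2 * (real_of_int (ratio_fix S m i) - real_of_int S * ((-1) ^ i * central_ratio m i)) / (1 - real c * (real i)\<^sup>2)"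
      unfolding d tap_def by (simp add: diff_divide_distrib algebra_simps)
    then show ?thesis by (simp only: abs_divide abs_mult abs_numeral)
  qed
  also have "\<dots> \<le> 2 * real i / real i"
    using ratio_fix_close[OF i(2), of S] ii i by (intro frac_le mult_left_mono) auto
  also have "\<dots> = 2" using i by simp
  finally show ?thesis using of_int_div_close[of ?z ?d] unfolding tap_fix_def by linarith
qed

lemma tap_fix_abs_le:
  assumes c: "c \<ge> 2" and i: "1 \<le> i" "i \<le> m" and S: "S \<ge> 0"
  shows "\<bar>real_of_int (tap_fix S m c i)\<bar> \<le> 4 / (real c * (real i)\<^sup>2) * real_of_int S + 1"
proof -
  let ?z = "2 * ratio_fix S m i" and ?d = "1 - int c * (int i * int i)"
  have ci: "real c * (real i)\<^sup>2 \<ge> 2 * 1" using c i by (intro mult_mono) auto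
  have d: "real_of_int ?d = 1 - real c * (real i)\<^sup>2" by (simp add: power2_eq_square)
  have "\<bar>real_of_int (ratio_fix S m i)\<bar> \<le> real_of_int S" using ratio_fix_abs_le[OF S i(2)] by linarith
  then have "\<bar>real_of_int ?z\<bar> / \<bar>real_of_int ?d\<bar> \<le> 2 * real_of_int S / (real c * (real i)\<^sup>2 / 2)"
    unfolding d using ci by (intro frac_le) (auto simp: abs_mult)
  then have "\<bar>real_of_int ?z / real_of_int ?d\<bar> \<le> 4 / (real c * (real i)\<^sup>2) * real_of_int S" by (simp add: abs_divide)
  then show ?thesis using of_int_div_close[of ?z ?d] unfolding tap_fix_def by linarith
qed

text \<open>The array \<open>f\<close> holds the coefficients of the target, \<open>w\<close> the filter weights, \<open>G\<close> the states; \<open>D\<close> is the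
  denominator \<open>(8 r)^r\<close> of the target and \<open>S\<close> the scale of the fixed-point numbers.\<close>

definition init_code :: "nat \<Rightarrow> nat \<Rightarrow> com" where
  "init_code c \<kappa> =
    Seq (Set_var ''p'' (Mul (Lit (2 * int \<kappa>)) (Var ''r'')))
   (Seq (Set_var ''m'' (Mul (Lit (int \<kappa>)) (Var ''r'')))
   (Seq (Set_var ''q'' (Mul (Lit (4 * int c * int \<kappa>)) (Var ''r'')))
   (Seq (Set_var ''n'' (Mul (Var ''q'') (Var ''p'')))
        (Set_var ''S'' (Lit 1)))))"

definition scale_code :: com where
  "scale_code = For ''i'' (Var ''p'') (Set_var ''S'' (Mul (Lit 2) (Var ''S'')))"

text \<open>Multiplication by a factor \<open>4 r x^q - (r + j + 1)\<close> in place.  The index runs downwards, so that the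
  lower coefficients that enter are still the old ones.\<close>

definition node_row_code :: com where
  "node_row_code = For ''i'' (Add (Var ''n'') (Lit 1))
     (Assign ''f'' (Sub (Var ''n'') (Var ''i''))
       (Sub (Mul (Mul (Lit 4) (Var ''r'')) (Cell ''f'' (Sub (Sub (Var ''n'') (Var ''i'')) (Var ''q''))))
            (Mul (Add (Add (Var ''r'') (Var ''j'')) (Lit 1)) (Cell ''f'' (Sub (Var ''n'') (Var ''i''))))))"

definition node_code :: com where
  "node_code =
    Seq (Seq (Set_var ''D'' (Lit 1)) (Assign ''f'' (Lit 0) (Lit 1)))
        (For ''j'' (Var ''r'') (Seq (Set_var ''D'' (Mul (Var ''D'') (Mul (Lit 8) (Var ''r'')))) node_row_code))"

definition tap_code :: "nat \<Rightarrow> com" where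
  "tap_code c =
    Seq (Set_var ''V'' (Var ''S''))
        (For ''i'' (Var ''m'')
          (Seq (Set_var ''V'' (Div (Mul (Sub (Lit 0) (Var ''V'')) (Sub (Var ''m'') (Var ''i'')))
                                   (Add (Add (Var ''m'') (Var ''i'')) (Lit 1))))
               (Assign ''w'' (Add (Var ''i'') (Lit 1))
                 (Div (Mul (Lit 2) (Var ''V''))
                      (Sub (Lit 1) (Mul (Lit (int c)) (Mul (Add (Var ''i'') (Lit 1)) (Add (Var ''i'') (Lit 1)))))))))"

definition feedback_code :: "nat \<Rightarrow> com" where
  "feedback_code c = Seq (Set_var ''acc'' (Lit 0))
     (For ''i'' (Var ''m'')
       (Set_var ''acc'' (Add (Var ''acc'')
         (Mul (Cell ''w'' (Add (Var ''i'') (Lit 1)))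
              (Sub (Cell ''G'' (Sub (Add (Var ''k'') (Lit 1))
                     (Mul (Lit (int c)) (Mul (Add (Var ''i'') (Lit 1)) (Add (Var ''i'') (Lit 1))))))
                   (Cell ''G'' (Var ''k'')))))))"

text \<open>The cells of \<open>eps\<close> are 0 initially, which already encodes the choice of the minimum.\<close>

definition choose_code :: "nat \<Rightarrow> com" where
  "choose_code d =
    Seq (IfLess (Cell ''G'' (Var ''k'')) (Lit 0)
          (Seq (Assign ''eps'' (Add (Var ''k'') (Lit 1)) (Lit 1))
               (Set_var ''x'' (Query_max (Add (Var ''k'') (Lit 1)) (Var ''p''))))
          (Set_var ''x'' (Query_min (Add (Var ''k'') (Lit 1)) (Var ''p''))))
        (Assign ''G'' (Add (Var ''k'') (Lit 1))
          (Sub (Sub (Add (Cell ''G'' (Var ''k'')) (Var ''x''))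
                    (Div (Mul (Var ''S'') (Cell ''f'' (Add (Var ''k'') (Lit 1)))) (Mul (Lit (int d)) (Var ''D''))))
               (Div (Var ''acc'') (Var ''S''))))"

definition quantise_code :: "nat \<Rightarrow> nat \<Rightarrow> com" where
  "quantise_code c d =
    Seq (Assign ''G'' (Lit 0)
          (Sub (Var ''S'') (Div (Mul (Var ''S'') (Cell ''f'' (Lit 0))) (Mul (Lit (int d)) (Var ''D'')))))
        (For ''k'' (Var ''n'') (Seq (feedback_code c) (choose_code d)))"

definition quantiser_code :: "nat \<Rightarrow> nat \<Rightarrow> nat \<Rightarrow> com" where
  "quantiser_code c d \<kappa> =
    Seq (init_code c \<kappa>) (Seq scale_code (Seq node_code (Seq (tap_code c) (quantise_code c d))))"

section \<open>Verification of the program\<close>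

text \<open>The number \<open>b\<close> bounds the digits of all numbers that occur; the assumptions cover the constants, the counters,
  the target, the accumulated feedback and the state.\<close>

locale quantiser_program = quantiser_constants +
  fixes E :: "nat \<Rightarrow> real set" and r b :: nat
  assumes range: "\<And>k. k \<ge> 1 \<Longrightarrow> E k \<subseteq> {-A..A}" and bal: "balanced E M a" and r: "r \<ge> 1"
  fixes S D :: int and m q n p :: nat and lo hi :: "nat \<Rightarrow> real"
  defines "p \<equiv> 2 * \<kappa> * r" and "S \<equiv> 2 ^ p" and "m \<equiv> \<kappa> * r" and "q \<equiv> 4 * c * \<kappa> * r"
    and "n \<equiv> q * (2 * \<kappa> * r)" and "D \<equiv> (8 * int r) ^ r"
    and "lo \<equiv> \<lambda>k. set_min (E k)" and "hi \<equiv> \<lambda>k. set_max (E k)"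
  assumes b_ge: "8 \<le> b" "4 * c * \<kappa> \<le> b" "d \<le> b" "p \<le> b"
    and b_n: "int n + 2 \<le> 2 ^ b" and b_D: "D \<le> 2 ^ b"
    and b_acc: "real m * ((real_of_int S + 1) * (2 * (B * real_of_int S))) \<le> 2 ^ b"
    and b_G: "B * real_of_int S \<le> 2 ^ b"
begin

lemma less_b: "z \<le> int b \<Longrightarrow> z \<le> 2 ^ b"
  using of_nat_less_two_power[of b, where 'a=int] by linarith

lemma b1: "1 \<le> b" using b_ge by simp

lemma sizes: "p \<le> n" "m \<le> n" "q \<le> n" "r \<le> n" "1 \<le> p" "1 \<le> q"
proof -
  have q2: "1 \<le> q" "r \<le> q" unfolding q_def using c_ge \<kappa> r by auto
  have p2: "1 \<le> p" unfolding p_def using \<kappa> r by auto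
  have n: "n = q * p" unfolding n_def p_def by simp
  show "1 \<le> p" "1 \<le> q" by fact+
  show "p \<le> n" "q \<le> n" unfolding n using q2 p2 by auto
  then show "r \<le> n" "m \<le> n" using q2 unfolding p_def m_def by auto
qed

lemma small_int: "x \<le> n + 2 \<Longrightarrow> \<bar>int x\<bar> \<le> 2 ^ b"
  using b_n by linarith

lemma lits: "\<bar>2 * int \<kappa>\<bar> \<le> 2 ^ b" "\<bar>int \<kappa>\<bar> \<le> 2 ^ b" "\<bar>4 * int c * int \<kappa>\<bar> \<le> 2 ^ b" "\<bar>int c\<bar> \<le> 2 ^ b"
  "\<bar>int d\<bar> \<le> 2 ^ b" "(1 :: int) \<le> 2 ^ b" "(2 :: int) \<le> 2 ^ b" "(4 :: int) \<le> 2 ^ b" "(8 :: int) \<le> 2 ^ b"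
proof -
  have "2 * \<kappa> \<le> 4 * c * \<kappa>" "\<kappa> \<le> 4 * c * \<kappa>" "c \<le> 4 * c * \<kappa>" using c_ge \<kappa> by auto
  then have "2 * \<kappa> \<le> b" "\<kappa> \<le> b" "c \<le> b" using b_ge(2) by linarith+
  then show "\<bar>2 * int \<kappa>\<bar> \<le> 2 ^ b" "\<bar>int \<kappa>\<bar> \<le> 2 ^ b" "\<bar>int c\<bar> \<le> 2 ^ b"
    using less_b[of "2 * int \<kappa>"] less_b[of "int \<kappa>"] less_b[of "int c"] by auto
  show "\<bar>int d\<bar> \<le> 2 ^ b" using less_b[of "int d"] b_ge(3) by auto
  have "4 * int c * int \<kappa> = int (4 * c * \<kappa>)" by simp
  also have "\<dots> \<le> 2 ^ b" using b_ge(2) by (intro less_b) (simp only: of_nat_le_iff)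
  finally show "\<bar>4 * int c * int \<kappa>\<bar> \<le> 2 ^ b" by simp
  show "(1 :: int) \<le> 2 ^ b" "(2 :: int) \<le> 2 ^ b" "(4 :: int) \<le> 2 ^ b" "(8 :: int) \<le> 2 ^ b"
    using less_b[of 1] less_b[of 2] less_b[of 4] less_b[of 8] b_ge(1) by auto
qed

lemma S_bounds: "1 \<le> S" "S + 1 \<le> 2 ^ b"
proof -
  show S1: "1 \<le> S" unfolding S_def by simp
  have "real_of_int S + 1 \<le> B * real_of_int S"
  proof -
    have "2 * real_of_int S \<le> B * real_of_int S" using B_ge S1 by (intro mult_right_mono) auto
    then show ?thesis using S1 by linarith
  qed
  then have "real_of_int (S + 1) \<le> real_of_int (2 ^ b)" using b_G by simp
  then show "S + 1 \<le> 2 ^ b" by (simp only: of_int_le_iff)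
qed

text \<open>Contents of the array \<open>f\<close> after \<open>j\<close> factors.\<close>

definition f_row :: "nat \<Rightarrow> int \<Rightarrow> int" where
  "f_row j e = (if e < 0 then 0 else coeff (node_poly r q j) (nat e))"

lemma f_row_bound: "j \<le> r \<Longrightarrow> \<bar>f_row j e\<bar> \<le> 2 ^ b"
proof -
  assume j: "j \<le> r"
  have "\<bar>f_row j e\<bar> \<le> (8 * int r) ^ j"
    unfolding f_row_def using coeff_node_poly_bound[OF j, of q "nat e"] by simp
  also have "\<dots> \<le> (8 * int r) ^ r" using j r by (intro power_increasing) auto
  finally show ?thesis using b_D unfolding D_def by simp
qed

lemma f_row_Suc:
  "e \<ge> 0 \<Longrightarrow> f_row (Suc j) e = 4 * int r * f_row j (e - int q) - (int r + int j + 1) * f_row j e"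
  unfolding f_row_def by (auto simp del: node_poly.simps simp: coeff_node_poly_Suc nat_diff_distrib)

lemma f_row_degree: "j \<le> r \<Longrightarrow> e > int n \<Longrightarrow> f_row j e = 0"
proof -
  assume j: "j \<le> r" and e: "e > int n"
  have "degree (node_poly r q j :: int poly) \<le> j * q" by (rule degree_node_poly)
  also have "\<dots> \<le> (2 * \<kappa> * r) * q"
  proof (rule mult_right_mono)
    have "1 * r \<le> 2 * \<kappa> * r" using \<kappa> by (intro mult_right_mono) auto
    then show "j \<le> 2 * \<kappa> * r" using j by linarith
  qed simp
  also have "\<dots> = n" unfolding n_def by simp
  finally have "degree (node_poly r q j :: int poly) < nat e" using e by linarith
  then show ?thesis unfolding f_row_def by (simp add: coeff_eq_0)
qed

definition env :: "store \<Rightarrow> bool" where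
  "env s \<longleftrightarrow> bounded_store b s \<and> s ''r'' 0 = int r \<and> s ''p'' 0 = int p \<and> s ''m'' 0 = int m \<and>
     s ''q'' 0 = int q \<and> s ''n'' 0 = int n"

text \<open>The arrays that the main loop relies on being 0 at the start.\<close>

definition fresh :: "store \<Rightarrow> bool" where
  "fresh s \<longleftrightarrow> s ''G'' = (\<lambda>_. 0) \<and> s ''eps'' = (\<lambda>_. 0)"

lemma env_update:
  "env s \<Longrightarrow> x \<notin> {''r'', ''p'', ''m'', ''q'', ''n''} \<Longrightarrow> bounded_row b g \<Longrightarrow> env (s(x := g))"
  unfolding env_def using bounded_store_update by auto

lemma env_row: "env s \<Longrightarrow> bounded_row b (s x)"
  unfolding env_def by (simp add: bounded_store_row)

lemma fresh_update: "fresh s \<Longrightarrow> x \<notin> {''G'', ''eps''} \<Longrightarrow> fresh (s(x := z))"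
  unfolding fresh_def by auto

lemma env_values:
  assumes "env s"
  shows "bounded_store b s" "s ''r'' 0 = int r" "s ''p'' 0 = int p" "s ''m'' 0 = int m"
    "s ''q'' 0 = int q" "s ''n'' 0 = int n"
  using assms unfolding env_def by auto

lemmas upd = env_update env_row fresh_update bounded_store_update bounded_store_row bounded_row_update

lemma init_code:
  "runs_to lo hi b (init_code c \<kappa>) 5
    (\<lambda>s. env s \<and> s ''f'' = (\<lambda>_. 0) \<and> fresh s \<and> s ''S'' 0 = 1) (input_store r)"
proof -
  let ?s0 = "input_store r"
  have b0: "bounded_store b ?s0"
    using small_int[of r] sizes unfolding bounded_store_def input_store_def by auto
  have e: "2 * int \<kappa> * int r = int p" "int \<kappa> * int r = int m" "4 * int c * int \<kappa> * int r = int q" "int q * int p = int n"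
    unfolding p_def m_def q_def n_def by auto
  have bs: "\<bar>int p\<bar> \<le> 2 ^ b" "\<bar>int m\<bar> \<le> 2 ^ b" "\<bar>int q\<bar> \<le> 2 ^ b" "\<bar>int n\<bar> \<le> 2 ^ b"
    using small_int sizes by (meson le_add1 order.trans)+
  have input: "input_store r ''r'' 0 = int r" "input_store r ''f'' = (\<lambda>_. 0)"
    "input_store r ''G'' = (\<lambda>_. 0)" "input_store r ''eps'' = (\<lambda>_. 0)"
    unfolding input_store_def by auto
  show ?thesis
    unfolding init_code_def
    by (rule runs_to_wp'[OF b1])
      (use lits bs in \<open>simp_all add: b0 bounded_store_update bounded_store_row bounded_row_update env_def fresh_def e input\<close>)
qed

lemma scale_code:
  assumes "env s \<and> s ''f'' = (\<lambda>_. 0) \<and> fresh s \<and> s ''S'' 0 = 1"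
  shows "runs_to lo hi b scale_code (2 + p * (1 + 2)) (\<lambda>s. env s \<and> s ''f'' = (\<lambda>_. 0) \<and> fresh s \<and> s ''S'' 0 = S) s"
  unfolding scale_code_def
proof (rule runs_to_For[OF b1, where Inv = "\<lambda>k s. env s \<and> s ''f'' = (\<lambda>_. 0) \<and> fresh s \<and> s ''S'' 0 = 2 ^ k \<and> s ''i'' 0 = int k"])
  fix k s
  assume k: "k < p" and s: "env s \<and> s ''f'' = (\<lambda>_. 0) \<and> fresh s \<and> s ''S'' 0 = 2 ^ k \<and> s ''i'' 0 = int k"
  have "(2 :: int) * 2 ^ k \<le> 2 ^ p" using k power_increasing[of "Suc k" p "2 :: int"] by simp
  then have S2: "\<bar>(2 :: int) * 2 ^ k\<bar> \<le> 2 ^ b" using S_bounds unfolding S_def by simp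
  have k1: "\<bar>int k + 1\<bar> \<le> 2 ^ b" using small_int[of "k + 1"] k sizes by simp
  have "bounded_store b s" using s unfolding env_def by simp
  then show "runs_to lo hi b (Set_var ''S'' (Mul (Lit 2) (Var ''S''))) 1
     (\<lambda>s'. bounded_store b s' \<and> s' ''i'' 0 = int k \<and>
       env (s'(''i'' := (s' ''i'')(0 := int k + 1))) \<and> (s'(''i'' := (s' ''i'')(0 := int k + 1))) ''f'' = (\<lambda>_. 0) \<and> fresh (s'(''i'' := (s' ''i'')(0 := int k + 1))) \<and>
       (s'(''i'' := (s' ''i'')(0 := int k + 1))) ''S'' 0 = 2 ^ Suc k \<and> (s'(''i'' := (s' ''i'')(0 := int k + 1))) ''i'' 0 = int (Suc k)) s"
    by (intro runs_to_wp'[OF b1]) (use s S2 k1 lits in \<open>simp_all add: upd\<close>)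
qed (use assms in \<open>auto simp: upd S_def env_values\<close>)

definition scaled :: "store \<Rightarrow> bool" where
  "scaled s \<longleftrightarrow> env s \<and> s ''S'' 0 = S"

lemma scaled_update:
  "scaled s \<Longrightarrow> x \<notin> {''r'', ''p'', ''m'', ''q'', ''n'', ''S''} \<Longrightarrow> bounded_row b g \<Longrightarrow> scaled (s(x := g))"
  unfolding scaled_def using env_update by auto

lemma scaled_row: "scaled s \<Longrightarrow> bounded_row b (s x)"
  unfolding scaled_def using env_row by auto

lemma scaled_values:
  assumes "scaled s"
  shows "bounded_store b s" "s ''r'' 0 = int r" "s ''p'' 0 = int p" "s ''m'' 0 = int m"
    "s ''q'' 0 = int q" "s ''n'' 0 = int n" "s ''S'' 0 = S"
  using assms env_values unfolding scaled_def by auto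

lemmas supd = scaled_update scaled_row fresh_update bounded_store_update bounded_store_row bounded_row_update

lemma node_row_code:
  assumes j: "j < r"
    and s: "scaled s \<and> fresh s \<and> s ''D'' 0 = (8 * int r) ^ Suc j \<and> s ''j'' 0 = int j \<and> s ''f'' = f_row j"
  shows "runs_to lo hi b node_row_code (2 + (n + 1) * (1 + 2))
    (\<lambda>s. scaled s \<and> fresh s \<and> s ''D'' 0 = (8 * int r) ^ Suc j \<and> s ''j'' 0 = int j \<and> s ''f'' = f_row (Suc j)) s"
proof -
  define Inv where "Inv k s \<longleftrightarrow> scaled s \<and> fresh s \<and> s ''D'' 0 = (8 * int r) ^ Suc j \<and>
    s ''j'' 0 = int j \<and> s ''i'' 0 = int k \<and> s ''f'' = (\<lambda>e. if e > int n - int k then f_row (Suc j) e else f_row j e)" for k :: nat and s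
  show ?thesis
    unfolding node_row_code_def
  proof (rule runs_to_For[OF b1, where Inv = Inv])
    show "Inv 0 (s(''i'' := (s ''i'')(0 := 0)))"
      unfolding Inv_def using s f_row_degree[of j] f_row_degree[of "Suc j"] j by (auto simp: supd)
  next
    fix k s
    assume "Inv k s"
    then show "bounded_store b s \<and> tame lo hi b s (Add (Var ''n'') (Lit 1)) \<and>
      aval lo hi s (Add (Var ''n'') (Lit 1)) = int (n + 1) \<and> s ''i'' 0 = int k"
      unfolding Inv_def using lits scaled_values[of s] by simp
  next
    fix k s
    assume k: "k < n + 1" and Inv: "Inv k s"
    define h where "h = (\<lambda>e. if e > int n - int (Suc k) then f_row (Suc j) e else f_row j e)"
    let ?e = "int n - int k"
    have e0: "?e \<ge> 0" using k by simp
    have val: "4 * int r * s ''f'' (?e - int q) - (int r + int j + 1) * s ''f'' ?e = f_row (Suc j) ?e"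
      unfolding f_row_Suc[OF e0] using Inv unfolding Inv_def by simp
    have h: "(s ''f'')(?e := f_row (Suc j) ?e) = h"
      unfolding h_def using Inv unfolding Inv_def by (auto simp: fun_eq_iff)
    have hb: "bounded_row b h"
      unfolding h_def bounded_row_def using f_row_bound[of j] f_row_bound[of "Suc j"] j by simp
    have k1: "\<bar>int k + 1\<bar> \<le> 2 ^ b" using small_int[of "k + 1"] k by simp
    have s: "scaled s" "fresh s" "s ''D'' 0 = (8 * int r) ^ Suc j" "s ''j'' 0 = int j" "s ''i'' 0 = int k"
      using Inv unfolding Inv_def by auto
    show "runs_to lo hi b (Assign ''f'' (Sub (Var ''n'') (Var ''i''))
       (Sub (Mul (Mul (Lit 4) (Var ''r'')) (Cell ''f'' (Sub (Sub (Var ''n'') (Var ''i'')) (Var ''q''))))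
            (Mul (Add (Add (Var ''r'') (Var ''j'')) (Lit 1)) (Cell ''f'' (Sub (Var ''n'') (Var ''i'')))))) 1
       (\<lambda>s'. bounded_store b s' \<and> s' ''i'' 0 = int k \<and> Inv (Suc k) (s'(''i'' := (s' ''i'')(0 := int k + 1)))) s"
      unfolding Inv_def h_def[symmetric]
      by (intro runs_to_wp'[OF b1])
        (use s val h hb k1 lits scaled_values[OF s(1)] in \<open>simp_all add: supd\<close>)
  next
    fix s
    assume "Inv (n + 1) s"
    then show "scaled s \<and> fresh s \<and> s ''D'' 0 = (8 * int r) ^ Suc j \<and> s ''j'' 0 = int j \<and> s ''f'' = f_row (Suc j)"
      unfolding Inv_def by (auto simp: f_row_def fun_eq_iff)
  qed (use s in \<open>auto simp: scaled_values\<close>)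
qed

lemma node_code:
  assumes s: "scaled s \<and> fresh s \<and> s ''f'' = (\<lambda>_. 0)"
  shows "runs_to lo hi b node_code (2 + (2 + r * ((1 + (2 + (n + 1) * (1 + 2))) + 2)))
    (\<lambda>s. scaled s \<and> fresh s \<and> s ''D'' 0 = D \<and> s ''f'' = f_row r) s"
  unfolding node_code_def
proof (rule runs_to_Seq)
  have "(\<lambda>_. 0)(0 := 1) = f_row 0" by (auto simp: fun_eq_iff f_row_def coeff_1)
  moreover have "bounded_row b (f_row 0)" unfolding bounded_row_def using f_row_bound[of 0] by simp
  ultimately show "runs_to lo hi b (Seq (Set_var ''D'' (Lit 1)) (Assign ''f'' (Lit 0) (Lit 1))) 2
     (\<lambda>s. scaled s \<and> fresh s \<and> s ''D'' 0 = 1 \<and> s ''f'' = f_row 0) s"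
    by (intro runs_to_wp'[OF b1]) (use s lits in \<open>simp_all add: supd scaled_values bounded_row_zero\<close>)
next
  fix s1
  assume s1: "scaled s1 \<and> fresh s1 \<and> s1 ''D'' 0 = 1 \<and> s1 ''f'' = f_row 0"
  define Inv where "Inv k s \<longleftrightarrow> scaled s \<and> fresh s \<and> s ''D'' 0 = (8 * int r) ^ k \<and>
    s ''j'' 0 = int k \<and> s ''f'' = f_row k" for k :: nat and s
  show "runs_to lo hi b (For ''j'' (Var ''r'') (Seq (Set_var ''D'' (Mul (Var ''D'') (Mul (Lit 8) (Var ''r'')))) node_row_code))
      (2 + r * ((1 + (2 + (n + 1) * (1 + 2))) + 2)) (\<lambda>s. scaled s \<and> fresh s \<and> s ''D'' 0 = D \<and> s ''f'' = f_row r) s1"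
  proof (rule runs_to_For[OF b1, where Inv = Inv])
    show "Inv 0 (s1(''j'' := (s1 ''j'')(0 := 0)))"
      unfolding Inv_def using s1 by (auto simp: supd)
  next
    fix k s
    assume "Inv k s"
    then show "bounded_store b s \<and> tame lo hi b s (Var ''r'') \<and> aval lo hi s (Var ''r'') = int r \<and> s ''j'' 0 = int k"
      unfolding Inv_def using scaled_values[of s] by simp
  next
    fix k s
    assume k: "k < r" and Inv: "Inv k s"
    then have s: "scaled s" "fresh s" "s ''D'' 0 = (8 * int r) ^ k" "s ''j'' 0 = int k" "s ''f'' = f_row k"
      unfolding Inv_def by auto
    have k1: "\<bar>int k + 1\<bar> \<le> 2 ^ b" using small_int[of "k + 1"] k sizes by simp
    have "(8 * int r) ^ Suc k \<le> D" unfolding D_def using k r by (intro power_increasing) auto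
    then have "\<bar>(8 * int r) ^ Suc k\<bar> \<le> 2 ^ b" using b_D by simp
    then have Db: "\<bar>(8 * int r) ^ k * (8 * int r)\<bar> \<le> 2 ^ b" by (simp only: power_Suc2)
    show "runs_to lo hi b (Seq (Set_var ''D'' (Mul (Var ''D'') (Mul (Lit 8) (Var ''r'')))) node_row_code)
       (1 + (2 + (n + 1) * (1 + 2)))
       (\<lambda>s'. bounded_store b s' \<and> s' ''j'' 0 = int k \<and> Inv (Suc k) (s'(''j'' := (s' ''j'')(0 := int k + 1)))) s"
    proof (rule runs_to_Seq)
      show "runs_to lo hi b (Set_var ''D'' (Mul (Var ''D'') (Mul (Lit 8) (Var ''r'')))) 1
        (\<lambda>s. scaled s \<and> fresh s \<and> s ''D'' 0 = (8 * int r) ^ Suc k \<and> s ''j'' 0 = int k \<and> s ''f'' = f_row k) s"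
        by (intro runs_to_wp'[OF b1])
          (use s Db lits scaled_values[OF s(1)] in \<open>simp_all add: supd power_Suc2 del: power_Suc\<close>)
    next
      fix s'
      assume s': "scaled s' \<and> fresh s' \<and> s' ''D'' 0 = (8 * int r) ^ Suc k \<and> s' ''j'' 0 = int k \<and> s' ''f'' = f_row k"
      have "runs_to lo hi b node_row_code (2 + (n + 1) * (1 + 2))
        (\<lambda>s. scaled s \<and> fresh s \<and> s ''D'' 0 = (8 * int r) ^ Suc k \<and> s ''j'' 0 = int k \<and> s ''f'' = f_row (Suc k)) s'"
        by (rule node_row_code[OF k s'])
      then show "runs_to lo hi b node_row_code (2 + (n + 1) * (1 + 2))
        (\<lambda>s'. bounded_store b s' \<and> s' ''j'' 0 = int k \<and> Inv (Suc k) (s'(''j'' := (s' ''j'')(0 := int k + 1)))) s'"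
        by (rule runs_to_mono) (use k1 in \<open>auto simp: Inv_def supd scaled_values\<close>)
    qed
  next
    fix s
    assume "Inv r s"
    then show "scaled s \<and> fresh s \<and> s ''D'' 0 = D \<and> s ''f'' = f_row r"
      unfolding Inv_def D_def by simp
  qed (use s1 in \<open>auto simp: scaled_values\<close>)
qed

definition noded :: "store \<Rightarrow> bool" where
  "noded s \<longleftrightarrow> scaled s \<and> s ''D'' 0 = D \<and> s ''f'' = f_row r"

lemma noded_update:
  "noded s \<Longrightarrow> x \<notin> {''r'', ''p'', ''m'', ''q'', ''n'', ''S'', ''D'', ''f''} \<Longrightarrow> bounded_row b g \<Longrightarrow> noded (s(x := g))"
  unfolding noded_def using scaled_update by auto

lemma noded_row: "noded s \<Longrightarrow> bounded_row b (s x)"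
  unfolding noded_def using scaled_row by auto

lemma noded_values:
  assumes "noded s"
  shows "bounded_store b s" "s ''r'' 0 = int r" "s ''p'' 0 = int p" "s ''m'' 0 = int m"
    "s ''q'' 0 = int q" "s ''n'' 0 = int n" "s ''S'' 0 = S" "s ''D'' 0 = D" "s ''f'' = f_row r"
  using assms scaled_values unfolding noded_def by auto

lemmas nupd = noded_update noded_row fresh_update bounded_store_update bounded_store_row bounded_row_update

lemma tap_fix_le: "1 \<le> i \<Longrightarrow> i \<le> m \<Longrightarrow> \<bar>tap_fix S m c i\<bar> \<le> S + 1"
proof -
  assume i: "1 \<le> i" "i \<le> m"
  have "4 * 1 \<le> real c * (real i)\<^sup>2" using c_ge i by (intro mult_mono) auto
  then have "4 / (real c * (real i)\<^sup>2) \<le> 1" by simp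
  then have "4 / (real c * (real i)\<^sup>2) * real_of_int S \<le> 1 * real_of_int S"
    using S_bounds by (intro mult_right_mono) auto
  moreover have "\<bar>real_of_int (tap_fix S m c i)\<bar> \<le> 4 / (real c * (real i)\<^sup>2) * real_of_int S + 1"
    using c_ge S_bounds i by (intro tap_fix_abs_le) auto
  ultimately show ?thesis by linarith
qed

lemma tap_code:
  assumes s: "noded s \<and> fresh s"
  shows "runs_to lo hi b (tap_code c) (1 + (2 + m * (2 + 2)))
    (\<lambda>s. noded s \<and> fresh s \<and> (\<forall>i. 1 \<le> i \<and> i \<le> m \<longrightarrow> s ''w'' (int i) = tap_fix S m c i)) s"
  unfolding tap_code_def
proof (rule runs_to_Seq)
  show "runs_to lo hi b (Set_var ''V'' (Var ''S'')) 1 (\<lambda>s. noded s \<and> fresh s \<and> s ''V'' 0 = S) s"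
    by (intro runs_to_wp'[OF b1]) (use s S_bounds in \<open>simp_all add: nupd noded_values\<close>)
next
  fix s1
  assume s1: "noded s1 \<and> fresh s1 \<and> s1 ''V'' 0 = S"
  define Inv where "Inv k s \<longleftrightarrow> noded s \<and> fresh s \<and> s ''V'' 0 = ratio_fix S m k \<and> s ''i'' 0 = int k \<and>
    (\<forall>i. 1 \<le> i \<and> i \<le> k \<longrightarrow> s ''w'' (int i) = tap_fix S m c i)" for k :: nat and s
  let ?body = "Seq (Set_var ''V'' (Div (Mul (Sub (Lit 0) (Var ''V'')) (Sub (Var ''m'') (Var ''i'')))
                                   (Add (Add (Var ''m'') (Var ''i'')) (Lit 1))))
               (Assign ''w'' (Add (Var ''i'') (Lit 1))
                 (Div (Mul (Lit 2) (Var ''V''))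
                      (Sub (Lit 1) (Mul (Lit (int c)) (Mul (Add (Var ''i'') (Lit 1)) (Add (Var ''i'') (Lit 1)))))))"
  show "runs_to lo hi b (For ''i'' (Var ''m'') ?body) (2 + m * (2 + 2))
    (\<lambda>s. noded s \<and> fresh s \<and> (\<forall>i. 1 \<le> i \<and> i \<le> m \<longrightarrow> s ''w'' (int i) = tap_fix S m c i)) s1"
  proof (rule runs_to_For[OF b1, where Inv = Inv])
    show "Inv 0 (s1(''i'' := (s1 ''i'')(0 := 0)))"
      unfolding Inv_def using s1 by (auto simp: nupd)
  next
    fix k s
    assume "Inv k s"
    then show "bounded_store b s \<and> tame lo hi b s (Var ''m'') \<and> aval lo hi s (Var ''m'') = int m \<and> s ''i'' 0 = int k"
      unfolding Inv_def using noded_values[of s] by simp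
  next
    fix k s
    assume k: "k < m" and Inv: "Inv k s"
    then have s: "noded s" "fresh s" "s ''V'' 0 = ratio_fix S m k" "s ''i'' 0 = int k"
      and w: "\<And>i. 1 \<le> i \<and> i \<le> k \<Longrightarrow> s ''w'' (int i) = tap_fix S m c i"
      unfolding Inv_def by auto
    have k1: "\<bar>int k + 1\<bar> \<le> 2 ^ b" using small_int[of "k + 1"] k sizes by simp
    have V: "((0 - ratio_fix S m k) * (int m - int k)) div (int m + int k + 1) = ratio_fix S m (Suc k)" by simp
    have Vb: "\<bar>ratio_fix S m (Suc k)\<bar> \<le> 2 ^ b"
      using ratio_fix_abs_le[of S "Suc k" m] S_bounds k by linarith
    have W: "(2 * ratio_fix S m (Suc k)) div (1 - int c * ((int k + 1) * (int k + 1))) = tap_fix S m c (Suc k)"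
      unfolding tap_fix_def by (simp add: add.commute del: ratio_fix.simps)
    have Wb: "\<bar>tap_fix S m c (Suc k)\<bar> \<le> 2 ^ b"
      using tap_fix_le[of "Suc k"] S_bounds k by linarith
    have w': "\<forall>i. 1 \<le> i \<and> i \<le> Suc k \<longrightarrow> ((s ''w'')(int k + 1 := tap_fix S m c (Suc k))) (int i) = tap_fix S m c i"
    proof (intro allI impI)
      fix i assume i: "1 \<le> i \<and> i \<le> Suc k"
      show "((s ''w'')(int k + 1 := tap_fix S m c (Suc k))) (int i) = tap_fix S m c i"
      proof (cases "i = Suc k")
        case True
        then show ?thesis by (simp add: add.commute)
      next
        case False
        then have "int i \<noteq> int k + 1" by linarith
        then show ?thesis using w[of i] i False by simp
      qed
    qed
    show "runs_to lo hi b ?body 2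
       (\<lambda>s'. bounded_store b s' \<and> s' ''i'' 0 = int k \<and> Inv (Suc k) (s'(''i'' := (s' ''i'')(0 := int k + 1)))) s"
    proof (rule runs_to_wp'[OF b1])
      have "noded (s(''V'' := (s ''V'')(0 := ratio_fix S m (Suc k))))" using s(1) Vb by (simp add: nupd del: ratio_fix.simps)
      moreover have "Inv (Suc k) (s(''V'' := (s ''V'')(0 := ratio_fix S m (Suc k)),
         ''w'' := (s ''w'')(int k + 1 := tap_fix S m c (Suc k)), ''i'' := (s ''i'')(0 := int k + 1)))"
        unfolding Inv_def using s(1,2) w' Vb Wb k1 by (simp add: nupd del: ratio_fix.simps)
      ultimately show "wp lo hi b ?body
        (\<lambda>s'. bounded_store b s' \<and> s' ''i'' 0 = int k \<and> Inv (Suc k) (s'(''i'' := (s' ''i'')(0 := int k + 1)))) s"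
        using s V W Vb Wb lits noded_values[OF s(1)] by (simp add: nupd del: ratio_fix.simps)
    qed simp
  next
    fix s
    assume "Inv m s"
    then show "noded s \<and> fresh s \<and> (\<forall>i. 1 \<le> i \<and> i \<le> m \<longrightarrow> s ''w'' (int i) = tap_fix S m c i)"
      unfolding Inv_def by simp
  qed (use s1 in \<open>auto simp: noded_values\<close>)
qed

definition feedback_sum :: "(int \<Rightarrow> int) \<Rightarrow> nat \<Rightarrow> nat \<Rightarrow> int" where
  "feedback_sum g k I = (\<Sum>i=1..I. tap_fix S m c i * (g (int k + 1 - int c * (int i)\<^sup>2) - g (int k)))"

definition target_term :: "nat \<Rightarrow> int" where
  "target_term k = (S * coeff (node_poly r q r) k) div (int d * D)"

definition step_value :: "(int \<Rightarrow> int) \<Rightarrow> nat \<Rightarrow> int" where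
  "step_value g k = g (int k) + fixed_point p (if g (int k) < 0 then hi (Suc k) else lo (Suc k))
     - target_term (Suc k) - feedback_sum g k m div S"

text \<open>The recursion as a property of the whole array, so that the real-number analysis applies to the array
  of the program at every moment of the main loop.\<close>

definition valid_upto :: "nat \<Rightarrow> (int \<Rightarrow> int) \<Rightarrow> bool" where
  "valid_upto N g \<longleftrightarrow> (\<forall>j<0. g j = 0) \<and> g 0 = S - target_term 0 \<and>
     (\<forall>k<N. g (int k + 1) = step_value g k)"

lemma valid_run:
  assumes "valid_upto N g" "N \<le> n"
  shows "quantiser_run A a M c d \<kappa> \<eta> B E r (\<lambda>i. tap_fix S m c (nat i)) g N"
proof (unfold_locales, goal_cases)
  case (4 i)
  then show ?case using tap_fix_close[of c i m S] c_ge unfolding S_def p_def m_def by simp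
next
  case (5 i)
  then show ?case using tap_fix_abs_le[of c i m S] c_ge S_bounds unfolding S_def p_def m_def by simp
next
  case 6
  show ?case using assms(1)
    unfolding valid_upto_def target_term_def S_def p_def q_def D_def by blast
next
  case (7 j)
  then show ?case using assms(1) unfolding valid_upto_def by blast
next
  case 8
  show ?case using assms(2) unfolding n_def q_def .
next
  case (9 k)
  then have "g (int k + 1) = step_value g k" using assms(1) unfolding valid_upto_def by blast
  moreover have "int (Suc k) - 1 = int k" by simp
  ultimately show ?case
    unfolding step_value_def target_term_def feedback_sum_def S_def p_def q_def m_def D_def lo_def hi_def
    by (simp only: nat_int if_False nat.distinct)
qed (use range bal r in auto)

lemma valid_bound:
  assumes "valid_upto N g" "N \<le> n" "j \<le> N"
  shows "\<bar>real_of_int (g (int j))\<bar> \<le> B * real_of_int S"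
proof -
  have S0: "0 < real_of_int S" using S_bounds by simp
  have "\<bar>real_of_int (g (int j)) / real_of_int S\<bar> \<le> B"
    using quantiser_run.g_bounded[OF valid_run[OF assms(1,2)] assms(3)]
    unfolding quantiser_run.g_def[OF valid_run[OF assms(1,2)]] S_def p_def .
  then show ?thesis using S0 by (simp add: abs_divide divide_le_eq)
qed

lemma valid_bound_int:
  assumes "valid_upto N g" "N \<le> n" "j \<le> int N"
  shows "\<bar>real_of_int (g j)\<bar> \<le> B * real_of_int S" "\<bar>g j\<bar> \<le> 2 ^ b"
proof -
  show 1: "\<bar>real_of_int (g j)\<bar> \<le> B * real_of_int S"
  proof (cases "j < 0")
    case True
    then have "g j = 0" using assms(1) unfolding valid_upto_def by blast
    then show ?thesis using B_ge S_bounds by simp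
  next
    case False
    then show ?thesis using valid_bound[OF assms(1,2), of "nat j"] assms(3) by simp
  qed
  then have "real_of_int \<bar>g j\<bar> \<le> real_of_int (2 ^ b)" using b_G by simp
  then show "\<bar>g j\<bar> \<le> 2 ^ b" by (simp only: of_int_le_iff)
qed

lemma feedback_sum_bound:
  assumes "valid_upto N g" "N \<le> n" "I \<le> m"
  shows "\<bar>feedback_sum g N I\<bar> \<le> 2 ^ b"
proof -
  let ?S = "real_of_int S"
  have "\<bar>real_of_int (feedback_sum g N I)\<bar> \<le> (\<Sum>i=1..I. (?S + 1) * (2 * (B * ?S)))"
    unfolding feedback_sum_def of_int_sum
  proof (intro order.trans[OF sum_abs] sum_mono)
    fix i assume i: "i \<in> {1..I}"
    have t: "\<bar>real_of_int (tap_fix S m c i)\<bar> \<le> ?S + 1" using tap_fix_le[of i] i assms(3) by simp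
    have "1 \<le> c * i\<^sup>2" using c_ge i by simp
    then have "1 \<le> int c * (int i)\<^sup>2" by (metis of_nat_1 of_nat_le_iff of_nat_mult of_nat_power)
    then have "int N + 1 - int c * (int i)\<^sup>2 \<le> int N" by simp
    then have "\<bar>real_of_int (g (int N + 1 - int c * (int i)\<^sup>2))\<bar> \<le> B * ?S" by (rule valid_bound_int[OF assms(1,2)])
    moreover have "\<bar>real_of_int (g (int N))\<bar> \<le> B * ?S" by (rule valid_bound_int[OF assms(1,2)]) simp
    ultimately have "\<bar>real_of_int (g (int N + 1 - int c * (int i)\<^sup>2) - g (int N))\<bar> \<le> 2 * (B * ?S)"
      unfolding of_int_diff by linarith
    then show "\<bar>real_of_int (tap_fix S m c i * (g (int N + 1 - int c * (int i)\<^sup>2) - g (int N)))\<bar> \<le> (?S + 1) * (2 * (B * ?S))"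
      unfolding of_int_mult abs_mult using t by (intro mult_mono) (use S_bounds in auto)
  qed
  also have "\<dots> = real I * ((?S + 1) * (2 * (B * ?S)))" by simp
  also have "\<dots> \<le> real m * ((?S + 1) * (2 * (B * ?S)))"
    using assms(3) S_bounds B_ge by (intro mult_right_mono) auto
  also have "\<dots> \<le> 2 ^ b" by (rule b_acc)
  finally have "real_of_int \<bar>feedback_sum g N I\<bar> \<le> real_of_int (2 ^ b)" by simp
  then show ?thesis by (simp only: of_int_le_iff)
qed

lemma feedback_sum_update:
  assumes "l \<le> k"
  shows "feedback_sum (g(int k + 1 := z)) l I = feedback_sum g l I"
  unfolding feedback_sum_def
proof (intro sum.cong refl)
  fix i assume i: "i \<in> {1..I}"
  have "1 \<le> c * i\<^sup>2" using c_ge i by simp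
  then have "1 \<le> int c * (int i)\<^sup>2" by (metis of_nat_1 of_nat_le_iff of_nat_mult of_nat_power)
  then have "int l + 1 - int c * (int i)\<^sup>2 \<noteq> int k + 1" using assms by linarith
  then show "tap_fix S m c i * ((g(int k + 1 := z)) (int l + 1 - int c * (int i)\<^sup>2) - (g(int k + 1 := z)) (int l))
    = tap_fix S m c i * (g (int l + 1 - int c * (int i)\<^sup>2) - g (int l))"
    using assms by simp
qed

text \<open>All delays are at least 1, so the new value does not disturb the relations for earlier times.\<close>

lemma valid_extend:
  assumes "valid_upto k g"
  shows "valid_upto (Suc k) (g(int k + 1 := step_value g k))"
proof -
  have *: "step_value (g(int k + 1 := z)) l = step_value g l" if "l \<le> k" for l z
    using that unfolding step_value_def feedback_sum_update[OF that] by simp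
  show ?thesis
    using assms unfolding valid_upto_def by (auto simp: * less_Suc_eq)
qed

definition quantising :: "nat \<Rightarrow> store \<Rightarrow> bool" where
  "quantising k s \<longleftrightarrow> noded s \<and> (\<forall>i. 1 \<le> i \<and> i \<le> m \<longrightarrow> s ''w'' (int i) = tap_fix S m c i) \<and>
     valid_upto k (s ''G'') \<and> s ''k'' 0 = int k \<and>
     (\<forall>l. 1 \<le> l \<longrightarrow> s ''eps'' (int l) = (if l \<le> k \<and> s ''G'' (int l - 1) < 0 then 1 else 0))"

lemma quantising_update:
  "quantising k s \<Longrightarrow> x \<notin> {''r'', ''p'', ''m'', ''q'', ''n'', ''S'', ''D'', ''f'', ''w'', ''G'', ''k'', ''eps''} \<Longrightarrow>
    bounded_row b g \<Longrightarrow> quantising k (s(x := g))"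
  unfolding quantising_def using noded_update by auto

lemmas qupd = quantising_update bounded_store_update bounded_store_row bounded_row_update

lemma feedback_code:
  assumes k: "k < n" and s: "quantising k s"
  shows "runs_to lo hi b (feedback_code c) (1 + (2 + m * (1 + 2)))
    (\<lambda>s'. quantising k s' \<and> s' ''acc'' 0 = feedback_sum (s' ''G'') k m) s"
  unfolding feedback_code_def
proof (rule runs_to_Seq)
  have "bounded_store b s" using s noded_values unfolding quantising_def by auto
  then show "runs_to lo hi b (Set_var ''acc'' (Lit 0)) 1 (\<lambda>s. quantising k s \<and> s ''acc'' 0 = 0) s"
    by (intro runs_to_wp'[OF b1]) (use s in \<open>simp_all add: qupd\<close>)
next
  fix s1
  assume s1: "quantising k s1 \<and> s1 ''acc'' 0 = 0"
  define Inv where "Inv I s \<longleftrightarrow> quantising k s \<and> s ''acc'' 0 = feedback_sum (s ''G'') k I \<and> s ''i'' 0 = int I" for I :: nat and s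
  let ?body = "Set_var ''acc'' (Add (Var ''acc'')
         (Mul (Cell ''w'' (Add (Var ''i'') (Lit 1)))
              (Sub (Cell ''G'' (Sub (Add (Var ''k'') (Lit 1))
                     (Mul (Lit (int c)) (Mul (Add (Var ''i'') (Lit 1)) (Add (Var ''i'') (Lit 1))))))
                   (Cell ''G'' (Var ''k'')))))"
  have bs: "bounded_store b s" if "quantising k s" for s
    using that noded_values unfolding quantising_def by auto
  show "runs_to lo hi b (For ''i'' (Var ''m'') ?body) (2 + m * (1 + 2))
    (\<lambda>s'. quantising k s' \<and> s' ''acc'' 0 = feedback_sum (s' ''G'') k m) s1"
  proof (rule runs_to_For[OF b1, where Inv = Inv])
    show "Inv 0 (s1(''i'' := (s1 ''i'')(0 := 0)))"
      unfolding Inv_def using s1 bs[of s1] by (simp add: qupd feedback_sum_def)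
  next
    fix I s
    assume "Inv I s"
    then show "bounded_store b s \<and> tame lo hi b s (Var ''m'') \<and> aval lo hi s (Var ''m'') = int m \<and> s ''i'' 0 = int I"
      unfolding Inv_def quantising_def using noded_values[of s] by simp
  next
    fix I s
    assume I: "I < m" and Inv: "Inv I s"
    then have s: "quantising k s" "s ''acc'' 0 = feedback_sum (s ''G'') k I" "s ''i'' 0 = int I"
      unfolding Inv_def by auto
    have w: "s ''w'' (int I + 1) = tap_fix S m c (Suc I)" and kk: "s ''k'' 0 = int k" and v: "valid_upto k (s ''G'')"
    proof -
      have "1 \<le> Suc I \<and> Suc I \<le> m \<longrightarrow> s ''w'' (int (Suc I)) = tap_fix S m c (Suc I)"
        using s(1) unfolding quantising_def by blast
      with I show "s ''w'' (int I + 1) = tap_fix S m c (Suc I)" by (simp add: add.commute)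
    qed (use s(1) in \<open>auto simp: quantising_def\<close>)
    have I1: "\<bar>int I + 1\<bar> \<le> 2 ^ b" using small_int[of "I + 1"] I sizes by simp
    have new: "feedback_sum (s ''G'') k I + tap_fix S m c (Suc I) *
        (s ''G'' (int k + 1 - int c * ((int I + 1) * (int I + 1))) - s ''G'' (int k)) = feedback_sum (s ''G'') k (Suc I)"
      unfolding feedback_sum_def by (simp add: power2_eq_square add.commute)
    have newb: "\<bar>feedback_sum (s ''G'') k (Suc I)\<bar> \<le> 2 ^ b"
      using v k I by (intro feedback_sum_bound) auto
    show "runs_to lo hi b ?body 1
       (\<lambda>s'. bounded_store b s' \<and> s' ''i'' 0 = int I \<and> Inv (Suc I) (s'(''i'' := (s' ''i'')(0 := int I + 1)))) s"
      unfolding Inv_def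
      by (intro runs_to_wp'[OF b1])
        (use s w kk new newb I1 lits bs[OF s(1)] in \<open>simp_all add: qupd\<close>)
  qed (use s1 bs in \<open>auto simp: Inv_def\<close>)
qed

text \<open>A run of 0 steps already gives access to the bounds on the minima and maxima.\<close>

lemma fixed_point_bound:
  assumes "1 \<le> k"
  shows "\<bar>fixed_point p (lo k)\<bar> \<le> 2 ^ b" "\<bar>fixed_point p (hi k)\<bar> \<le> 2 ^ b"
proof -
  have v0: "valid_upto 0 (\<lambda>j. if j = 0 then S - target_term 0 else 0)" unfolding valid_upto_def by simp
  have r: "\<bar>lo k\<bar> \<le> A \<and> \<bar>hi k\<bar> \<le> A"
    using quantiser_run.lo_hi_range[OF valid_run[OF v0] assms] unfolding lo_def hi_def by simp
  have *: "\<bar>fixed_point p v\<bar> \<le> 2 ^ b" if v: "\<bar>v\<bar> \<le> A" for v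
  proof -
    have S1: "1 \<le> real_of_int S" using S_bounds by simp
    have "\<bar>real_of_int S * v\<bar> \<le> real_of_int S * A" unfolding abs_mult using v S1 by (intro mult_mono) auto
    moreover have "fixed_point p v = \<lfloor>real_of_int S * v\<rfloor>" unfolding fixed_point_def S_def by simp
    ultimately have "\<bar>real_of_int (fixed_point p v)\<bar> \<le> real_of_int S * A + 1" by linarith
    also have "\<dots> \<le> real_of_int S * A + real_of_int S * 1" using S1 by simp
    also have "\<dots> = (A + 1) * real_of_int S" by (simp add: algebra_simps)
    also have "\<dots> \<le> B * real_of_int S"
    proof (rule mult_right_mono)
      have "1 * (A + \<eta>) \<le> (real M + 1) * (A + \<eta>)" using A eta_pos by (intro mult_right_mono) auto
      then show "A + 1 \<le> B" unfolding B_def using eta_pos by simp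
    qed (use S1 in simp)
    also have "\<dots> \<le> 2 ^ b" by (rule b_G)
    finally have "real_of_int \<bar>fixed_point p v\<bar> \<le> real_of_int (2 ^ b)" by simp
    then show ?thesis by (simp only: of_int_le_iff)
  qed
  show "\<bar>fixed_point p (lo k)\<bar> \<le> 2 ^ b" "\<bar>fixed_point p (hi k)\<bar> \<le> 2 ^ b" using r * by auto
qed

lemma choose_code:
  assumes k: "k < n" and s: "quantising k s \<and> s ''acc'' 0 = feedback_sum (s ''G'') k m"
  shows "runs_to lo hi b (choose_code d) 5
    (\<lambda>s'. bounded_store b s' \<and> s' ''k'' 0 = int k \<and> quantising (Suc k) (s'(''k'' := (s' ''k'')(0 := int k + 1)))) s"
proof -
  let ?g = "s ''G''"
  have nd: "noded s" and v: "valid_upto k ?g" and kk: "s ''k'' 0 = int k"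
    and w: "\<forall>i. 1 \<le> i \<and> i \<le> m \<longrightarrow> s ''w'' (int i) = tap_fix S m c i"
    and eps: "\<And>l. 1 \<le> l \<Longrightarrow> s ''eps'' (int l) = (if l \<le> k \<and> ?g (int l - 1) < 0 then 1 else 0)"
    using s unfolding quantising_def by auto
  have bs: "bounded_store b s" using noded_values[OF nd] by simp
  have k1: "\<bar>int k + 1\<bar> \<le> 2 ^ b" using small_int[of "k + 1"] k by simp
  have nk: "nat (int k + 1) = Suc k" by simp
  have fk: "f_row r (int k + 1) = coeff (node_poly r q r) (Suc k)" unfolding f_row_def by (simp add: nk)
  define x where "x = fixed_point p (if ?g (int k) < 0 then hi (Suc k) else lo (Suc k))"
  have xb: "\<bar>x\<bar> \<le> 2 ^ b" unfolding x_def using fixed_point_bound[of "Suc k"] by auto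
  define z where "z = step_value ?g k"
  have z: "?g (int k) + x - (S * coeff (node_poly r q r) (Suc k)) div (int d * D) - feedback_sum ?g k m div S = z"
    unfolding z_def step_value_def x_def target_term_def ..
  have vz: "valid_upto (Suc k) (?g(int k + 1 := z))" unfolding z_def by (rule valid_extend[OF v])
  have zb: "\<bar>z\<bar> \<le> 2 ^ b" using valid_bound_int(2)[OF vz, of "int k + 1"] k by simp
  define e where "e = (if ?g (int k) < 0 then (s ''eps'')(int k + 1 := 1) else s ''eps'')"
  have eb: "bounded_row b e" unfolding e_def using lits bs by (simp add: qupd)
  have fin: "quantising (Suc k) (s(''eps'' := e, ''x'' := (s ''x'')(0 := x), ''G'' := ?g(int k + 1 := z), ''k'' := (s ''k'')(0 := int k + 1)))"
  proof -
    have "e (int l) = (if l \<le> Suc k \<and> (?g(int k + 1 := z)) (int l - 1) < 0 then 1 else 0)" if "1 \<le> l" for l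
    proof (cases "l = Suc k")
      case True
      then show ?thesis using eps[of l] unfolding e_def by (simp add: add.commute)
    next
      case False
      then have "int l \<noteq> int k + 1" by linarith
      then show ?thesis using eps[OF that] False unfolding e_def by auto
    qed
    then show ?thesis
      unfolding quantising_def using vz w nd eb xb zb k1 bs by (simp add: nupd)
  qed
  have fin': "quantising (Suc k) (s(''x'' := (s ''x'')(0 := x), ''G'' := ?g(int k + 1 := z), ''k'' := (s ''k'')(0 := int k + 1)))"
    if "\<not> ?g (int k) < 0"
    using fin that unfolding e_def by simp
  show ?thesis
  proof (cases "?g (int k) < 0")
    case True
    then have e: "e = (s ''eps'')(int k + 1 := 1)" and x: "fixed_point p (hi (Suc k)) = x"
      unfolding e_def x_def by auto
    show ?thesis
      unfolding choose_code_def
      by (intro runs_to_wp'[OF b1])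
        (use True fin[unfolded e] x xb zb z k1 kk lits bs b_ge s noded_values[OF nd] in \<open>simp_all add: qupd nk fk\<close>)
  next
    case False
    then have x: "fixed_point p (lo (Suc k)) = x" unfolding x_def by auto
    show ?thesis
      unfolding choose_code_def
      by (intro runs_to_wp'[OF b1])
        (use False fin'[OF False] x xb zb z k1 kk lits bs b_ge s noded_values[OF nd] in \<open>simp_all add: qupd nk fk\<close>)
  qed
qed

lemma quantise_code:
  assumes s: "noded s \<and> fresh s \<and> (\<forall>i. 1 \<le> i \<and> i \<le> m \<longrightarrow> s ''w'' (int i) = tap_fix S m c i)"
  shows "runs_to lo hi b (quantise_code c d) (1 + (2 + n * (((1 + (2 + m * (1 + 2))) + 5) + 2))) (quantising n) s"
  unfolding quantise_code_def
proof (rule runs_to_Seq)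
  let ?z = "S - target_term 0"
  have v0: "valid_upto 0 ((\<lambda>_. 0)(0 := ?z))" unfolding valid_upto_def by simp
  have zb: "\<bar>?z\<bar> \<le> 2 ^ b" using valid_bound_int(2)[OF v0, of 0] by simp
  have z: "S - (S * f_row r 0) div (int d * D) = ?z" unfolding target_term_def f_row_def by simp
  have "noded s" "s ''G'' = (\<lambda>_. 0)" "s ''eps'' = (\<lambda>_. 0)" using s unfolding fresh_def by auto
  then show "runs_to lo hi b (Assign ''G'' (Lit 0)
          (Sub (Var ''S'') (Div (Mul (Var ''S'') (Cell ''f'' (Lit 0))) (Mul (Lit (int d)) (Var ''D''))))) 1
      (\<lambda>s. noded s \<and> s ''eps'' = (\<lambda>_. 0) \<and> s ''G'' = (\<lambda>_. 0)(0 := ?z) \<and>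
        (\<forall>i. 1 \<le> i \<and> i \<le> m \<longrightarrow> s ''w'' (int i) = tap_fix S m c i)) s"
    by (intro runs_to_wp'[OF b1])
      (use s z zb lits in \<open>simp_all add: nupd noded_values bounded_row_zero\<close>)
  fix s1
  assume s1: "noded s1 \<and> s1 ''eps'' = (\<lambda>_. 0) \<and> s1 ''G'' = (\<lambda>_. 0)(0 := ?z) \<and>
        (\<forall>i. 1 \<le> i \<and> i \<le> m \<longrightarrow> s1 ''w'' (int i) = tap_fix S m c i)"
  show "runs_to lo hi b (For ''k'' (Var ''n'') (Seq (feedback_code c) (choose_code d)))
    (2 + n * (((1 + (2 + m * (1 + 2))) + 5) + 2)) (quantising n) s1"
  proof (rule runs_to_For[OF b1, where Inv = quantising])
    show "quantising 0 (s1(''k'' := (s1 ''k'')(0 := 0)))"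
      unfolding quantising_def using s1 v0 by (simp add: nupd)
  next
    fix k s
    assume "quantising k s"
    then show "bounded_store b s \<and> tame lo hi b s (Var ''n'') \<and> aval lo hi s (Var ''n'') = int n \<and> s ''k'' 0 = int k"
      unfolding quantising_def using noded_values[of s] by simp
  next
    fix k s
    assume "k < n" "quantising k s"
    then show "runs_to lo hi b (Seq (feedback_code c) (choose_code d)) ((1 + (2 + m * (1 + 2))) + 5)
      (\<lambda>s'. bounded_store b s' \<and> s' ''k'' 0 = int k \<and> quantising (Suc k) (s'(''k'' := (s' ''k'')(0 := int k + 1)))) s"
      by (intro runs_to_Seq[OF feedback_code] choose_code)
  qed (use s1 noded_values in auto)
qed

definition total_ticks :: nat where
  "total_ticks = 5 + ((2 + p * (1 + 2)) + ((2 + (2 + r * ((1 + (2 + (n + 1) * (1 + 2))) + 2))) +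
     ((1 + (2 + m * (2 + 2))) + (1 + (2 + n * (((1 + (2 + m * (1 + 2))) + 5) + 2))))))"

lemma quantiser_code:
  "runs_to lo hi b (quantiser_code c d \<kappa>) total_ticks (quantising n) (input_store r)"
  unfolding quantiser_code_def total_ticks_def
  by (rule runs_to_Seq[OF init_code] runs_to_Seq[OF scale_code] runs_to_Seq[OF node_code] runs_to_Seq[OF tap_code] quantise_code
      | assumption | force simp: scaled_def noded_def)+

lemma output_solution:
  assumes "quantising n s"
  shows "is_solution (8 * real c * (real \<kappa>)\<^sup>2) E r (output_degree s) (output_coeff E s)"
proof -
  have v: "valid_upto n (s ''G'')" and nd: "noded s"
    and eps: "\<And>l. 1 \<le> l \<Longrightarrow> s ''eps'' (int l) = (if l \<le> n \<and> s ''G'' (int l - 1) < 0 then 1 else 0)"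
    using assms unfolding quantising_def by auto
  have deg: "output_degree s = n" unfolding output_degree_def using noded_values[OF nd] by simp
  have N: "n = 4 * c * \<kappa> * r * (2 * \<kappa> * r)" unfolding n_def q_def ..
  show ?thesis
    unfolding deg
    by (rule is_solution_cong[OF _ quantiser_run.quantised_solution[OF valid_run[OF v order.refl] N, folded N]])
      (auto simp: output_coeff_def eps)
qed

end

section \<open>Choice of the constants\<close>

text \<open>The constants \<open>c\<close> and \<open>d\<close> depend only on \<open>B\<close> and \<open>\<eta>\<close>; then \<open>\<kappa>\<close> is taken large, which is possible
  since \<open>2^\<kappa>\<close> outgrows every multiple of \<open>\<kappa>\<close>.\<close>

lemma quantiser_constants_exist:
  fixes A a :: real and M :: nat
  assumes "A > 0" "a > 0" "M \<ge> 1"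
  obtains c d \<kappa> :: nat and \<eta> B :: real where "quantiser_constants A a M c d \<kappa> \<eta> B"
proof -
  define \<eta> where "\<eta> = a / (real M + 1)"
  define B where "B = 2 + (real M + 1) * (A + \<eta>)"
  have B: "B > 0" unfolding B_def \<eta>_def using assms by (simp add: add_pos_pos)
  have \<eta>: "\<eta> > 0" unfolding \<eta>_def using assms by simp
  obtain c :: nat where c: "64 * B / \<eta> \<le> real c" using real_arch_simple by blast
  obtain d0 :: nat where d0: "4 / \<eta> \<le> real d0" using real_arch_simple by blast
  define d where "d = d0 + 2"
  define X where "X = 12 * real c * real d * (9 * B + 3) * 2 ^ 8"
  have X: "X \<ge> 0" unfolding X_def using B by simp
  obtain j0 where j0: "2 * X + 4 * (2 * B + 4) / \<eta> < 2 ^ j0" using real_arch_pow[of 2] by auto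
  define j where "j = Suc j0"
  have "(2 :: real) ^ j0 \<le> 2 ^ j" unfolding j_def by simp
  moreover have "0 \<le> 4 * (2 * B + 4) / \<eta>" using B \<eta> by simp
  ultimately have j: "2 * X \<le> 2 ^ j" "4 * (2 * B + 4) / \<eta> \<le> 2 ^ j" using j0 X by linarith+
  \<comment> \<open>An even exponent: one factor \<open>2^j\<close> beats the constant, the other one beats \<open>j\<close>.\<close>
  define \<kappa> where "\<kappa> = 2 * j"
  have pow: "(2 :: real) ^ \<kappa> = 2 ^ j * 2 ^ j" unfolding \<kappa>_def by (simp add: mult_2 power_add)
  have "4 * (2 * B + 4) / \<eta> \<le> 2 ^ \<kappa>"
    by (rule order.trans[OF j(2)]) (simp add: \<kappa>_def)
  then have 1: "(2 * B + 4) / 2 ^ \<kappa> \<le> \<eta> / 4" using \<eta> by (simp add: field_simps)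
  have "X * real \<kappa> = (2 * X) * real j" unfolding \<kappa>_def by simp
  also have "\<dots> \<le> 2 ^ j * real j" using j(1) by (intro mult_right_mono) auto
  also have "\<dots> < 2 ^ j * 2 ^ j" by (simp add: of_nat_less_two_power)
  finally have 2: "12 * real c * real \<kappa> * real d * (9 * B + 3) * 2 ^ 8 < 2 ^ \<kappa>"
    unfolding pow X_def by (simp add: mult_ac)
  have "quantiser_constants A a M c d \<kappa> \<eta> B"
    by unfold_locales (use assms c d0 1 2 in \<open>auto simp: \<eta>_def B_def d_def \<kappa>_def j_def\<close>)
  then show ?thesis by (rule that)
qed

context quantiser_constants
begin

text \<open>A multiple of \<open>r\<^sup>2\<close> digits is generous: the largest number is of the order \<open>(8 r)^r\<close> or \<open>2^(5 \<kappa> r)\<close>,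
  and estimating \<open>8 r\<close> by \<open>2^(4 r)\<close> avoids logarithms altogether.\<close>

definition bits :: nat where
  "bits = 8 * c * \<kappa>\<^sup>2 + 2 + 4 * c * \<kappa> + d + 8 + 5 * \<kappa> + nat \<lceil>4 * B\<rceil>"

lemma program_parameters:
  assumes range: "\<And>k. k \<ge> 1 \<Longrightarrow> E k \<subseteq> {-A..A}" and bal: "balanced E M a" and r: "r \<ge> 1"
  shows "quantiser_program A a M c d \<kappa> \<eta> B E r (bits * r\<^sup>2)"
proof -
  let ?b = "bits * r\<^sup>2" and ?S = "(2 :: real) ^ (2 * \<kappa> * r)"
  have r2: "1 \<le> r\<^sup>2" "r \<le> r\<^sup>2" using r by (auto simp: power2_eq_square)
  have mono: "x * r\<^sup>2 \<le> ?b" if "x \<le> bits" for x using that by (rule mult_right_mono) simp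
  have lin: "x * r \<le> x * r\<^sup>2" "x \<le> x * r\<^sup>2" for x :: nat using r2 by auto
  have pow: "real x \<le> 2 ^ x" for x :: nat by (simp add: less_imp_le of_nat_less_two_power)
  have B4: "4 * B \<le> 2 ^ nat \<lceil>4 * B\<rceil>"
    using real_nat_ceiling_ge[of "4 * B"] pow[of "nat \<lceil>4 * B\<rceil>"] by linarith
  have Bp: "B \<ge> 2" by (rule B_ge)
  have S1: "1 \<le> ?S" by simp
  have n2: "4 * c * \<kappa> * r * (2 * \<kappa> * r) + 2 \<le> ?b"
  proof -
    have "4 * c * \<kappa> * r * (2 * \<kappa> * r) + 2 \<le> (8 * c * \<kappa>\<^sup>2 + 2) * r\<^sup>2"
      using r2 by (simp add: power2_eq_square algebra_simps)
    then show ?thesis using mono[of "8 * c * \<kappa>\<^sup>2 + 2"] unfolding bits_def by linarith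
  qed
  have tot: "\<kappa> * r + 2 * (2 * \<kappa> * r) + nat \<lceil>4 * B\<rceil> \<le> ?b"
  proof -
    have "\<kappa> * r + 2 * (2 * \<kappa> * r) + nat \<lceil>4 * B\<rceil> \<le> (5 * \<kappa> + nat \<lceil>4 * B\<rceil>) * r\<^sup>2"
    proof -
      have "\<kappa> * r + 2 * (2 * \<kappa> * r) = 5 * \<kappa> * r" by simp
      then show ?thesis
        unfolding distrib_right using lin(1)[of "5 * \<kappa>"] lin(2)[of "nat \<lceil>4 * B\<rceil>"] by linarith
    qed
    then show ?thesis using mono[of "5 * \<kappa> + nat \<lceil>4 * B\<rceil>"] unfolding bits_def by linarith
  qed
  have acc: "real (\<kappa> * r) * ((?S + 1) * (2 * (B * ?S))) \<le> 2 ^ ?b"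
  proof -
    have "real (\<kappa> * r) * ((?S + 1) * (2 * (B * ?S))) \<le> 2 ^ (\<kappa> * r) * ((2 * ?S) * (2 * (B * ?S)))"
      using S1 Bp pow[of "\<kappa> * r"] by (intro mult_mono) auto
    also have "\<dots> = (4 * B) * (2 ^ (\<kappa> * r) * (?S * ?S))" by simp
    also have "\<dots> \<le> 2 ^ nat \<lceil>4 * B\<rceil> * (2 ^ (\<kappa> * r) * (?S * ?S))" using B4 by (intro mult_right_mono) auto
    also have "\<dots> = 2 ^ (\<kappa> * r + 2 * (2 * \<kappa> * r) + nat \<lceil>4 * B\<rceil>)"
      unfolding mult_2 power_add by simp
    also have "\<dots> \<le> 2 ^ ?b" using tot by (intro power_increasing) auto
    finally show ?thesis .
  qed
  have G: "B * ?S \<le> 2 ^ ?b"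
  proof -
    have "1 \<le> \<kappa> * r" using \<kappa> r by simp
    then have "1 \<le> real (\<kappa> * r)" by linarith
    then have "1 * 1 \<le> real (\<kappa> * r) * (?S + 1)" by (intro mult_mono) auto
    then have "1 * 1 * (B * ?S) \<le> real (\<kappa> * r) * (?S + 1) * (2 * (B * ?S))"
      by (rule mult_mono) (use Bp in auto)
    then show ?thesis using acc by (simp only: mult_1 mult.assoc) 
  qed
  have D: "(8 * int r) ^ r \<le> 2 ^ ?b"
  proof -
    have "int r \<le> 2 ^ r" by (simp add: less_imp_le of_nat_less_two_power)
    then have "8 * int r \<le> 2 ^ (3 + r)" by (simp add: power_add)
    also have "\<dots> \<le> 2 ^ (4 * r)" using r by (intro power_increasing) auto
    finally have "(8 * int r) ^ r \<le> (2 ^ (4 * r)) ^ r" by (intro power_mono) auto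
    also have "\<dots> = 2 ^ (4 * r\<^sup>2)" by (simp add: power_mult[symmetric] power2_eq_square)
    also have "\<dots> \<le> 2 ^ ?b" using mono[of 4] unfolding bits_def by (intro power_increasing) auto
    finally show ?thesis .
  qed
  have n2': "int (4 * c * \<kappa> * r * (2 * \<kappa> * r)) + 2 \<le> 2 ^ ?b"
  proof -
    have "int (4 * c * \<kappa> * r * (2 * \<kappa> * r) + 2) \<le> int ?b" using n2 by (simp only: of_nat_le_iff)
    also have "\<dots> \<le> 2 ^ ?b" using of_nat_less_two_power[of ?b, where 'a=int] by simp
    finally show ?thesis by simp
  qed
  have small: "8 \<le> ?b" "4 * c * \<kappa> \<le> ?b" "d \<le> ?b" "2 * \<kappa> * r \<le> ?b"
    using lin(2)[of 8] mono[of 8] lin(2)[of "4 * c * \<kappa>"] mono[of "4 * c * \<kappa>"] lin(2)[of d] mono[of d]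
      lin(1)[of "2 * \<kappa>"] mono[of "2 * \<kappa>"] unfolding bits_def by linarith+
  show ?thesis
    by unfold_locales (use range bal r acc G D n2' small in auto)
qed

text \<open>Bounds the number of ticks divided by \<open>r\<^sup>3\<close>; the nested loops for the target and for the filter
  contribute the terms of order \<open>r\<^sup>3\<close>.\<close>

definition tick_rate :: nat where
  "tick_rate = 25 + 10 * \<kappa> + 104 * c * \<kappa>\<^sup>2 + 24 * c * \<kappa>\<^sup>2 * \<kappa>"

lemma quantiser_output:
  assumes range: "\<forall>k\<ge>1. E k \<subseteq> {-A..A}" and bal: "balanced E M a" and r: "r \<ge> 1"
  shows "\<exists>t s. run_on (quantiser_code c d \<kappa>) E r t s \<and>
    real t \<le> real (8000 * bits * tick_rate) * real r ^ 5 \<and>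
    is_solution (8 * real c * (real \<kappa>)\<^sup>2) E r (output_degree s) (output_coeff E s)"
proof -
  have qp: "quantiser_program A a M c d \<kappa> \<eta> B E r (bits * r\<^sup>2)"
    using range by (intro program_parameters bal r) auto
  interpret Q: quantiser_program A a M c d \<kappa> \<eta> B E r "bits * r\<^sup>2" "2 ^ (2 * \<kappa> * r)" "(8 * int r) ^ r"
    "\<kappa> * r" "4 * c * \<kappa> * r" "4 * c * \<kappa> * r * (2 * \<kappa> * r)" "2 * \<kappa> * r" "\<lambda>k. set_min (E k)" "\<lambda>k. set_max (E k)"
    by (rule qp)
  obtain t s where ts: "exec (\<lambda>k. set_min (E k)) (\<lambda>k. set_max (E k)) (quantiser_code c d \<kappa>) (input_store r) t s"
    "t \<le> Q.total_ticks * tick (bits * r\<^sup>2)" "Q.quantising (4 * c * \<kappa> * r * (2 * \<kappa> * r)) s"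
    using Q.quantiser_code unfolding runs_to_def by auto
  have r3: "1 \<le> r ^ 3" "r \<le> r ^ 3" "r\<^sup>2 \<le> r ^ 3" using r by (auto simp: power3_eq_cube power2_eq_square)
  have "Q.total_ticks = 17 + (10 * \<kappa> + 8) * r + 80 * c * \<kappa>\<^sup>2 * r\<^sup>2 + (24 * c * \<kappa>\<^sup>2 + 24 * c * \<kappa>\<^sup>2 * \<kappa>) * r ^ 3"
    unfolding Q.total_ticks_def by (simp add: algebra_simps power2_eq_square power3_eq_cube)
  also have "\<dots> \<le> 17 * r ^ 3 + (10 * \<kappa> + 8) * r ^ 3 + 80 * c * \<kappa>\<^sup>2 * r ^ 3 + (24 * c * \<kappa>\<^sup>2 + 24 * c * \<kappa>\<^sup>2 * \<kappa>) * r ^ 3"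
    using r3 by (intro add_mono mult_left_mono) auto
  also have "\<dots> = tick_rate * r ^ 3" unfolding tick_rate_def by (simp add: algebra_simps)
  finally have "Q.total_ticks * tick (bits * r\<^sup>2) \<le> tick_rate * r ^ 3 * (8000 * (bits * r\<^sup>2))"
    unfolding tick_def by (rule mult_right_mono) simp
  also have "\<dots> = 8000 * bits * tick_rate * r ^ 5"
    using power_add[of r 3 2] by (simp add: mult_ac)
  finally have "t \<le> 8000 * bits * tick_rate * r ^ 5" using ts(2) by linarith
  then have "real t \<le> real (8000 * bits * tick_rate * r ^ 5)" by (simp only: of_nat_le_iff)
  also have "\<dots> = real (8000 * bits * tick_rate) * real r ^ 5" by (simp only: of_nat_mult of_nat_power)
  finally have "real t \<le> real (8000 * bits * tick_rate) * real r ^ 5" .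
  moreover have "is_solution (8 * real c * (real \<kappa>)\<^sup>2) E r (output_degree s) (output_coeff E s)"
    by (rule Q.output_solution[OF ts(3)])
  ultimately show ?thesis using ts(1) unfolding run_on_def by blast
qed

end

theorem mainTheorem1:
  fixes A a :: real and M :: nat
  assumes "A > 0" and "a > 0"
  shows "\<exists>C::real. C > 0 \<and>
    (\<forall>(E :: nat \<Rightarrow> real set) r::nat.
        (\<forall>k\<ge>1. E k \<subseteq> {-A..A}) \<and> balanced E M a \<and> r \<ge> 1 \<longrightarrow>
        (\<exists>(n::nat) \<epsilon>. is_solution C E r n \<epsilon>)) \<and>
    (\<exists>(prog::com) (K::real) (p::nat).
       \<forall>(E :: nat \<Rightarrow> real set) r::nat.
        (\<forall>k\<ge>1. E k \<subseteq> {-A..A}) \<and> balanced E M a \<and> r \<ge> 1 \<longrightarrow>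
        (\<exists>(t::nat) s. run_on prog E r t s \<and>
            real t \<le> K * real r ^ 5 * (1 + ln (real r)) ^ p \<and>
            is_solution C E r (output_degree s) (output_coeff E s)))"
proof (cases "M = 0")
  case True
  \<comment> \<open>An empty block has sum 0, which is not at most \<open>- a\<close>.\<close>
  have "\<not> balanced E M a" for E
    using assms(2) True unfolding balanced_def by auto
  then show ?thesis by (intro exI[of _ 1]) auto
next
  case False
  then have "M \<ge> 1" by simp
  then obtain c d \<kappa> :: nat and \<eta> B :: real where "quantiser_constants A a M c d \<kappa> \<eta> B"
    using quantiser_constants_exist[OF assms] by blast
  then interpret quantiser_constants A a M c d \<kappa> \<eta> B .
  let ?C = "8 * real c * (real \<kappa>)\<^sup>2" and ?K = "real (8000 * bits * tick_rate)"
  have out: "\<exists>t s. run_on (quantiser_code c d \<kappa>) E r t s \<and>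
      real t \<le> ?K * real r ^ 5 * (1 + ln (real r)) ^ 0 \<and>
      is_solution ?C E r (output_degree s) (output_coeff E s)"
    if "(\<forall>k\<ge>1. E k \<subseteq> {-A..A}) \<and> balanced E M a \<and> r \<ge> 1" for E r
    using quantiser_output[of E r] that unfolding power_0 mult_1_right by blast
  have "?C > 0" using c_ge \<kappa> by simp
  moreover have "\<exists>(n::nat) \<epsilon>. is_solution ?C E r n \<epsilon>"
    if "(\<forall>k\<ge>1. E k \<subseteq> {-A..A}) \<and> balanced E M a \<and> r \<ge> 1" for E and r :: nat
    using out[OF that] by blast
  ultimately show ?thesis using out by blast
qed

end
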